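(* Let $c>0$, let $M\ge1$ be an integer, let $N\ge 2M$ be a multiple of $M$, put $\varepsilon=MN^{-1}$ and $C=cN^{-1/2}$. Let $\varrho$ be a probability density on $[-c,c]$ with $\varrho(-w)=\varrho(w)$, and let $\rho(v)=N^{1/2}\varrho(N^{1/2}v)$, $|v|\le C$, be the corresponding density of $v=wN^{-1/2}$. Consider the Gaussian two-armed bandit with horizon $N$ on the set of close expectations $\Theta_N=\{\theta=(m_1,m_2):|m_1-m_2|\le 2cN^{-1/2}\}$, controlled by strategies that apply each chosen action $M$ times in a row, with prior density $\nu_a(m,v)=\kappa_a(m)\rho(v)$, where $\kappa_a$ is the uniform density on $[-a,a]$ and $a\to\infty$. For $\ell=1,2$, real $u$, and $t_1,t_2\ge\varepsilon$ that are integer multiples of $\varepsilon$ with $t=t_1+t_2\le1$, put $$g^{(\ell)}(u,t_1,t_2)=\int_0^c 2w\exp\left((-1)^{\ell}2uw-2w^2t_1t_2t^{-1}\right)\varrho(w)\,dw,$$ and define recursively $$r_\varepsilon(u,t_1,t_2)=\min_{\ell=1,2}r^{(\ell)}_\varepsilon(u,t_1,t_2),$$ where $r^{(1)}_\varepsilon(u,t_1,t_2)=r^{(2)}_\varepsilon(u,t_1,t_2)=0$ if $t_1+t_2=1$, and, if $t_1+t_2<1$, $$r^{(1)}_\varepsilon(u,t_1,t_2)=\varepsilon g^{(1)}(u,t_1,t_2)+\int_{-\infty}^{\infty}r_\varepsilon(u-x,t_1+\varepsilon,t_2)\,f_{\varepsilon t_2^2t^{-1}(t+\varepsilon)^{-1}}(x)\,dx,$$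 $$r^{(2)}_\varepsilon(u,t_1,t_2)=\varepsilon g^{(2)}(u,t_1,t_2)+\int_{-\infty}^{\infty}r_\varepsilon(u-x,t_1,t_2+\varepsilon)\,f_{\varepsilon t_1^2t^{-1}(t+\varepsilon)^{-1}}(x)\,dx.$$ Then the following strategy is Bayesian in the limit $a\to\infty$. At the initial stage $t\le2\varepsilon$ (that is, $n\le2\varepsilon N$) it applies the actions turn-by-turn (one packet of $M$ applications of each action). Afterwards, if the history is $(X_1,n_1,X_2,n_2)$ with $n_1,n_2\ge M$, $n=n_1+n_2<N$, and $t_1=n_1N^{-1}$, $t_2=n_2N^{-1}$, $u=N^{-1/2}(X_1n_2-X_2n_1)n^{-1}$, the $\ell$-th action is currently optimal if and only if $r^{(\ell)}_\varepsilon(u,t_1,t_2)$ is the smaller of $r^{(1)}_\varepsilon(u,t_1,t_2)$ and $r^{(2)}_\varepsilon(u,t_1,t_2)$ (if the two values are equal, both actions are optimal and the choice is arbitrary). The corresponding Bayesian risk $R^B_N(\rho)=\lim_{a\to\infty}R^B_N(\nu_a)$ satisfies $$N^{-1/2}R^B_N(\rho)=4\varepsilon\int_0^c w\varrho(w)\,dw+\int_{-\infty}^{\infty}r_\varepsilon(u,\varepsilon,\varepsilon)\,f_{0.5\varepsilon}(u)\,du.$$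
   Context: Notation: $f_D(x|m)=(2\pi D)^{-1/2}\exp\{-(x-m)^2/(2D)\}$ for $D>0$, and $f_D(x)=f_D(x|0)$. Gaussian two-armed bandit: at each time $n=1,\dots,N$ an action $y_n\in\{1,2\}$ is chosen and an income $\xi_n$ is received. Given $y_n=\ell$, $\xi_n$ is normal with mean $m_\ell$ and variance $1$, independently of the past. The unknown parameter is $\theta=(m_1,m_2)$, parameterized as $m_1=m+v$, $m_2=m-v$ with $|v|\le C$. Strategies: a strategy $\sigma$ assigns to each history of past actions and incomes the (possibly random) choice of the next action. Only strategies applying each chosen action $M$ times are considered: the $N$ steps are divided into $N/M$ consecutive packets of length $M$, the same action is used throughout a packet, and it is chosen on the basis of the history before the packet. Loss: $L_N(\sigma,\theta)=N\max(m_1,m_2)-\mathbb{E}_{\sigma,\theta}\left(\sum_{n=1}^N\xi_n\right)$. Bayesian risk: for a prior density $\nu(m,v)$, $R^B_N(\nu)=\inf_\sigma\iint L_N(\sigma,(m+v,m-v))\,\nu(m,v)\,dm\,dv$, the infimum being over all (possibly randomized) strategies $\sigma$ that use the same action throughout each of the $N/M$ consecutive packets of length $M$, this action being chosen on the basis of the history before the packet. History: after $n$ steps it is summarized by $(X_1,n_1,X_2,n_2)$, where $n_\ell$ is the number of applications of action $\ell$ so far ($n_1+n_2=n$) and $X_\ell$ is the total income obtained from action $\ell$. Limiting Bayesian strategy: a strategy $\sigma$ is Bayesian in the limit $a\to\infty$ if $\iint L_N(\sigma,(m+v,m-v))\,\nu_a(m,v)\,dm\,dv-R^B_N(\nu_a)\to0$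 as $a\to\infty$. For a history with $n_1,n_2\ge M$, the posterior is taken with respect to the prior that is formally constant in $m$, i.e. the posterior density of $(m,v)\in\mathbb{R}\times[-C,C]$ is proportional to $f_{n_1}(X_1|n_1(m+v))\,f_{n_2}(X_2|n_2(m-v))\,\rho(v)$. An action is currently optimal after that history if applying it in the next packet and continuing optimally minimizes, over all continuations, the posterior expected loss $\mathbb{E}\sum_{k=n+1}^{N}\left(\max(m_1,m_2)-m_{y_k}\right)$ over the remaining $N-n$ steps. *)

theory Defs
  imports "HOL-Probability.Probability"
begin

text \<open>
  Actions are the numbers 1 and 2. A history of length \<open>n\<close> is an (extensional) function on
  \<open>{0..<n}\<close>; its value at \<open>k\<close> is the pair of the action \<open>y\<^sub>k\<^sub>+\<^sub>1\<close> and the income \<open>\<xi>\<^sub>k\<^sub>+\<^sub>1\<close>.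
\<close>

type_synonym history = "nat \<Rightarrow> nat \<times> real"

abbreviation action_space :: "nat measure" where
  "action_space \<equiv> count_space {1, 2}"

definition obs_space :: "(nat \<times> real) measure" where
  "obs_space = action_space \<Otimes>\<^sub>M borel"

definition hist_space :: "nat \<Rightarrow> history measure" where
  "hist_space n = PiM {0..<n} (\<lambda>_. obs_space)"

text \<open>
  A strategy is a sequence of Markov kernels from histories to actions: \<open>\<sigma> n h\<close> is the
  distribution of the action \<open>y\<^sub>n\<^sub>+\<^sub>1\<close> after the history \<open>h\<close> of length \<open>n\<close>.
\<close>

type_synonym strategy = "nat \<Rightarrow> history \<Rightarrow> nat measure"

definition is_strategy :: "strategy \<Rightarrow> bool" where
  "is_strategy \<sigma> \<longleftrightarrow> (\<forall>n. \<sigma> n \<in> hist_space n \<rightarrow>\<^sub>M prob_algebra action_space)"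

text \<open>
  Within a packet of length \<open>M\<close> the previous action is repeated, so that a choice is made
  only at the times divisible by \<open>M\<close>.
\<close>

definition packet_strategy :: "nat \<Rightarrow> strategy \<Rightarrow> bool" where
  "packet_strategy M \<sigma> \<longleftrightarrow> is_strategy \<sigma> \<and>
     (\<forall>n. \<not> M dvd n \<longrightarrow>
        (\<forall>h \<in> space (hist_space n). \<sigma> n h = return action_space (fst (h (n - 1)))))"

fun arm_mean :: "real \<times> real \<Rightarrow> nat \<Rightarrow> real" where
  "arm_mean (m1, m2) l = (if l = 1 then m1 else m2)"

definition obs_kernel :: "strategy \<Rightarrow> real \<times> real \<Rightarrow> nat \<Rightarrow> history \<Rightarrow> (nat \<times> real) measure" where
  "obs_kernel \<sigma> \<theta> n h =
     \<sigma> n h \<bind> (\<lambda>y. distr (density lborel (normal_density (arm_mean \<theta> y) 1)) obs_space (Pair y))"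

text \<open>
  The law of the history of length \<open>n + k\<close>, given that its first \<open>n\<close> steps are \<open>h\<close>.
\<close>

definition continuation_law :: "strategy \<Rightarrow> real \<times> real \<Rightarrow> nat \<Rightarrow> nat \<Rightarrow> history \<Rightarrow> history measure" where
  "continuation_law \<sigma> \<theta> n k h = Ionescu_Tulcea.C (obs_kernel \<sigma> \<theta>) (\<lambda>_. obs_space) n k h"

definition history_law :: "strategy \<Rightarrow> real \<times> real \<Rightarrow> nat \<Rightarrow> history measure" where
  "history_law \<sigma> \<theta> n = continuation_law \<sigma> \<theta> 0 n (\<lambda>_. undefined)"

lemma measurable_obs [measurable]:
  "(\<lambda>y. distr (density lborel (normal_density (arm_mean \<theta> y) 1)) obs_space (Pair y))
     \<in> action_space \<rightarrow>\<^sub>M prob_algebra obs_space"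
proof -
  have "distr (density lborel (normal_density (arm_mean \<theta> y) 1)) obs_space (Pair y)
          \<in> space (prob_algebra obs_space)" if "y \<in> {1, 2}" for y
  proof -
    interpret prob_space "density lborel (normal_density (arm_mean \<theta> y) 1)"
      by (rule prob_space_normal_density) simp
    have "Pair y \<in> density lborel (normal_density (arm_mean \<theta> y) 1) \<rightarrow>\<^sub>M obs_space"
      using that unfolding obs_space_def by (intro measurable_Pair measurable_const) auto
    then show ?thesis
      by (simp add: space_prob_algebra prob_space_distr)
  qed
  then show ?thesis by (simp add: measurable_count_space_eq1)
qed

lemma Ionescu_Tulcea_obs_kernel:
  assumes "is_strategy \<sigma>"
  shows "Ionescu_Tulcea (obs_kernel \<sigma> \<theta>) (\<lambda>_. obs_space)"
proof -
  have *: "obs_kernel \<sigma> \<theta> n \<in> PiM {0..<n} (\<lambda>_. obs_space) \<rightarrow>\<^sub>M prob_algebra obs_space" for n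
  proof -
    have sigma: "\<sigma> n \<in> PiM {0..<n} (\<lambda>_. obs_space) \<rightarrow>\<^sub>M prob_algebra action_space"
      using assms by (simp add: is_strategy_def hist_space_def)
    have "(\<lambda>h. obs_kernel \<sigma> \<theta> n h) \<in> PiM {0..<n} (\<lambda>_. obs_space) \<rightarrow>\<^sub>M prob_algebra obs_space"
      unfolding obs_kernel_def
      by (rule measurable_bind_prob_space[OF sigma measurable_obs])
    then show ?thesis .
  qed
  show ?thesis
  proof (rule Ionescu_Tulcea.intro)
    show "obs_kernel \<sigma> \<theta> n \<in> PiM {0..<n} (\<lambda>_. obs_space) \<rightarrow>\<^sub>M subprob_algebra obs_space" for n
      using * by (rule measurable_prob_algebraD)
    show "x \<in> space (PiM {0..<n} (\<lambda>_. obs_space)) \<Longrightarrow> prob_space (obs_kernel \<sigma> \<theta> n x)" for n x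
      using measurable_space[OF *] by (auto simp: space_prob_algebra)
  qed
qed

definition loss :: "nat \<Rightarrow> strategy \<Rightarrow> real \<times> real \<Rightarrow> real" where
  "loss N \<sigma> \<theta> = real N * max (fst \<theta>) (snd \<theta>) - (\<integral>h. (\<Sum>k<N. snd (h k)) \<partial>history_law \<sigma> \<theta> N)"

text \<open>Prior densities are functions of \<open>(m, v)\<close>, where \<open>m\<^sub>1 = m + v\<close> and \<open>m\<^sub>2 = m - v\<close>.\<close>

definition bayes_loss :: "nat \<Rightarrow> (real \<times> real \<Rightarrow> real) \<Rightarrow> strategy \<Rightarrow> real" where
  "bayes_loss N \<nu> \<sigma> = (\<integral>(m, v). loss N \<sigma> (m + v, m - v) * \<nu> (m, v) \<partial>(lborel \<Otimes>\<^sub>M lborel))"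

definition bayes_risk :: "nat \<Rightarrow> nat \<Rightarrow> (real \<times> real \<Rightarrow> real) \<Rightarrow> real" where
  "bayes_risk N M \<nu> = (INF \<sigma> \<in> {\<sigma>. packet_strategy M \<sigma>}. bayes_loss N \<nu> \<sigma>)"

definition bayesian_in_limit :: "nat \<Rightarrow> nat \<Rightarrow> (real \<Rightarrow> real \<times> real \<Rightarrow> real) \<Rightarrow> strategy \<Rightarrow> bool" where
  "bayesian_in_limit N M \<nu> \<sigma> \<longleftrightarrow>
     ((\<lambda>a. bayes_loss N (\<nu> a) \<sigma> - bayes_risk N M (\<nu> a)) \<longlongrightarrow> 0) at_top"

text \<open>
  Below, \<open>varrho\<close> is the density of the normalized half-difference \<open>w\<close> on \<open>[-c, c]\<close> (its
  values elsewhere are never used), and \<open>\<rho>\<close> is the induced density of \<open>v = w / sqrt N\<close>.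
\<close>

definition uniform_dens :: "real \<Rightarrow> real \<Rightarrow> real" where
  "uniform_dens a m = indicator {-a..a} m / (2 * a)"

definition scaled_dens :: "nat \<Rightarrow> real \<Rightarrow> (real \<Rightarrow> real) \<Rightarrow> real \<Rightarrow> real" where
  "scaled_dens N c varrho v = (if \<bar>v\<bar> \<le> c / sqrt N then sqrt N * varrho (sqrt N * v) else 0)"

definition prior :: "nat \<Rightarrow> real \<Rightarrow> (real \<Rightarrow> real) \<Rightarrow> real \<Rightarrow> real \<times> real \<Rightarrow> real" where
  "prior N c varrho a = (\<lambda>(m, v). uniform_dens a m * scaled_dens N c varrho v)"

definition applications :: "nat \<Rightarrow> history \<Rightarrow> nat \<Rightarrow> nat" where
  "applications n h l = card {k. k < n \<and> fst (h k) = l}"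

definition total_income :: "nat \<Rightarrow> history \<Rightarrow> nat \<Rightarrow> real" where
  "total_income n h l = (\<Sum>k | k < n \<and> fst (h k) = l. snd (h k))"

text \<open>
  The posterior is formed with the prior that is constant in \<open>m\<close> over the whole real line.
\<close>

definition posterior_weight :: "(real \<Rightarrow> real) \<Rightarrow> nat \<Rightarrow> history \<Rightarrow> real \<times> real \<Rightarrow> real" where
  "posterior_weight \<rho> n h = (\<lambda>(m, v).
     let n1 = real (applications n h 1); n2 = real (applications n h 2) in
       normal_density (n1 * (m + v)) (sqrt n1) (total_income n h 1) *
       normal_density (n2 * (m - v)) (sqrt n2) (total_income n h 2) * \<rho> v)"

definition posterior_dens :: "(real \<Rightarrow> real) \<Rightarrow> nat \<Rightarrow> history \<Rightarrow> real \<times> real \<Rightarrow> real" where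
  "posterior_dens \<rho> n h p =
     posterior_weight \<rho> n h p / (\<integral>q. posterior_weight \<rho> n h q \<partial>(lborel \<Otimes>\<^sub>M lborel))"

definition remaining_loss :: "nat \<Rightarrow> strategy \<Rightarrow> nat \<Rightarrow> history \<Rightarrow> real \<times> real \<Rightarrow> real" where
  "remaining_loss N \<sigma> n h \<theta> =
     (\<integral>h'. (\<Sum>k = n..<N. max (fst \<theta>) (snd \<theta>) - arm_mean \<theta> (fst (h' k)))
        \<partial>continuation_law \<sigma> \<theta> n (N - n) h)"

definition posterior_loss :: "nat \<Rightarrow> (real \<Rightarrow> real) \<Rightarrow> strategy \<Rightarrow> nat \<Rightarrow> history \<Rightarrow> real" where
  "posterior_loss N \<rho> \<sigma> n h =
     (\<integral>(m, v). remaining_loss N \<sigma> n h (m + v, m - v) * posterior_dens \<rho> n h (m, v)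
        \<partial>(lborel \<Otimes>\<^sub>M lborel))"

definition currently_optimal ::
    "nat \<Rightarrow> nat \<Rightarrow> (real \<Rightarrow> real) \<Rightarrow> nat \<Rightarrow> history \<Rightarrow> nat \<Rightarrow> bool" where
  "currently_optimal N M \<rho> n h l \<longleftrightarrow>
     (\<exists>\<sigma>. packet_strategy M \<sigma> \<and> \<sigma> n h = return action_space l \<and>
        (\<forall>\<sigma>'. packet_strategy M \<sigma>' \<longrightarrow> posterior_loss N \<rho> \<sigma> n h \<le> posterior_loss N \<rho> \<sigma>' n h))"

definition g_fun :: "real \<Rightarrow> (real \<Rightarrow> real) \<Rightarrow> nat \<Rightarrow> real \<Rightarrow> real \<Rightarrow> real \<Rightarrow> real" where
  "g_fun c varrho l u t1 t2 =
     (LINT w:{0..c}|lborel.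
        2 * w * exp ((-1) ^ l * (2 * u * w) - 2 * w\<^sup>2 * t1 * t2 / (t1 + t2)) * varrho w)"

text \<open>
  \<open>r_act c varrho \<epsilon> l\<close> is \<open>r\<^sub>\<epsilon>\<close> with superscript \<open>l\<close>. For \<open>\<epsilon> > 0\<close> and multiples \<open>t1\<close>, \<open>t2\<close> of
  \<open>\<epsilon> = 1/K\<close> with \<open>t1 + t2 \<le> 1\<close> the first case is exactly \<open>t1 + t2 = 1\<close>; the other
  arguments it covers only make the function total.
  Note that \<open>normal_density\<close> takes the standard deviation, not the variance.
\<close>

function r_act :: "real \<Rightarrow> (real \<Rightarrow> real) \<Rightarrow> real \<Rightarrow> nat \<Rightarrow> real \<Rightarrow> real \<Rightarrow> real \<Rightarrow> real" where
  "r_act c varrho \<epsilon> l u t1 t2 =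
     (if \<epsilon> \<le> 0 \<or> t1 + t2 \<ge> 1 then 0
      else if l = 1 then
        \<epsilon> * g_fun c varrho 1 u t1 t2 +
        (\<integral>x. min (r_act c varrho \<epsilon> 1 (u - x) (t1 + \<epsilon>) t2) (r_act c varrho \<epsilon> 2 (u - x) (t1 + \<epsilon>) t2) *
             normal_density 0 (sqrt (\<epsilon> * t2\<^sup>2 / ((t1 + t2) * (t1 + t2 + \<epsilon>)))) x \<partial>lborel)
      else
        \<epsilon> * g_fun c varrho 2 u t1 t2 +
        (\<integral>x. min (r_act c varrho \<epsilon> 1 (u - x) t1 (t2 + \<epsilon>)) (r_act c varrho \<epsilon> 2 (u - x) t1 (t2 + \<epsilon>)) *
             normal_density 0 (sqrt (\<epsilon> * t1\<^sup>2 / ((t1 + t2) * (t1 + t2 + \<epsilon>)))) x \<partial>lborel))"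
  by pat_completeness auto
termination
proof (relation "Wellfounded.measure (\<lambda>(c, varrho, \<epsilon>, l, u, t1, t2). nat \<lceil>(1 - t1 - t2) / \<epsilon>\<rceil>)",
    goal_cases)
  have *: "\<lceil>s' / \<epsilon>\<rceil> < \<lceil>s / \<epsilon>\<rceil>" if "\<not> \<epsilon> \<le> 0" "s' = s - \<epsilon>" for s s' \<epsilon> :: real
    using that by (simp add: diff_divide_distrib)
  {
    case 1
    show ?case by simp
  next
    case 2
    then show ?case by (auto intro!: *)
  next
    case 3
    then show ?case by (auto intro!: *)
  next
    case 4
    then show ?case by (auto intro!: *)
  next
    case 5
    then show ?case by (auto intro!: *)
  }
qed

declare r_act.simps [simp del]

definition r_fun :: "real \<Rightarrow> (real \<Rightarrow> real) \<Rightarrow> real \<Rightarrow> real \<Rightarrow> real \<Rightarrow> real \<Rightarrow> real" where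
  "r_fun c varrho \<epsilon> u t1 t2 = min (r_act c varrho \<epsilon> 1 u t1 t2) (r_act c varrho \<epsilon> 2 u t1 t2)"

text \<open>
  The histories after complete packets, with each action applied in at least one packet and
  the horizon not yet reached.
\<close>

definition decision_history :: "nat \<Rightarrow> nat \<Rightarrow> nat \<Rightarrow> history \<Rightarrow> bool" where
  "decision_history N M n h \<longleftrightarrow>
     n < N \<and> M dvd n \<and> h \<in> space (hist_space n) \<and>
     (\<forall>j < n. \<forall>k < n. j div M = k div M \<longrightarrow> fst (h j) = fst (h k)) \<and>
     applications n h 1 \<ge> M \<and> applications n h 2 \<ge> M"

definition smaller_r :: "nat \<Rightarrow> nat \<Rightarrow> real \<Rightarrow> (real \<Rightarrow> real) \<Rightarrow> nat \<Rightarrow> history \<Rightarrow> nat \<Rightarrow> bool" where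
  "smaller_r N M c varrho n h l \<longleftrightarrow>
     (let \<epsilon> = real M / real N;
          n1 = real (applications n h 1); n2 = real (applications n h 2);
          t1 = n1 / real N; t2 = n2 / real N;
          u = (total_income n h 1 * n2 - total_income n h 2 * n1) / (sqrt N * real n)
      in r_act c varrho \<epsilon> l u t1 t2 = r_fun c varrho \<epsilon> u t1 t2)"

text \<open>
  The order of the two initial packets is left open, and so is the (possibly randomized)
  choice in the case of equality.
\<close>

definition limiting_strategy :: "nat \<Rightarrow> nat \<Rightarrow> real \<Rightarrow> (real \<Rightarrow> real) \<Rightarrow> strategy \<Rightarrow> bool" where
  "limiting_strategy N M c varrho \<sigma> \<longleftrightarrow> packet_strategy M \<sigma> \<and>
     (\<exists>l \<in> {1, 2}.
        (\<forall>h \<in> space (hist_space 0). \<sigma> 0 h = return action_space l) \<and>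
        (\<forall>h \<in> space (hist_space M). \<sigma> M h = return action_space (3 - l))) \<and>
     (\<forall>n h. decision_history N M n h \<longrightarrow>
        (\<forall>l \<in> {1, 2}. measure (\<sigma> n h) {l} > 0 \<longrightarrow> smaller_r N M c varrho n h l))"

end

theory Submission
  imports Defs
begin

text \<open>
  Take the prior that is constant in \<open>m\<close>. The likelihood of a history, integrated over \<open>m\<close>, is a
  factor free of \<open>v\<close> (its value at \<open>v = 0\<close>, a product of predictive densities) times
  \<open>exp (2 u w - 2 w\<^sup>2 t\<^sub>1 t\<^sub>2 / t)\<close> with \<open>w = v sqrt N\<close>. Hence a history matters only through
  \<open>(u, t\<^sub>1, t\<^sub>2)\<close>, and under the predictive law \<open>u\<close> is a Gaussian walk whose variances telescope.
  Backward induction over single steps shows that the posterior loss of a packet strategy, weighted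
  by the likelihood, is at least the predictive density times \<open>sqrt N r\<^sub>\<epsilon>(u, t\<^sub>1, t\<^sub>2)\<close>, with equality
  if an action with the smaller value is always chosen. As long as only one arm is known, an
  interchange argument shows that it is optimal to switch at once.

  For the proper prior on \<open>[-a, a]\<close>, replace the truncation \<open>\<bar>m\<bar> \<le> a\<close> by \<open>\<bar>x\<bar> \<le> a\<close>, where \<open>x\<close> is the
  first income. As \<open>x - m\<close> has a law not depending on \<open>m\<close>, this changes the unnormalized loss by an amount
  bounded in \<open>a\<close>, and the loss by \<open>O(1/a)\<close>. Given \<open>x\<close>, the analysis of the constant prior applies,
  and the optimal value does not depend on \<open>x\<close>.
\<close>

section \<open>Convolution with centered normal laws\<close>

text \<open>The recursion covers only histories in which both arms have been applied, but competing
  strategies may stay with one arm for many packets. The value has to be extended to such histories,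
  and there the optimality of switching is not built into a minimum: it rests on
  \<open>u = 0\<close> and on the evenness of the prior, which make both arms equally costly while
  nothing is known about \<open>w\<close>. Choices are made once per packet but the laws are built
  step by step, so the value is also needed inside a packet, as a function of the applications still
  owed. What makes all this consistent is that the information \<open>t1 t2 / t\<close> about
  \<open>w\<close> grows exactly by the variance of the change of \<open>u\<close>. Hence the
  expected loss rate is a martingale, a packet costs \<open>M\<close> times its first application,
  and the total variance does not depend on the order of the arms. The constant prior is improper,
  but one income makes the likelihood integrable in \<open>m\<close>; therefore the induction goes
  back to time 1 only, and the first step is taken under the proper prior. Unnormalized losses in
  \<open>ennreal\<close> keep normalization and integrability out of the exchanges of
  integrals.\<close>

lemma nn_integral_normal_density:
  assumes "0 < \<sigma>"
  shows "(\<integral>\<^sup>+x. ennreal (normal_density \<mu> \<sigma> x) \<partial>lborel) = 1"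
  using assms by (subst nn_integral_eq_integral) auto

text \<open>Completing the square: tilting a centered normal density by an exponential shifts its
  mean.\<close>

lemma normal_density_times_exp:
  assumes "0 < \<sigma>"
  shows "normal_density 0 \<sigma> x * exp (s * x) = exp (s\<^sup>2 * \<sigma>\<^sup>2 / 2) * normal_density (s * \<sigma>\<^sup>2) \<sigma> x"
proof -
  have "- x\<^sup>2 / (2 * \<sigma>\<^sup>2) + s * x = s\<^sup>2 * \<sigma>\<^sup>2 / 2 + - (x - s * \<sigma>\<^sup>2)\<^sup>2 / (2 * \<sigma>\<^sup>2)"
    using assms by (simp add: field_simps power2_eq_square)
  then show ?thesis
    by (simp add: normal_density_def flip: exp_add)
qed

lemma nn_integral_normal_density_exp:
  assumes "0 < \<sigma>"
  shows "(\<integral>\<^sup>+x. ennreal (normal_density 0 \<sigma> x * exp (s * x)) \<partial>lborel) = ennreal (exp (s\<^sup>2 * \<sigma>\<^sup>2 / 2))"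
  using assms
  by (simp add: normal_density_times_exp ennreal_mult nn_integral_cmult nn_integral_normal_density)

text \<open>\<open>D = 0\<close> stands for the point mass, whereas \<open>normal_density 0 0\<close> is the zero function.\<close>

definition gconv :: "real \<Rightarrow> (real \<Rightarrow> real) \<Rightarrow> real \<Rightarrow> real" where
  "gconv D F u = (if D = 0 then F u else (\<integral>x. F (u - x) * normal_density 0 (sqrt D) x \<partial>lborel))"

text \<open>This class contains the loss rates \<open>g_fun\<close> (with \<open>s = 2 * c\<close>)
  and is closed under all that the recursion does: sums, minima, nonnegative multiples and Gaussian
  convolution. It guarantees that the integrals of the recursion are finite, so that none of them is
  0 merely by the default value of the Bochner integral.\<close>

definition exp_growth :: "real \<Rightarrow> (real \<Rightarrow> real) \<Rightarrow> bool" where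
  "exp_growth s F \<longleftrightarrow> F \<in> borel_measurable borel \<and> (\<forall>u. 0 \<le> F u) \<and>
     (\<exists>B. \<forall>u. F u \<le> B * (exp (s * u) + exp (- s * u)))"

lemma exp_growth_measurable: "exp_growth s F \<Longrightarrow> F \<in> borel_measurable borel"
  by (simp add: exp_growth_def)

lemma exp_growth_nonneg: "exp_growth s F \<Longrightarrow> 0 \<le> F u"
  by (simp add: exp_growth_def)

lemma exp_growthI:
  assumes "F \<in> borel_measurable borel" "\<And>u. 0 \<le> F u"
    and "\<And>u. F u \<le> B * (exp (s * u) + exp (- s * u))"
  shows "exp_growth s F"
  using assms unfolding exp_growth_def by blast

lemma exp_growth_zero: "exp_growth s (\<lambda>_. 0)"
  by (rule exp_growthI[where B = 0]) auto

lemma exp_growth_bound: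
  assumes "exp_growth s F"
  obtains B where "0 \<le> B" "\<And>u. F u \<le> B * (exp (s * u) + exp (- s * u))"
proof -
  obtain B where B: "\<And>u. F u \<le> B * (exp (s * u) + exp (- s * u))"
    using assms unfolding exp_growth_def by blast
  have "0 \<le> B"
    using order_trans[OF exp_growth_nonneg[OF assms, of 0] B[of 0]] by simp
  then show ?thesis using B that by blast
qed

lemma exp_growth_add:
  assumes "exp_growth s F" "exp_growth s G"
  shows "exp_growth s (\<lambda>u. F u + G u)"
proof -
  obtain A where A: "0 \<le> A" "\<And>u. F u \<le> A * (exp (s * u) + exp (- s * u))"
    using exp_growth_bound[OF assms(1)] by blast
  obtain B where B: "0 \<le> B" "\<And>u. G u \<le> B * (exp (s * u) + exp (- s * u))"
    using exp_growth_bound[OF assms(2)] by blast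
  show ?thesis
  proof (rule exp_growthI[where B = "A + B"])
    show "(\<lambda>u. F u + G u) \<in> borel_measurable borel"
      using assms[THEN exp_growth_measurable] by measurable
    show "0 \<le> F u + G u" for u
      using assms[THEN exp_growth_nonneg] by (simp add: add_nonneg_nonneg)
    show "F u + G u \<le> (A + B) * (exp (s * u) + exp (- s * u))" for u
      using A(2)[of u] B(2)[of u] by (simp add: algebra_simps)
  qed
qed

lemma exp_growth_cmult:
  assumes "exp_growth s F" "0 \<le> k"
  shows "exp_growth s (\<lambda>u. k * F u)"
proof -
  obtain A where A: "0 \<le> A" "\<And>u. F u \<le> A * (exp (s * u) + exp (- s * u))"
    using exp_growth_bound[OF assms(1)] by blast
  show ?thesis
  proof (rule exp_growthI[where B = "k * A"])
    show "(\<lambda>u. k * F u) \<in> borel_measurable borel"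
      using exp_growth_measurable[OF assms(1)] by measurable
    show "0 \<le> k * F u" for u
      using assms exp_growth_nonneg[OF assms(1)] by simp
    show "k * F u \<le> k * A * (exp (s * u) + exp (- s * u))" for u
      using mult_left_mono[OF A(2)[of u] assms(2)] by (simp add: algebra_simps)
  qed
qed

lemma exp_growth_min:
  assumes "exp_growth s F" "exp_growth s G"
  shows "exp_growth s (\<lambda>u. min (F u) (G u))"
proof -
  obtain A where A: "0 \<le> A" "\<And>u. F u \<le> A * (exp (s * u) + exp (- s * u))"
    using exp_growth_bound[OF assms(1)] by blast
  show ?thesis
  proof (rule exp_growthI[where B = A])
    show "(\<lambda>u. min (F u) (G u)) \<in> borel_measurable borel"
      using assms[THEN exp_growth_measurable] by measurable
    show "0 \<le> min (F u) (G u)" for u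
      using assms[THEN exp_growth_nonneg] by simp
    show "min (F u) (G u) \<le> A * (exp (s * u) + exp (- s * u))" for u
      using A(2)[of u] by linarith
  qed
qed

text \<open>Exponentials are eigenfunctions of Gaussian convolution; the eigenvalue is the moment
  generating function.\<close>

lemma nn_integral_gconv_exp:
  assumes "0 < D"
  shows "(\<integral>\<^sup>+x. ennreal (exp (s * (u - x)) * normal_density 0 (sqrt D) x) \<partial>lborel) =
    ennreal (exp (s * u + s\<^sup>2 * D / 2))"
proof -
  have "(\<integral>\<^sup>+x. ennreal (exp (s * (u - x)) * normal_density 0 (sqrt D) x) \<partial>lborel) =
    (\<integral>\<^sup>+x. ennreal (exp (s * u)) * ennreal (normal_density 0 (sqrt D) x * exp (- s * x)) \<partial>lborel)"
    by (intro nn_integral_cong)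
      (simp add: right_diff_distrib exp_diff exp_minus field_simps flip: ennreal_mult)
  also have "\<dots> = ennreal (exp (s * u)) * ennreal (exp ((- s)\<^sup>2 * (sqrt D)\<^sup>2 / 2))"
    using assms by (subst nn_integral_cmult) (simp_all only: nn_integral_normal_density_exp real_sqrt_gt_zero, measurable)
  finally show ?thesis
    using assms by (simp add: exp_add flip: ennreal_mult)
qed

text \<open>By the eigenvalue property, convolution enlarges the constant of the growth bound but
  keeps the rate \<open>s\<close>, so any number of recursion steps stays in one class.\<close>

lemma exp_growth_nn_integral_le:
  assumes F: "exp_growth s F" and "0 < D"
    and B: "0 \<le> B" "\<And>u. F u \<le> B * (exp (s * u) + exp (- s * u))"
  shows "(\<integral>\<^sup>+x. ennreal (F (u - x) * normal_density 0 (sqrt D) x) \<partial>lborel) \<le>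
    ennreal (B * exp (s\<^sup>2 * D / 2) * (exp (s * u) + exp (- s * u)))"
proof -
  have "(\<integral>\<^sup>+x. ennreal (F (u - x) * normal_density 0 (sqrt D) x) \<partial>lborel) \<le>
    (\<integral>\<^sup>+x. ennreal B * (ennreal (exp (s * (u - x)) * normal_density 0 (sqrt D) x) +
       ennreal (exp (- s * (u - x)) * normal_density 0 (sqrt D) x)) \<partial>lborel)"
  proof (rule nn_integral_mono)
    fix x
    have "F (u - x) * normal_density 0 (sqrt D) x \<le>
      B * (exp (s * (u - x)) + exp (- s * (u - x))) * normal_density 0 (sqrt D) x"
      by (intro mult_right_mono B) simp
    then show "ennreal (F (u - x) * normal_density 0 (sqrt D) x) \<le>
      ennreal B * (ennreal (exp (s * (u - x)) * normal_density 0 (sqrt D) x) +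
       ennreal (exp (- s * (u - x)) * normal_density 0 (sqrt D) x))"
      using B(1) by (simp add: algebra_simps flip: ennreal_mult ennreal_plus)
  qed
  also have "\<dots> = ennreal B * (ennreal (exp (s * u + s\<^sup>2 * D / 2)) + ennreal (exp (- s * u + (- s)\<^sup>2 * D / 2)))"
    by (subst nn_integral_cmult, measurable, subst nn_integral_add, measurable)
      (simp only: nn_integral_gconv_exp[OF assms(2)])
  also have "\<dots> = ennreal (B * exp (s\<^sup>2 * D / 2) * (exp (s * u) + exp (- s * u)))"
  proof -
    have "exp (s * u + s\<^sup>2 * D / 2) = exp (s\<^sup>2 * D / 2) * exp (s * u)"
      "exp (- s * u + (- s)\<^sup>2 * D / 2) = exp (s\<^sup>2 * D / 2) * exp (- s * u)"
      by (simp_all add: add.commute flip: exp_add)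
    then show ?thesis
      using B(1) by (simp add: distrib_left mult.assoc flip: ennreal_mult ennreal_plus)
  qed
  finally show ?thesis .
qed

text \<open>The growth bound makes the integrand integrable. Additivity, monotonicity and exchange
  of integrals can then be settled for nonnegative integrals and carried back to
  \<open>gconv\<close>.\<close>

lemma ennreal_gconv:
  assumes F: "exp_growth s F" and "0 < D"
  shows "ennreal (gconv D F u) = (\<integral>\<^sup>+x. ennreal (F (u - x) * normal_density 0 (sqrt D) x) \<partial>lborel)"
proof -
  obtain B where B: "0 \<le> B" "\<And>u. F u \<le> B * (exp (s * u) + exp (- s * u))"
    using exp_growth_bound[OF F] by blast
  note [measurable] = exp_growth_measurable[OF F]
  have nonneg: "0 \<le> F (u - x) * normal_density 0 (sqrt D) x" for x
    using exp_growth_nonneg[OF F] by simp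
  have "(\<integral>\<^sup>+x. ennreal (F (u - x) * normal_density 0 (sqrt D) x) \<partial>lborel) < \<infinity>"
    using exp_growth_nn_integral_le[OF F assms(2) B, of u] by (simp add: le_less_trans)
  then have "integrable lborel (\<lambda>x. F (u - x) * normal_density 0 (sqrt D) x)"
    by (intro integrableI_nonneg) (auto simp: nonneg)
  then show ?thesis
    using assms(2) nonneg by (simp add: gconv_def nn_integral_eq_integral)
qed

lemma gconv_nonneg: "(\<And>u. 0 \<le> F u) \<Longrightarrow> 0 \<le> gconv D F u"
  by (simp add: gconv_def)

lemma exp_growth_gconv:
  assumes F: "exp_growth s F" and "0 \<le> D"
  shows "exp_growth s (gconv D F)"
proof (cases "D = 0")
  case True
  then have "gconv D F = F" by (simp add: gconv_def fun_eq_iff)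
  then show ?thesis using F by simp
next
  case False
  then have D: "0 < D" using assms(2) by simp
  obtain B where B: "0 \<le> B" "\<And>u. F u \<le> B * (exp (s * u) + exp (- s * u))"
    using exp_growth_bound[OF F] by blast
  note [measurable] = exp_growth_measurable[OF F]
  show ?thesis
  proof (rule exp_growthI[where B = "B * exp (s\<^sup>2 * D / 2)"])
    have "(\<lambda>u. \<integral>x. F (u - x) * normal_density 0 (sqrt D) x \<partial>lborel) \<in> borel_measurable borel"
      by measurable
    then show "gconv D F \<in> borel_measurable borel"
      using D by (simp add: gconv_def[abs_def])
    show "0 \<le> gconv D F u" for u
      using exp_growth_nonneg[OF F] by (intro gconv_nonneg)
    show "gconv D F u \<le> B * exp (s\<^sup>2 * D / 2) * (exp (s * u) + exp (- s * u))" for u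
      using exp_growth_nn_integral_le[OF F D B, of u] B(1)
      by (simp add: ennreal_gconv[OF F D, symmetric] ennreal_le_iff)
  qed
qed

lemma gconv_mono:
  assumes "exp_growth s F" "exp_growth s G" "0 \<le> D" "\<And>u. F u \<le> G u"
  shows "gconv D F u \<le> gconv D G u"
proof (cases "D = 0")
  case True
  then show ?thesis using assms by (simp add: gconv_def)
next
  case False
  then have D: "0 < D" using assms by simp
  have "ennreal (gconv D F u) \<le> ennreal (gconv D G u)"
    unfolding ennreal_gconv[OF assms(1) D] ennreal_gconv[OF assms(2) D]
    by (intro nn_integral_mono ennreal_leI mult_right_mono assms) simp
  then show ?thesis
    using gconv_nonneg[of G] exp_growth_nonneg[OF assms(2)] by (simp add: ennreal_le_iff)
qed

lemma gconv_add:
  assumes F: "exp_growth s F" and G: "exp_growth s G" and "0 \<le> D"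
  shows "gconv D (\<lambda>u. F u + G u) u = gconv D F u + gconv D G u"
proof (cases "D = 0")
  case True
  then show ?thesis by (simp add: gconv_def)
next
  case False
  then have D: "0 < D" using assms by simp
  note [measurable] = exp_growth_measurable[OF F] exp_growth_measurable[OF G]
  note nn = exp_growth_nonneg[OF F] exp_growth_nonneg[OF G]
  have "ennreal (gconv D (\<lambda>u. F u + G u) u) = ennreal (gconv D F u) + ennreal (gconv D G u)"
    unfolding ennreal_gconv[OF exp_growth_add[OF F G] D] ennreal_gconv[OF F D] ennreal_gconv[OF G D]
    by (subst nn_integral_add[symmetric]) (auto simp: nn distrib_right simp flip: ennreal_plus)
  then show ?thesis
    by (simp add: nn gconv_nonneg flip: ennreal_plus)
qed

lemma gconv_cmult: "gconv D (\<lambda>u. k * F u) u = k * gconv D F u"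
  by (simp add: gconv_def mult.assoc)

text \<open>Semigroup law: variances of independent centered normal variables add. It merges the
  single steps of a packet into one convolution.\<close>

lemma gconv_gconv:
  assumes F: "exp_growth s F" and "0 \<le> D" "0 \<le> E"
  shows "gconv D (gconv E F) u = gconv (D + E) F u"
proof (cases "D = 0 \<or> E = 0")
  case True
  then show ?thesis
    by (auto simp: gconv_def)
next
  case False
  then have D: "0 < D" and E: "0 < E" using assms by simp_all
  note [measurable] = exp_growth_measurable[OF F]
  note nn = exp_growth_nonneg[OF F]
  let ?n = "\<lambda>D. normal_density 0 (sqrt D)"
  have "ennreal (gconv D (gconv E F) u) = (\<integral>\<^sup>+x. ennreal (gconv E F (u - x) * ?n D x) \<partial>lborel)"
    using F D E by (intro ennreal_gconv exp_growth_gconv) auto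
  also have "\<dots> = (\<integral>\<^sup>+x. (\<integral>\<^sup>+y. ennreal (F (u - x - y) * ?n E y) \<partial>lborel) * ennreal (?n D x) \<partial>lborel)"
    by (intro nn_integral_cong)
      (simp add: ennreal_mult gconv_nonneg nn ennreal_gconv[OF F E])
  \<comment> \<open>The substitution \<open>y = z - x\<close> makes \<open>F\<close> depend on
    \<open>z\<close> alone, so that after Tonelli the integral over \<open>x\<close> is a
    convolution of two densities.\<close>
  also have "\<dots> = (\<integral>\<^sup>+x. \<integral>\<^sup>+z. ennreal (F (u - z) * ?n E (z - x) * ?n D x) \<partial>lborel \<partial>lborel)"
  proof (intro nn_integral_cong)
    fix x
    have "(\<integral>\<^sup>+y. ennreal (F (u - x - y) * ?n E y) \<partial>lborel) =
      (\<integral>\<^sup>+z. ennreal (F (u - z) * ?n E (z - x)) \<partial>lborel)"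
      by (subst nn_integral_real_affine[where c = 1 and t = "- x"]) auto
    then show "(\<integral>\<^sup>+y. ennreal (F (u - x - y) * ?n E y) \<partial>lborel) * ennreal (?n D x) =
      (\<integral>\<^sup>+z. ennreal (F (u - z) * ?n E (z - x) * ?n D x) \<partial>lborel)"
      by (simp add: nn_integral_multc[symmetric] nn flip: ennreal_mult)
  qed
  also have "\<dots> = (\<integral>\<^sup>+z. \<integral>\<^sup>+x. ennreal (F (u - z) * ?n E (z - x) * ?n D x) \<partial>lborel \<partial>lborel)"
    by (rule lborel_pair.Fubini'[symmetric]) measurable
  also have "\<dots> = (\<integral>\<^sup>+z. ennreal (F (u - z) * ?n (D + E) z) \<partial>lborel)"
  proof (intro nn_integral_cong)
    fix z
    have "(\<integral>\<^sup>+x. ennreal (?n E (z - x) * ?n D x) \<partial>lborel) = ennreal (?n (D + E) z)"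
      using fun_cong[OF conv_normal_density_zero_mean[of "sqrt E" "sqrt D"], of z] D E
      by (simp add: add.commute)
    then show "(\<integral>\<^sup>+x. ennreal (F (u - z) * ?n E (z - x) * ?n D x) \<partial>lborel) =
       ennreal (F (u - z) * ?n (D + E) z)"
      by (simp add: nn ennreal_mult mult.assoc nn_integral_cmult)
  qed
  also have "\<dots> = ennreal (gconv (D + E) F u)"
    using D E by (intro ennreal_gconv[OF F, symmetric]) simp
  finally show ?thesis
    by (simp add: nn gconv_nonneg)
qed

text \<open>This turns an integral over a new income into a \<open>gconv\<close>. The case
  \<open>b = 0\<close> arises when the other arm has not been applied yet, and is the reason why
  \<open>gconv\<close> admits variance 0.\<close>

lemma nn_integral_normal_affine:
  assumes F: "exp_growth s F" and "0 < \<sigma>"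
  shows "(\<integral>\<^sup>+x. ennreal (normal_density \<mu> \<sigma> x * F (u + b * (x - \<mu>))) \<partial>lborel) =
    ennreal (gconv (b\<^sup>2 * \<sigma>\<^sup>2) F u)"
proof (cases "b = 0")
  case True
  then show ?thesis
    using assms exp_growth_nonneg[OF F]
    by (simp add: gconv_def ennreal_mult nn_integral_multc nn_integral_normal_density)
next
  case False
  note [measurable] = exp_growth_measurable[OF F]
  \<comment> \<open>The substitution \<open>\<mu> - x / b\<close> has the sign that turns
    \<open>u + b * (x - \<mu>)\<close> into \<open>u - x\<close>, the form used by
    \<open>gconv\<close>.\<close>
  have eq: "normal_density \<mu> \<sigma> (\<mu> + x * (- 1 / b)) = \<bar>b\<bar> * normal_density 0 (sqrt (b\<^sup>2 * \<sigma>\<^sup>2)) x" for x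
  proof -
    have "sqrt (2 * pi * (b\<^sup>2 * \<sigma>\<^sup>2)) = \<bar>b\<bar> * sqrt (2 * pi * \<sigma>\<^sup>2)"
      by (simp add: real_sqrt_mult)
    then show ?thesis
      using assms(2) False
      by (simp add: normal_density_def power_mult_distrib field_simps)
  qed
  have "(\<integral>\<^sup>+x. ennreal (normal_density \<mu> \<sigma> x * F (u + b * (x - \<mu>))) \<partial>lborel) =
    ennreal \<bar>- 1 / b\<bar> * (\<integral>\<^sup>+x. ennreal (normal_density \<mu> \<sigma> (\<mu> + x * (- 1 / b)) * F (u - x)) \<partial>lborel)"
    using False by (subst nn_integral_real_affine[where c = "- 1 / b" and t = \<mu>]) (auto simp: mult.commute)
  also have "\<dots> = (\<integral>\<^sup>+x. ennreal (F (u - x) * normal_density 0 (sqrt (b\<^sup>2 * \<sigma>\<^sup>2)) x) \<partial>lborel)"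
    unfolding eq using False exp_growth_nonneg[OF F]
    by (subst nn_integral_cmult[symmetric]) (auto simp: field_simps simp flip: ennreal_mult)
  also have "\<dots> = ennreal (gconv (b\<^sup>2 * \<sigma>\<^sup>2) F u)"
    using False assms by (intro ennreal_gconv[OF F, symmetric]) simp
  finally show ?thesis .
qed

section \<open>The recursion for the risk\<close>

locale bandit =
  fixes c \<epsilon> :: real and M N :: nat and varrho :: "real \<Rightarrow> real"
  assumes c_pos: "c > 0"
    and M_ge: "M \<ge> 1" and N_ge: "N \<ge> 2 * M" and M_dvd: "M dvd N"
    and eps_eq: "\<epsilon> = real M / real N"
    and varrho_nonneg: "\<And>w. w \<in> {-c..c} \<Longrightarrow> varrho w \<ge> 0"
    and varrho_integrable: "set_integrable lborel {-c..c} varrho"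
    and varrho_integral: "(LINT w:{-c..c}|lborel. varrho w) = 1"
    and varrho_even: "\<And>w. w \<in> {-c..c} \<Longrightarrow> varrho (- w) = varrho w"
begin

lemma N_pos: "N > 0"
  using M_ge N_ge by simp

lemma eps_pos: "\<epsilon> > 0"
  using M_ge N_pos by (simp add: eps_eq)

lemma two_eps_le: "2 * \<epsilon> \<le> 1"
proof -
  have "2 * real M \<le> real N" using N_ge by linarith
  then show ?thesis using N_pos by (simp add: eps_eq field_simps)
qed

text \<open>Extension by zero: \<open>varrho\<close> is constrained on \<open>[-c, c]\<close> only
  and may fail to be measurable elsewhere.\<close>

definition dens :: "real \<Rightarrow> real" where
  "dens w = indicator {-c..c} w * varrho w"

lemma dens_integrable: "integrable lborel dens"
  using varrho_integrable by (simp add: set_integrable_def dens_def[abs_def])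

lemma dens_integral: "(\<integral>w. dens w \<partial>lborel) = 1"
  using varrho_integral by (simp add: set_lebesgue_integral_def dens_def[abs_def])

lemma dens_measurable [measurable]: "dens \<in> borel_measurable borel"
  using dens_integrable by (simp add: borel_measurable_integrable)

lemma dens_nonneg: "0 \<le> dens w"
  using varrho_nonneg by (simp add: dens_def indicator_def)

lemma dens_even: "dens (- w) = dens w"
  using varrho_even[of w] by (auto simp: dens_def indicator_def)

lemma nn_integral_dens: "(\<integral>\<^sup>+w. ennreal (dens w) \<partial>lborel) = 1"
  using dens_integrable dens_integral dens_nonneg by (subst nn_integral_eq_integral) auto

text \<open>\<open>g\<^sup>(\<^sup>l\<^sup>)\<close> as a function of the information \<open>k = t\<^sub>1 t\<^sub>2 / t\<close> about \<open>w\<close>.\<close>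

definition g_info :: "nat \<Rightarrow> real \<Rightarrow> real \<Rightarrow> real" where
  "g_info l u k =
     (\<integral>w. indicator {0..c} w * (2 * w * exp ((-1) ^ l * (2 * u * w) - 2 * w\<^sup>2 * k)) * dens w \<partial>lborel)"

lemma g_fun_eq: "g_fun c varrho l u p q = g_info l u (p * q / (p + q))"
  unfolding g_fun_def g_info_def set_lebesgue_integral_def
  using c_pos by (intro Bochner_Integration.integral_cong) (auto simp: dens_def indicator_def)

lemma g_info_integrand_nonneg:
  "0 \<le> indicator {0..c} w * (2 * w * exp ((-1) ^ l * (2 * u * w) - 2 * w\<^sup>2 * k)) * dens w"
  by (auto simp: indicator_def dens_nonneg)

text \<open>Origin of the growth rate \<open>2 * c\<close>: for \<open>w\<close> in
  \<open>[0, c]\<close> the linear part of the exponent is at most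
  \<open>2 * c * \<bar>u\<bar>\<close>, and the information term only lowers it.\<close>

lemma g_info_integrand_le:
  assumes "0 \<le> k"
  shows "indicator {0..c} w * (2 * w * exp ((-1) ^ l * (2 * u * w) - 2 * w\<^sup>2 * k)) * dens w \<le>
    2 * c * (exp (2 * c * u) + exp (- (2 * c) * u)) * dens w"
proof (cases "w \<in> {0..c}")
  case True
  then have w: "0 \<le> w" "w \<le> c" by auto
  have "w * \<bar>u\<bar> \<le> c * \<bar>u\<bar>" using w by (intro mult_right_mono) auto
  then have "(-1) ^ l * (2 * u * w) - 2 * w\<^sup>2 * k \<le> 2 * c * \<bar>u\<bar>"
  proof -
    have "\<bar>(-1) ^ l * (2 * u * w)\<bar> = 2 * (w * \<bar>u\<bar>)"
      using w by (simp add: abs_mult power_abs)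
    moreover have "0 \<le> 2 * w\<^sup>2 * k" using assms by simp
    ultimately show ?thesis using \<open>w * \<bar>u\<bar> \<le> c * \<bar>u\<bar>\<close> by linarith
  qed
  then have "exp ((-1) ^ l * (2 * u * w) - 2 * w\<^sup>2 * k) \<le> exp (2 * c * \<bar>u\<bar>)"
    by simp
  also have "\<dots> \<le> exp (2 * c * u) + exp (- (2 * c) * u)"
    by (auto simp: abs_if)
  finally have "2 * w * exp ((-1) ^ l * (2 * u * w) - 2 * w\<^sup>2 * k) \<le>
      2 * c * (exp (2 * c * u) + exp (- (2 * c) * u))"
    using w by (intro mult_mono) auto
  then show ?thesis
    using True by (simp add: mult_right_mono dens_nonneg)
next
  case False
  then show ?thesis using c_pos dens_nonneg by simp
qed

lemma ennreal_g_info: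
  assumes "0 \<le> k"
  shows "ennreal (g_info l u k) =
    (\<integral>\<^sup>+w. ennreal (indicator {0..c} w * (2 * w * exp ((-1) ^ l * (2 * u * w) - 2 * w\<^sup>2 * k)) * dens w) \<partial>lborel)"
proof -
  have "integrable lborel (\<lambda>w. indicator {0..c} w * (2 * w * exp ((-1) ^ l * (2 * u * w) - 2 * w\<^sup>2 * k)) * dens w)"
  proof (rule Bochner_Integration.integrable_bound)
    show "integrable lborel (\<lambda>w. 2 * c * (exp (2 * c * u) + exp (- (2 * c) * u)) * dens w)"
      using dens_integrable by simp
    show "AE w in lborel. norm (indicator {0..c} w * (2 * w * exp ((-1) ^ l * (2 * u * w) - 2 * w\<^sup>2 * k)) * dens w)
        \<le> norm (2 * c * (exp (2 * c * u) + exp (- (2 * c) * u)) * dens w)"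
      using g_info_integrand_le[OF assms] g_info_integrand_nonneg
      by (intro AE_I2) (simp add: order_trans[OF _ abs_ge_self])
  qed measurable
  then show ?thesis
    unfolding g_info_def by (intro nn_integral_eq_integral[symmetric]) (auto simp: g_info_integrand_nonneg)
qed

lemma g_info_nonneg: "0 \<le> g_info l u k"
  unfolding g_info_def by (intro Bochner_Integration.integral_nonneg g_info_integrand_nonneg)

text \<open>The arm enters only through the sign of \<open>u\<close>, so at \<open>u = 0\<close>
  both arms cost the same.\<close>

lemma g_info_0: "g_info l 0 k = g_info l' 0 k"
  by (simp add: g_info_def)

lemma exp_growth_g_info:
  assumes "0 \<le> k"
  shows "exp_growth (2 * c) (\<lambda>u. g_info l u k)"
proof (rule exp_growthI[where B = "2 * c"])
  show "(\<lambda>u. g_info l u k) \<in> borel_measurable borel"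
    unfolding g_info_def by measurable
  show "0 \<le> g_info l u k" for u
    by (rule g_info_nonneg)
  show "g_info l u k \<le> 2 * c * (exp (2 * c * u) + exp (- (2 * c) * u))" for u
  proof -
    have "ennreal (g_info l u k) \<le> (\<integral>\<^sup>+w. ennreal (2 * c * (exp (2 * c * u) + exp (- (2 * c) * u))) * ennreal (dens w) \<partial>lborel)"
      unfolding ennreal_g_info[OF assms]
      using c_pos g_info_integrand_le[OF assms] dens_nonneg
      by (intro nn_integral_mono) (simp flip: ennreal_mult add: ennreal_leI)
    also have "\<dots> = ennreal (2 * c * (exp (2 * c * u) + exp (- (2 * c) * u)))"
      by (simp add: nn_integral_cmult nn_integral_dens)
    finally show ?thesis using c_pos by (simp add: ennreal_le_iff)
  qed
qed

text \<open>Martingale property of the expected loss rate: convolution with variance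
  \<open>D\<close> multiplies the exponential in \<open>u\<close> by
  \<open>exp (2 * w\<^sup>2 * D)\<close>, which cancels the extra damping caused by the information
  gain \<open>D\<close>.\<close>

lemma gconv_g_info:
  assumes "0 \<le> k" "0 \<le> D"
  shows "gconv D (\<lambda>u. g_info l u (k + D)) u = g_info l u k"
proof (cases "D = 0")
  case True
  then show ?thesis by (simp add: gconv_def)
next
  case False
  then have D: "0 < D" using assms by simp
  have kD: "0 \<le> k + D" using assms by simp
  let ?s = "\<lambda>w::real. (-1) ^ l * (2 * w)"
  let ?n = "normal_density 0 (sqrt D)"
  let ?k = "\<lambda>w. indicator {0..c} w * (2 * w) * exp (- 2 * w\<^sup>2 * (k + D)) * dens w"
  have k_nonneg: "0 \<le> ?k w" for w
    by (auto simp: indicator_def dens_nonneg)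
  have "ennreal (gconv D (\<lambda>u. g_info l u (k + D)) u) =
    (\<integral>\<^sup>+x. ennreal (g_info l (u - x) (k + D) * ?n x) \<partial>lborel)"
    by (rule ennreal_gconv[OF exp_growth_g_info[OF kD] D])
  also have "\<dots> = (\<integral>\<^sup>+x. \<integral>\<^sup>+w. ennreal (?k w * (exp (?s w * (u - x)) * ?n x)) \<partial>lborel \<partial>lborel)"
  proof (intro nn_integral_cong)
    fix x
    have "ennreal (g_info l (u - x) (k + D) * ?n x) =
      (\<integral>\<^sup>+w. ennreal (indicator {0..c} w * (2 * w * exp ((-1) ^ l * (2 * (u - x) * w) - 2 * w\<^sup>2 * (k + D))) * dens w) * ennreal (?n x) \<partial>lborel)"
      by (subst nn_integral_multc) (measurable, simp only: ennreal_g_info[OF kD, symmetric] ennreal_mult[OF g_info_nonneg normal_density_nonneg])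
    also have "\<dots> = (\<integral>\<^sup>+w. ennreal (?k w * (exp (?s w * (u - x)) * ?n x)) \<partial>lborel)"
    proof (intro nn_integral_cong)
      fix w
      have "exp ((-1) ^ l * (2 * (u - x) * w) - 2 * w\<^sup>2 * (k + D)) = exp (- 2 * w\<^sup>2 * (k + D)) * exp (?s w * (u - x))"
        by (simp add: algebra_simps flip: exp_add)
      then show "ennreal (indicator {0..c} w * (2 * w * exp ((-1) ^ l * (2 * (u - x) * w) - 2 * w\<^sup>2 * (k + D))) * dens w) * ennreal (?n x) =
        ennreal (?k w * (exp (?s w * (u - x)) * ?n x))"
        by (subst ennreal_mult''[symmetric]) (simp, simp only: mult_ac)
    qed
    finally show "ennreal (g_info l (u - x) (k + D) * ?n x) =
      (\<integral>\<^sup>+w. ennreal (?k w * (exp (?s w * (u - x)) * ?n x)) \<partial>lborel)" .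
  qed
  also have "\<dots> = (\<integral>\<^sup>+w. \<integral>\<^sup>+x. ennreal (?k w * (exp (?s w * (u - x)) * ?n x)) \<partial>lborel \<partial>lborel)"
    by (rule lborel_pair.Fubini'[symmetric]) measurable
  also have "\<dots> = (\<integral>\<^sup>+w. ennreal (indicator {0..c} w * (2 * w * exp ((-1) ^ l * (2 * u * w) - 2 * w\<^sup>2 * k)) * dens w) \<partial>lborel)"
  proof (intro nn_integral_cong)
    fix w :: real
    \<comment> \<open>The sign of the arm disappears in the square, so the compensation is the same
      for both arms.\<close>
    have s2: "(?s w)\<^sup>2 = 4 * w\<^sup>2" by (simp add: power_mult_distrib flip: power_mult)
    have "(\<integral>\<^sup>+x. ennreal (?k w * (exp (?s w * (u - x)) * ?n x)) \<partial>lborel) =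
      ennreal (?k w) * (\<integral>\<^sup>+x. ennreal (exp (?s w * (u - x)) * ?n x) \<partial>lborel)"
      by (simp only: ennreal_mult'[OF k_nonneg]) (simp add: nn_integral_cmult)
    also have "\<dots> = ennreal (?k w * exp (?s w * u + (?s w)\<^sup>2 * D / 2))"
      unfolding nn_integral_gconv_exp[OF D] by (simp only: ennreal_mult'[OF k_nonneg])
    also have "?k w * exp (?s w * u + (?s w)\<^sup>2 * D / 2) =
      indicator {0..c} w * (2 * w * (exp (- 2 * w\<^sup>2 * (k + D)) * exp (?s w * u + (?s w)\<^sup>2 * D / 2))) * dens w"
      by (simp only: mult_ac)
    also have "exp (- 2 * w\<^sup>2 * (k + D)) * exp (?s w * u + (?s w)\<^sup>2 * D / 2) =
      exp ((-1) ^ l * (2 * u * w) - 2 * w\<^sup>2 * k)"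
      unfolding s2 by (simp add: algebra_simps flip: exp_add)
    finally show "(\<integral>\<^sup>+x. ennreal (?k w * (exp (?s w * (u - x)) * ?n x)) \<partial>lborel) =
      ennreal (indicator {0..c} w * (2 * w * exp ((-1) ^ l * (2 * u * w) - 2 * w\<^sup>2 * k)) * dens w)" .
  qed
  also have "\<dots> = ennreal (g_info l u k)"
    by (rule ennreal_g_info[OF assms(1), symmetric])
  finally show ?thesis
    by (simp add: g_info_nonneg gconv_nonneg)
qed

text \<open>
  The variance of the change of \<open>u\<close> when an arm is applied \<open>j\<close> times at time \<open>t\<close>, where \<open>q\<close>
  is the time spent on the other arm. Written as an increment of \<open>- q\<^sup>2 / t\<close>, it telescopes
  along a packet.
\<close>

definition step_var :: "real \<Rightarrow> real \<Rightarrow> nat \<Rightarrow> real" where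
  "step_var q t j = q\<^sup>2 * (1 / t - 1 / (t + real j / real N))"

lemma step_var_nonneg: "0 < t \<Longrightarrow> 0 \<le> step_var q t j"
  by (simp add: step_var_def frac_le)

lemma step_var_0 [simp]: "step_var q t 0 = 0" "step_var 0 t j = 0"
  by (simp_all add: step_var_def)

lemma step_var_Suc: "step_var q t 1 + step_var q (t + 1 / real N) j = step_var q t (Suc j)"
  by (simp add: step_var_def algebra_simps add_divide_distrib)

lemma step_var_M: "0 < t \<Longrightarrow> step_var q t M = \<epsilon> * q\<^sup>2 / (t * (t + \<epsilon>))"
  using eps_pos unfolding step_var_def eps_eq[symmetric]
  by (simp add: field_simps)

text \<open>Since \<open>p * q / (p + q) = q - q\<^sup>2 / (p + q)\<close>, the information changes
  only through \<open>- q\<^sup>2 / t\<close>, whose increment is by definition the variance of the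
  change of \<open>u\<close>.\<close>

lemma info_step:
  assumes "0 \<le> p" "0 \<le> q" "0 < p + q"
  shows "(p + real j / real N) * q / (p + real j / real N + q) = p * q / (p + q) + step_var q (p + q) j"
proof -
  have *: "a * q / (a + q) = q - q\<^sup>2 / (a + q)" if "0 < a + q" for a :: real
    using that by (simp add: field_simps power2_eq_square)
  have "0 \<le> real j / real N" by simp
  then have "0 < p + real j / real N + q" using assms by linarith
  then show ?thesis
    using assms by (subst (1 2) *) (auto simp: step_var_def algebra_simps)
qed

text \<open>Information gain and variance coincide, so the martingale property applies along a
  packet. This is why the recursion may charge a whole packet at the rate known at its
  start.\<close>

lemma gconv_g_fun:
  assumes "0 \<le> p" "0 \<le> q" "0 < p + q"
  shows "gconv (step_var q (p + q) j) (\<lambda>u. g_fun c varrho l u (p + real j / real N) q) u =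
    g_fun c varrho l u p q"
  unfolding g_fun_eq info_step[OF assms]
  using assms by (intro gconv_g_info step_var_nonneg) auto

lemma exp_growth_g_fun:
  "0 \<le> p \<Longrightarrow> 0 \<le> q \<Longrightarrow> exp_growth (2 * c) (\<lambda>u. g_fun c varrho l u p q)"
  unfolding g_fun_eq by (intro exp_growth_g_info) simp

lemma g_fun_nonneg: "0 \<le> g_fun c varrho l u p q"
  by (simp add: g_fun_eq g_info_nonneg)

text \<open>
  Here and below, \<open>p\<close> is the time spent on the arm \<open>l\<close> under consideration and \<open>q\<close> the time spent on the
  other arm.
\<close>

definition own :: "nat \<Rightarrow> (real \<Rightarrow> real \<Rightarrow> real \<Rightarrow> real) \<Rightarrow> real \<Rightarrow> real \<Rightarrow> real \<Rightarrow> real" where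
  "own l f u p q = (if l = 1 then f u p q else f u q p)"

text \<open>Both lines of the recursion in one form, the chosen arm against the other, so that later
  arguments are made once. For arm 2 this uses the symmetry of \<open>g_fun\<close> in its two
  times.\<close>

lemma r_act_unfold:
  assumes "0 < p" "0 < q" "p + q < 1" "l \<in> {1, 2}"
  shows "own l (r_act c varrho \<epsilon> l) u p q =
    \<epsilon> * g_fun c varrho l u p q +
    gconv (step_var q (p + q) M) (\<lambda>u. own l (r_fun c varrho \<epsilon>) u (p + \<epsilon>) q) u"
proof -
  have sv: "step_var q (p + q) M = \<epsilon> * q\<^sup>2 / ((p + q) * (p + q + \<epsilon>))"
    using assms by (intro step_var_M) simp
  \<comment> \<open>The variance must not vanish here: \<open>gconv\<close> would mean a point mass,
    while the recursion integrates against a density.\<close>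
  have "0 < step_var q (p + q) M"
    unfolding sv using assms eps_pos by (intro divide_pos_pos mult_pos_pos) auto
  then have ne: "step_var q (p + q) M \<noteq> 0" by simp
  have sym: "g_fun c varrho 2 u q p = g_fun c varrho 2 u p q"
    by (simp add: g_fun_eq mult.commute add.commute)
  show ?thesis
  proof (cases "l = 1")
    case True
    have "r_act c varrho \<epsilon> 1 u p q = \<epsilon> * g_fun c varrho 1 u p q +
      (\<integral>x. r_fun c varrho \<epsilon> (u - x) (p + \<epsilon>) q * normal_density 0 (sqrt (step_var q (p + q) M)) x \<partial>lborel)"
      unfolding sv using assms(3) eps_pos by (subst r_act.simps) (simp add: r_fun_def)
    then show ?thesis using True ne by (simp add: own_def gconv_def)
  next
    case False
    then have l: "l = 2" using assms(4) by simp
    have sv2: "step_var q (p + q) M = \<epsilon> * q\<^sup>2 / ((q + p) * (q + p + \<epsilon>))"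
      by (simp add: sv add.commute)
    have "r_act c varrho \<epsilon> 2 u q p = \<epsilon> * g_fun c varrho 2 u q p +
      (\<integral>x. r_fun c varrho \<epsilon> (u - x) q (p + \<epsilon>) * normal_density 0 (sqrt (step_var q (p + q) M)) x \<partial>lborel)"
      unfolding sv2 using assms(3) eps_pos by (subst r_act.simps) (simp add: r_fun_def)
    then show ?thesis using l ne by (simp add: own_def gconv_def sym)
  qed
qed

text \<open>Induction on the number \<open>n\<close> of further packets that suffices to reach the
  horizon, where the recursion returns 0.\<close>

lemma exp_growth_r_act:
  assumes "0 < t1" "0 < t2" "l \<in> {1, 2}"
  shows "exp_growth (2 * c) (\<lambda>u. r_act c varrho \<epsilon> l u t1 t2)"
proof -
  have "exp_growth (2 * c) (\<lambda>u. r_act c varrho \<epsilon> l u t1 t2)"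
    if "1 \<le> t1 + t2 + real n * \<epsilon>" for n
    using that assms
  proof (induction n arbitrary: t1 t2 l)
    case 0
    then show ?case by (subst r_act.simps) (simp add: exp_growth_zero)
  next
    case (Suc n)
    show ?case
    proof (cases "t1 + t2 < 1")
      case True
      define p q where "p = (if l = 1 then t1 else t2)" and "q = (if l = 1 then t2 else t1)"
      have pq: "0 < p" "0 < q" "p + q < 1" using Suc.prems True by (auto simp: p_def q_def)
      have r: "r_act c varrho \<epsilon> l u t1 t2 = own l (r_act c varrho \<epsilon> l) u p q" for u
        by (simp add: own_def p_def q_def)
      have "exp_growth (2 * c) (\<lambda>u. own l (r_fun c varrho \<epsilon>) u (p + \<epsilon>) q)"
      proof -
        have "exp_growth (2 * c) (\<lambda>u. r_fun c varrho \<epsilon> u (t1 + \<epsilon>) t2)"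
          "exp_growth (2 * c) (\<lambda>u. r_fun c varrho \<epsilon> u t1 (t2 + \<epsilon>))"
          unfolding r_fun_def
          by (intro exp_growth_min Suc.IH; use Suc.prems eps_pos in \<open>simp add: algebra_simps\<close>)+
        then show ?thesis by (cases "l = 1") (simp_all add: own_def p_def q_def)
      qed
      then show ?thesis
        unfolding r r_act_unfold[OF pq Suc.prems(4)]
        using pq eps_pos
        by (intro exp_growth_add exp_growth_cmult exp_growth_g_fun exp_growth_gconv step_var_nonneg) auto
    next
      case False
      then show ?thesis by (subst r_act.simps) (simp add: exp_growth_zero)
    qed
  qed
  moreover obtain n where "1 / \<epsilon> < real n" using reals_Archimedean2 by blast
  then have "1 \<le> t1 + t2 + real n * \<epsilon>"
    using assms eps_pos by (simp add: field_simps)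
  ultimately show ?thesis by blast
qed

lemma exp_growth_r_fun:
  "0 < t1 \<Longrightarrow> 0 < t2 \<Longrightarrow> exp_growth (2 * c) (\<lambda>u. r_fun c varrho \<epsilon> u t1 t2)"
  unfolding r_fun_def by (intro exp_growth_min exp_growth_r_act) auto

text \<open>
  \<open>one_arm l u s\<close> extends \<open>r\<^sub>\<epsilon>\<close> to histories in which only the arm other than \<open>l\<close> has been
  applied, for a time \<open>s\<close>: it is the value of switching to \<open>l\<close> at once.
\<close>

definition one_arm :: "nat \<Rightarrow> real \<Rightarrow> real \<Rightarrow> real" where
  "one_arm l u s = (if s \<ge> 1 then 0 else
     \<epsilon> * g_fun c varrho l u 0 s +
     gconv (step_var s s M) (\<lambda>u. own l (r_fun c varrho \<epsilon>) u \<epsilon> s) u)"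

text \<open>In a one-arm history the value is that of switching to the arm not yet applied. That no
  other choice is better is a later result, and is shown at \<open>u = 0\<close>, the only value
  such histories take.\<close>

definition r_ext :: "real \<Rightarrow> real \<Rightarrow> real \<Rightarrow> real" where
  "r_ext u t1 t2 =
     (if t1 > 0 \<and> t2 > 0 then r_fun c varrho \<epsilon> u t1 t2
      else if t2 > 0 then one_arm 1 u t2 else one_arm 2 u t1)"

text \<open>
  The risk if \<open>l\<close> has to be applied \<open>j\<close> more times before the next choice; \<open>j = M\<close> gives \<open>r\<^sub>\<epsilon>\<close> with
  superscript \<open>l\<close>.
\<close>

definition packet_val :: "nat \<Rightarrow> nat \<Rightarrow> real \<Rightarrow> real \<Rightarrow> real \<Rightarrow> real" where
  "packet_val l j u p q =
     real j / real N * g_fun c varrho l u p q +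
     gconv (step_var q (p + q) j) (\<lambda>u. own l r_ext u (p + real j / real N) q) u"

lemma packet_val_0: "packet_val l 0 u p q = own l r_ext u p q"
  by (simp add: packet_val_def gconv_def)

lemma exp_growth_own_r_fun:
  "0 < p \<Longrightarrow> 0 < q \<Longrightarrow> exp_growth (2 * c) (\<lambda>u. own l (r_fun c varrho \<epsilon>) u p q)"
  by (cases "l = 1") (simp_all add: own_def exp_growth_r_fun)

lemma exp_growth_one_arm:
  assumes "0 < s"
  shows "exp_growth (2 * c) (\<lambda>u. one_arm l u s)"
proof (cases "s \<ge> 1")
  case True
  then show ?thesis by (simp add: one_arm_def exp_growth_zero)
next
  case False
  have "exp_growth (2 * c) (\<lambda>u. \<epsilon> * g_fun c varrho l u 0 s +
     gconv (step_var s s M) (\<lambda>u. own l (r_fun c varrho \<epsilon>) u \<epsilon> s) u)"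
    using assms eps_pos
    by (intro exp_growth_add exp_growth_cmult exp_growth_g_fun exp_growth_gconv step_var_nonneg
        exp_growth_own_r_fun) auto
  then show ?thesis using False by (simp add: one_arm_def)
qed

lemma exp_growth_r_ext:
  assumes "0 \<le> t1" "0 \<le> t2" "0 < t1 + t2"
  shows "exp_growth (2 * c) (\<lambda>u. r_ext u t1 t2)"
  using assms
  by (cases "0 < t1"; cases "0 < t2") (simp_all add: r_ext_def exp_growth_r_fun exp_growth_one_arm)

lemma exp_growth_own_r_ext:
  "0 \<le> p \<Longrightarrow> 0 \<le> q \<Longrightarrow> 0 < p + q \<Longrightarrow> exp_growth (2 * c) (\<lambda>u. own l r_ext u p q)"
  by (cases "l = 1") (simp_all add: own_def exp_growth_r_ext add.commute)

lemma exp_growth_packet_val: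
  assumes "0 \<le> p" "0 \<le> q" "0 < p + q"
  shows "exp_growth (2 * c) (\<lambda>u. packet_val l j u p q)"
proof -
  have "0 \<le> real j / real N" by simp
  then have "0 < p + real j / real N + q" using assms by linarith
  then show ?thesis
    unfolding packet_val_def using assms
    by (intro exp_growth_add exp_growth_cmult exp_growth_g_fun exp_growth_gconv step_var_nonneg
        exp_growth_own_r_ext) auto
qed

lemma packet_val_nonneg:
  "0 \<le> p \<Longrightarrow> 0 \<le> q \<Longrightarrow> 0 < p + q \<Longrightarrow> 0 \<le> packet_val l j u p q"
  by (rule exp_growth_nonneg[OF exp_growth_packet_val])

text \<open>Splits off one application: the loss rate is preserved by \<open>gconv_g_fun\<close>,
  and the two convolutions merge because their variances telescope.\<close>

lemma packet_val_Suc: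
  assumes pq: "0 \<le> p" "0 \<le> q" "0 < p + q"
  shows "packet_val l (Suc j) u p q =
    g_fun c varrho l u p q / real N +
    gconv (step_var q (p + q) 1) (\<lambda>u. packet_val l j u (p + 1 / real N) q) u"
proof -
  let ?p = "p + 1 / real N"
  have "0 \<le> 1 / real N" by simp
  then have pq': "0 \<le> ?p" "0 < ?p + q" using assms by linarith+
  have j: "0 \<le> real j / real N" by simp
  have pj: "?p + real j / real N = p + real (Suc j) / real N"
    by (simp add: add_divide_distrib)
  have growth: "exp_growth (2 * c) (\<lambda>u. own l r_ext u (?p + real j / real N) q)"
    using pq pq' j by (intro exp_growth_own_r_ext) linarith+
  have "gconv (step_var q (p + q) 1) (\<lambda>u. packet_val l j u ?p q) u =
    gconv (step_var q (p + q) 1) (\<lambda>u. real j / real N * g_fun c varrho l u ?p q) u +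
    gconv (step_var q (p + q) 1)
      (gconv (step_var q (?p + q) j) (\<lambda>u. own l r_ext u (?p + real j / real N) q)) u"
    unfolding packet_val_def using pq pq' growth
    by (intro gconv_add[where s = "2 * c"] exp_growth_cmult exp_growth_g_fun exp_growth_gconv step_var_nonneg) auto
  also have "\<dots> = real j / real N * g_fun c varrho l u p q +
    gconv (step_var q (p + q) (Suc j)) (\<lambda>u. own l r_ext u (?p + real j / real N) q) u"
    using gconv_g_fun[OF pq, of 1 l u] step_var_Suc[of q "p + q" j] pq pq'
    by (simp only: gconv_cmult gconv_gconv[OF growth step_var_nonneg step_var_nonneg])
      (simp add: add_ac)
  finally show ?thesis
    unfolding packet_val_def[of l "Suc j"] pj by (simp add: add_divide_distrib distrib_right)
qed

lemma packet_val_M: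
  assumes "0 < p" "0 < q" "p + q < 1" "l \<in> {1, 2}"
  shows "packet_val l M u p q = own l (r_act c varrho \<epsilon> l) u p q"
proof -
  have "0 < p + \<epsilon>" using assms eps_pos by simp
  then show ?thesis
    using assms unfolding packet_val_def r_act_unfold[OF assms] eps_eq[symmetric]
    by (auto simp: own_def r_ext_def)
qed

text \<open>Choosing the arm not yet applied attains the extended value by construction; only
  staying with the known arm needs an argument.\<close>

lemma packet_val_M_new:
  assumes "0 < s" "s < 1"
  shows "packet_val l M u 0 s = one_arm l u s"
  using assms eps_pos unfolding packet_val_def one_arm_def eps_eq[symmetric]
  by (cases "l = 1") (simp_all add: own_def r_ext_def)

text \<open>
  Interchange argument: while only one arm is known, applying it once more before switching
  costs the same as applying it right after the switch, which is not better than continuing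
  optimally after the switch.
\<close>

lemma one_arm_le:
  assumes s: "0 < s" "s < 1" and l: "l \<in> {1, 2}"
  shows "one_arm l 0 s \<le> \<epsilon> * g_fun c varrho (3 - l) 0 s 0 + one_arm l 0 (s + \<epsilon>)"
proof -
  \<comment> \<open>With zero information and \<open>u = 0\<close> the loss rate depends neither on
    the arm nor on the times.\<close>
  have g0: "g_fun c varrho k 0 a b = g_info 1 0 0" if "a * b = 0" for k a b
    unfolding g_fun_eq that by (simp add: g_info_0[of k 0 1])
  show ?thesis
  proof (cases "s + \<epsilon> < 1")
    \<comment> \<open>Only one packet is left, so either choice costs one packet at the common
      rate.\<close>
    case False
    then have "own l (r_fun c varrho \<epsilon>) u \<epsilon> s = 0" for u
      by (auto simp: own_def r_fun_def r_act.simps add.commute)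
    then have "one_arm l 0 s = \<epsilon> * g_info 1 0 0"
      using s by (simp add: one_arm_def g0 gconv_def)
    then show ?thesis using False by (simp add: one_arm_def g0)
  next
    case True
    let ?l' = "3 - l"
    have l': "?l' \<in> {1, 2}" using l by auto
    have own_swap: "own l f u \<epsilon> x = own ?l' f u x \<epsilon>" for f u x
      using l by (auto simp: own_def)
    let ?G = "\<lambda>u. own ?l' (r_fun c varrho \<epsilon>) u (s + \<epsilon>) \<epsilon>"
    let ?v = "step_var \<epsilon> (s + \<epsilon>) M"
    have G: "exp_growth (2 * c) ?G"
      using s eps_pos by (intro exp_growth_own_r_fun) auto
    have v: "0 \<le> ?v" "0 \<le> step_var s s M"
      using s eps_pos by (auto intro!: step_var_nonneg)
    have g: "exp_growth (2 * c) (\<lambda>u. g_fun c varrho ?l' u s \<epsilon>)"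
      using s eps_pos by (intro exp_growth_g_fun) auto
    have "own l (r_fun c varrho \<epsilon>) u \<epsilon> s \<le> \<epsilon> * g_fun c varrho ?l' u s \<epsilon> + gconv ?v ?G u" for u
    proof -
      \<comment> \<open>After the switch, optimal continuation costs at most as much as returning to
        the known arm for one packet.\<close>
      have "own ?l' (r_fun c varrho \<epsilon>) u s \<epsilon> \<le> own ?l' (r_act c varrho \<epsilon> ?l') u s \<epsilon>"
        using l by (auto simp: own_def r_fun_def)
      then show ?thesis
        unfolding own_swap r_act_unfold[OF s(1) eps_pos True l'] .
    qed
    then have "gconv (step_var s s M) (\<lambda>u. own l (r_fun c varrho \<epsilon>) u \<epsilon> s) 0 \<le>
      gconv (step_var s s M) (\<lambda>u. \<epsilon> * g_fun c varrho ?l' u s \<epsilon> + gconv ?v ?G u) 0"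
      using s eps_pos v G g
      by (intro gconv_mono[where s = "2 * c"] exp_growth_add exp_growth_cmult exp_growth_gconv exp_growth_own_r_fun) auto
    also have "\<dots> = \<epsilon> * gconv (step_var s s M) (\<lambda>u. g_fun c varrho ?l' u s \<epsilon>) 0 +
      gconv (step_var s s M + ?v) ?G 0"
      using v G g eps_pos
      by (subst gconv_add[where s = "2 * c"])
        (auto intro!: exp_growth_cmult exp_growth_gconv simp: gconv_cmult gconv_gconv[OF G])
    \<comment> \<open>By the martingale property the mean rate of this detour is the rate at zero
      information, the one paid when the known arm is applied before the switch.\<close>
    also have "gconv (step_var s s M) (\<lambda>u. g_fun c varrho ?l' u s \<epsilon>) 0 = g_info 1 0 0"
      using gconv_g_fun[of 0 s M ?l' 0] s
      by (simp add: g0 eps_eq[symmetric]) (simp add: g_fun_eq mult.commute add.commute)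
    \<comment> \<open>Both orders start with zero information and end at the times
      \<open>\<epsilon>\<close> and \<open>s + \<epsilon>\<close>, so the total variance on either
      side is the final information
      \<open>\<epsilon> * (s + \<epsilon>) / (s + 2 * \<epsilon>)\<close>.\<close>
    also have "step_var s s M + ?v = step_var (s + \<epsilon>) (s + \<epsilon>) M"
    proof -
      let ?a = "s + \<epsilon>" and ?b = "s + \<epsilon> + \<epsilon>"
      have "?a \<noteq> 0" "?b \<noteq> 0" using s eps_pos by auto
      moreover have "\<epsilon>\<^sup>2 - s\<^sup>2 = (\<epsilon> - s) * ?a" "?a\<^sup>2 - \<epsilon>\<^sup>2 = s * ?b"
        by (simp_all add: power2_eq_square algebra_simps)
      ultimately have "(\<epsilon>\<^sup>2 - s\<^sup>2) / ?a = \<epsilon> - s" "(?a\<^sup>2 - \<epsilon>\<^sup>2) / ?b = s" "s\<^sup>2 / s = s" "?a\<^sup>2 / ?a = ?a"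
        by (simp_all add: power2_eq_square)
      then show ?thesis
        unfolding step_var_def eps_eq[symmetric]
        by (simp add: diff_divide_distrib right_diff_distrib)
    qed
    finally show ?thesis
      using s True by (simp add: one_arm_def g0 own_swap)
  qed
qed

text \<open>Bellman inequality at a packet boundary. With both arms known it is the minimum in the
  recursion; with one arm known, staying with that arm is covered by
  \<open>one_arm_le\<close>.\<close>

lemma r_ext_le_packet_val:
  assumes "0 \<le> t1" "0 \<le> t2" "0 < t1 + t2" "t1 + t2 < 1"
    and "t1 = 0 \<or> t2 = 0 \<Longrightarrow> u = 0" and "l \<in> {1, 2}"
  shows "r_ext u t1 t2 \<le> own l (packet_val l M) u t1 t2"
proof -
  consider "0 < t1" "0 < t2" | "t1 = 0" "0 < t2" "t2 < 1" "u = 0" | "t2 = 0" "0 < t1" "t1 < 1" "u = 0"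
    using assms by fastforce
  then show ?thesis
  proof cases
    case 1
    then show ?thesis
      using assms(4,6) packet_val_M[of t1 t2 1 u] packet_val_M[of t2 t1 2 u]
      by (auto simp: own_def r_ext_def r_fun_def add.commute)
  next
    case 2
    have "packet_val 2 M 0 t2 0 = \<epsilon> * g_fun c varrho 2 0 t2 0 + one_arm 1 0 (t2 + \<epsilon>)"
      using 2 eps_pos unfolding packet_val_def eps_eq[symmetric]
      by (simp add: gconv_def own_def r_ext_def)
    then show ?thesis
      using 2 assms(6) one_arm_le[of t2 1] packet_val_M_new[of t2 1 0]
      by (auto simp: own_def r_ext_def)
  next
    case 3
    have "packet_val 1 M 0 t1 0 = \<epsilon> * g_fun c varrho 1 0 t1 0 + one_arm 2 0 (t1 + \<epsilon>)"
      using 3 eps_pos unfolding packet_val_def eps_eq[symmetric]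
      by (simp add: gconv_def own_def r_ext_def)
    then show ?thesis
      using 3 assms(6) one_arm_le[of t1 2] packet_val_M_new[of t1 2 0]
      by (auto simp: own_def r_ext_def)
  qed
qed

end

section \<open>Expected losses of strategies\<close>

definition gap :: "real \<times> real \<Rightarrow> nat \<Rightarrow> real" where
  "gap \<theta> y = max (fst \<theta>) (snd \<theta>) - arm_mean \<theta> y"

lemma arm_mean_eq: "arm_mean \<theta> y = (if y = 1 then fst \<theta> else snd \<theta>)"
  by (cases \<theta>) simp

lemma gap_nonneg: "0 \<le> gap \<theta> y"
  by (simp add: gap_def arm_mean_eq)

lemma gap_le: "gap \<theta> y \<le> \<bar>fst \<theta> - snd \<theta>\<bar>"
  by (auto simp: gap_def arm_mean_eq max_def)

lemma borel_measurable_arm_mean [measurable]: "(\<lambda>\<theta>. arm_mean \<theta> y) \<in> borel_measurable (borel \<Otimes>\<^sub>M borel)"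
  unfolding arm_mean_eq by measurable

lemma borel_measurable_gap [measurable]: "(\<lambda>\<theta>. gap \<theta> y) \<in> borel_measurable (borel \<Otimes>\<^sub>M borel)"
  unfolding gap_def by measurable

lemma borel_measurable_normal_density_mean [measurable (raw)]:
  assumes [measurable]: "f \<in> borel_measurable K" "g \<in> borel_measurable K"
  shows "(\<lambda>x. normal_density (f x) \<sigma> (g x)) \<in> borel_measurable K"
  unfolding normal_density_def by measurable

lemma space_obs_space: "space obs_space = {1, 2} \<times> UNIV"
  by (simp add: obs_space_def space_pair_measure)

lemma space_hist_space: "space (hist_space n) = PiE {0..<n} (\<lambda>_. {1, 2} \<times> UNIV)"
  by (simp add: hist_space_def space_PiM space_obs_space)

lemma hist_space_upd:
  "h \<in> space (hist_space n) \<Longrightarrow> y \<in> {1, 2} \<Longrightarrow> h(n := (y, x)) \<in> space (hist_space (Suc n))"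
  unfolding space_hist_space atLeastLessThanSuc[of 0 n] by (auto simp: PiE_iff extensional_def)

lemma fst_hist: "h \<in> space (hist_space n) \<Longrightarrow> i < n \<Longrightarrow> fst (h i) \<in> {1, 2}"
  by (force simp: space_hist_space PiE_iff)

lemma measurable_hist_upd [measurable (raw)]:
  assumes f: "f \<in> K \<rightarrow>\<^sub>M hist_space n" and g: "g \<in> borel_measurable K" and y: "y \<in> {1, 2}"
  shows "(\<lambda>x. (f x)(n := (y, g x))) \<in> K \<rightarrow>\<^sub>M hist_space (Suc n)"
proof -
  have "(\<lambda>x. (y, g x)) \<in> K \<rightarrow>\<^sub>M obs_space"
    unfolding obs_space_def using g y by (intro measurable_Pair measurable_const) auto
  then show ?thesis
    using f unfolding hist_space_def
    by (intro measurable_fun_upd[where J = "{0..<n}"]) auto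
qed

lemma measurable_hist_fst: "i < n \<Longrightarrow> (\<lambda>h. fst (h i)) \<in> hist_space n \<rightarrow>\<^sub>M action_space"
  and measurable_hist_snd: "i < n \<Longrightarrow> (\<lambda>h. snd (h i)) \<in> borel_measurable (hist_space n)"
proof -
  assume i: "i < n"
  have "(\<lambda>h. h i) \<in> hist_space n \<rightarrow>\<^sub>M action_space \<Otimes>\<^sub>M borel"
    using i unfolding hist_space_def obs_space_def by (intro measurable_component_singleton) auto
  then show "(\<lambda>h. fst (h i)) \<in> hist_space n \<rightarrow>\<^sub>M action_space"
    "(\<lambda>h. snd (h i)) \<in> borel_measurable (hist_space n)"
    by (auto intro: measurable_compose[OF _ measurable_fst] measurable_compose[OF _ measurable_snd])
qed

lemma strategy_prob_algebra:
  assumes "is_strategy \<sigma>" "h \<in> space (hist_space n)"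
  shows "\<sigma> n h \<in> space (prob_algebra action_space)"
  using assms unfolding is_strategy_def by (auto dest: measurable_space)

lemma sum_strategy:
  assumes "is_strategy \<sigma>" "h \<in> space (hist_space n)"
  shows "(\<Sum>y\<in>{1, 2}. emeasure (\<sigma> n h) {y}) = 1"
proof -
  have sets: "sets (\<sigma> n h) = Pow {1, 2}" and "prob_space (\<sigma> n h)"
    using strategy_prob_algebra[OF assms] by (auto simp: space_prob_algebra)
  then interpret prob_space "\<sigma> n h" by simp
  have "space (\<sigma> n h) = {1, 2}"
    using sets_eq_imp_space_eq[of "\<sigma> n h" action_space] sets by simp
  then show ?thesis
    using emeasure_space_1 sum_emeasure[of "\<lambda>y. {y}" "{1, 2}" "\<sigma> n h"] sets
    by (simp add: disjoint_family_on_def insert_commute)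
qed

lemma nn_integral_action_space:
  assumes "sets K = Pow {1, 2 :: nat}"
  shows "(\<integral>\<^sup>+y. f y \<partial>K) = (\<Sum>y\<in>{1, 2}. emeasure K {y} * f y)"
proof -
  have space: "space K = {1, 2}"
    using sets_eq_imp_space_eq[of K action_space] assms by simp
  have "(\<integral>\<^sup>+y. f y \<partial>K) = (\<integral>\<^sup>+y. (\<Sum>z\<in>{1, 2}. f z * indicator {z} y) \<partial>K)"
    by (intro nn_integral_cong) (auto simp: space indicator_def)
  also have "\<dots> = (\<Sum>z\<in>{1, 2}. \<integral>\<^sup>+y. f z * indicator {z} y \<partial>K)"
    by (intro nn_integral_sum borel_measurable_times_ennreal borel_measurable_const borel_measurable_indicator)
      (auto simp: assms)
  also have "\<dots> = (\<Sum>y\<in>{1, 2}. emeasure K {y} * f y)"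
    by (intro sum.cong) (auto simp: assms mult.commute nn_integral_cmult_indicator)
  finally show ?thesis .
qed

lemma nn_integral_obs_kernel:
  assumes \<sigma>: "is_strategy \<sigma>" and h: "h \<in> space (hist_space n)"
    and f: "f \<in> borel_measurable obs_space"
  shows "(\<integral>\<^sup>+z. f z \<partial>obs_kernel \<sigma> \<theta> n h) =
    (\<Sum>y\<in>{1, 2}. emeasure (\<sigma> n h) {y} *
       (\<integral>\<^sup>+x. ennreal (normal_density (arm_mean \<theta> y) 1 x) * f (y, x) \<partial>lborel))"
proof -
  have sets: "sets (\<sigma> n h) = Pow {1, 2}"
    using strategy_prob_algebra[OF assms(1,2)] by (auto simp: space_prob_algebra)
  let ?K = "\<lambda>y. distr (density lborel (normal_density (arm_mean \<theta> y) 1)) obs_space (Pair y)"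
  have "?K \<in> \<sigma> n h \<rightarrow>\<^sub>M subprob_algebra obs_space"
    using measurable_prob_algebraD[OF measurable_obs[of \<theta>]] sets
    by (subst measurable_cong_sets[of _ action_space]) auto
  then have "(\<integral>\<^sup>+z. f z \<partial>obs_kernel \<sigma> \<theta> n h) = (\<integral>\<^sup>+y. (\<integral>\<^sup>+z. f z \<partial>?K y) \<partial>\<sigma> n h)"
    unfolding obs_kernel_def using f by (rule nn_integral_bind[rotated])
  also have "\<dots> = (\<Sum>y\<in>{1, 2}. emeasure (\<sigma> n h) {y} * (\<integral>\<^sup>+z. f z \<partial>?K y))"
    by (rule nn_integral_action_space[OF sets])
  also have "\<dots> = (\<Sum>y\<in>{1, 2}. emeasure (\<sigma> n h) {y} *
       (\<integral>\<^sup>+x. ennreal (normal_density (arm_mean \<theta> y) 1 x) * f (y, x) \<partial>lborel))"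
  proof (intro sum.cong refl arg_cong[where f = "(*) _"])
    fix y :: nat assume y: "y \<in> {1, 2}"
    have P: "Pair y \<in> borel \<rightarrow>\<^sub>M obs_space"
      unfolding obs_space_def using y by (intro measurable_Pair measurable_const) auto
    have fy: "(\<lambda>x. f (y, x)) \<in> borel_measurable borel"
      using measurable_compose[OF P f] .
    show "(\<integral>\<^sup>+z. f z \<partial>?K y) = (\<integral>\<^sup>+x. ennreal (normal_density (arm_mean \<theta> y) 1 x) * f (y, x) \<partial>lborel)"
      using P f fy by (subst nn_integral_distr) (auto simp: nn_integral_density)
  qed
  finally show ?thesis .
qed

text \<open>The Ionescu-Tulcea law is built by appending steps at the end. Here its first step is
  split off instead, the direction that a backward recursion needs.\<close>

lemma nn_integral_continuation_Suc:
  assumes \<sigma>: "is_strategy \<sigma>" and h: "h \<in> space (hist_space n)"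
    and f: "f \<in> borel_measurable (hist_space (n + Suc k))"
  shows "(\<integral>\<^sup>+h'. f h' \<partial>continuation_law \<sigma> \<theta> n (Suc k) h) =
    (\<integral>\<^sup>+z. (\<integral>\<^sup>+h'. f h' \<partial>continuation_law \<sigma> \<theta> (Suc n) k (h(n := z))) \<partial>obs_kernel \<sigma> \<theta> n h)"
proof -
  interpret Ionescu_Tulcea "obs_kernel \<sigma> \<theta>" "\<lambda>_. obs_space"
    using \<sigma> by (rule Ionescu_Tulcea_obs_kernel)
  have h': "h \<in> space (PiM {0..<n} (\<lambda>_. obs_space))"
    using h by (simp add: hist_space_def)
  have f': "f \<in> borel_measurable (PiM {0..<Suc n + k} (\<lambda>_. obs_space))"
    using f by (simp add: hist_space_def)
  have 1: "C n 1 h = eP n h"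
    using h' by (simp add: bind_return[OF measurable_eP])
  have "C n (Suc k) h = eP n h \<bind> C (Suc n) k"
    using split_C[OF h', of 1 k] 1 by simp
  then have "(\<integral>\<^sup>+h'. f h' \<partial>C n (Suc k) h) = (\<integral>\<^sup>+g. (\<integral>\<^sup>+h'. f h' \<partial>C (Suc n) k g) \<partial>eP n h)"
    using h' f' measurable_C[of "Suc n" k]
    by (simp add: nn_integral_bind[where B = "PiM {0..<Suc n + k} (\<lambda>_. obs_space)"] sets_eP cong: measurable_cong_sets)
  also have "\<dots> = (\<integral>\<^sup>+z. (\<integral>\<^sup>+h'. f h' \<partial>C (Suc n) k (h(n := z))) \<partial>obs_kernel \<sigma> \<theta> n h)"
    using h' measurable_compose[OF measurable_C nn_integral_measurable_subprob_algebra[OF f']]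
    by (subst nn_integral_eP) auto
  finally show ?thesis
    by (simp add: continuation_law_def)
qed

text \<open>The continuation kernel only appends coordinates, so the regret of the step just made
  can be read off from the extended history.\<close>

lemma nn_integral_continuation_past:
  assumes \<sigma>: "is_strategy \<sigma>" and h: "h \<in> space (hist_space n)" and i: "i < n"
    and f: "f \<in> borel_measurable obs_space"
  shows "(\<integral>\<^sup>+h'. f (h' i) \<partial>continuation_law \<sigma> \<theta> n k h) = f (h i)"
proof -
  interpret Ionescu_Tulcea "obs_kernel \<sigma> \<theta>" "\<lambda>_. obs_space"
    using \<sigma> by (rule Ionescu_Tulcea_obs_kernel)
  have h': "h \<in> space (PiM {0..<n} (\<lambda>_. obs_space))"
    using h by (simp add: hist_space_def)
  have m: "(\<lambda>h'. f (h' i)) \<in> borel_measurable (PiM {0..<n} (\<lambda>_. obs_space))"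
    using i f by (intro measurable_compose[OF measurable_component_singleton]) auto
  then show ?thesis
    using nn_integral_C[of 0 k "\<lambda>h'. f (h' i)" n h] h' i
    by (simp add: continuation_law_def nn_integral_return)
qed

section \<open>Expected regret as a backward recursion\<close>

text \<open>The conditional expected regret of the next \<open>k\<close> steps after
  \<open>h\<close>, computed from the kernels alone. With values in \<open>ennreal\<close> it needs
  no integrability, and the parameter is a plain argument over which a prior can be
  integrated.\<close>

primrec exp_loss :: "strategy \<Rightarrow> real \<times> real \<Rightarrow> nat \<Rightarrow> nat \<Rightarrow> history \<Rightarrow> ennreal" where
  "exp_loss \<sigma> \<theta> 0 n h = 0"
| "exp_loss \<sigma> \<theta> (Suc k) n h =
     (\<Sum>y\<in>{1, 2}. emeasure (\<sigma> n h) {y} * (ennreal (gap \<theta> y) +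
        (\<integral>\<^sup>+x. ennreal (normal_density (arm_mean \<theta> y) 1 x) * exp_loss \<sigma> \<theta> k (Suc n) (h(n := (y, x))) \<partial>lborel)))"

text \<open>Joint measurability in history and parameter is what permits exchanging the integral
  over the next income with that over the prior.\<close>

lemma borel_measurable_exp_loss:
  assumes \<sigma>: "is_strategy \<sigma>"
  shows "(\<lambda>(h, \<theta>). exp_loss \<sigma> \<theta> k n h) \<in> borel_measurable (hist_space n \<Otimes>\<^sub>M (borel \<Otimes>\<^sub>M borel))"
proof (induction k arbitrary: n)
  case 0
  then show ?case by simp
next
  case (Suc k)
  have e: "(\<lambda>p. emeasure (\<sigma> n (fst p)) {y}) \<in> borel_measurable (hist_space n \<Otimes>\<^sub>M (borel \<Otimes>\<^sub>M borel))"
    if "y \<in> {1, 2}" for y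
  proof -
    have "\<sigma> n \<in> hist_space n \<rightarrow>\<^sub>M subprob_algebra action_space"
      using \<sigma> by (auto simp: is_strategy_def intro: measurable_prob_algebraD)
    then have "(\<lambda>h. emeasure (\<sigma> n h) {y}) \<in> borel_measurable (hist_space n)"
      using that by (intro measurable_compose[OF _ measurable_emeasure_subprob_algebra]) auto
    then show ?thesis by (rule measurable_compose[OF measurable_fst])
  qed
  have i: "(\<lambda>p. \<integral>\<^sup>+x. ennreal (normal_density (arm_mean (snd p) y) 1 x) *
      exp_loss \<sigma> (snd p) k (Suc n) ((fst p)(n := (y, x))) \<partial>lborel)
      \<in> borel_measurable (hist_space n \<Otimes>\<^sub>M (borel \<Otimes>\<^sub>M borel))" if y: "y \<in> {1, 2}" for y
  proof (rule lborel.borel_measurable_nn_integral)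
    let ?K = "(hist_space n \<Otimes>\<^sub>M (borel \<Otimes>\<^sub>M borel)) \<Otimes>\<^sub>M (lborel :: real measure)"
    have "(\<lambda>q. ((fst (fst q))(n := (y, snd q)), snd (fst q))) \<in> ?K \<rightarrow>\<^sub>M hist_space (Suc n) \<Otimes>\<^sub>M (borel \<Otimes>\<^sub>M borel)"
      using y by (intro measurable_Pair measurable_hist_upd) measurable
    from measurable_compose[OF this Suc.IH]
    have [measurable]: "(\<lambda>q. exp_loss \<sigma> (snd (fst q)) k (Suc n) ((fst (fst q))(n := (y, snd q)))) \<in> borel_measurable ?K"
      by simp
    have [measurable]: "(\<lambda>q. arm_mean (snd (fst q)) y) \<in> borel_measurable ?K"
      by (rule measurable_compose[OF _ borel_measurable_arm_mean]) measurable
    show "(\<lambda>(p, x). ennreal (normal_density (arm_mean (snd p) y) 1 x) *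
      exp_loss \<sigma> (snd p) k (Suc n) ((fst p)(n := (y, x)))) \<in> borel_measurable ?K"
      unfolding split_beta by measurable
  qed
  have g: "(\<lambda>p. ennreal (gap (snd p) y)) \<in> borel_measurable (hist_space n \<Otimes>\<^sub>M (borel \<Otimes>\<^sub>M borel))" for y
    by measurable
  show ?case
    unfolding split_beta exp_loss.simps
  proof (rule borel_measurable_sum)
    fix y :: nat assume y: "y \<in> {1, 2}"
    note [measurable] = e[OF y] i[OF y] g[of y]
    show "(\<lambda>p. emeasure (\<sigma> n (fst p)) {y} * (ennreal (gap (snd p) y) +
        (\<integral>\<^sup>+x. ennreal (normal_density (arm_mean (snd p) y) 1 x) *
          exp_loss \<sigma> (snd p) k (Suc n) ((fst p)(n := (y, x))) \<partial>lborel)))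
      \<in> borel_measurable (hist_space n \<Otimes>\<^sub>M (borel \<Otimes>\<^sub>M borel))"
      by measurable
  qed
qed

lemma borel_measurable_exp_loss_comp:
  assumes "is_strategy \<sigma>" "f \<in> K \<rightarrow>\<^sub>M hist_space n" "g \<in> K \<rightarrow>\<^sub>M borel \<Otimes>\<^sub>M borel"
  shows "(\<lambda>x. exp_loss \<sigma> (g x) k n (f x)) \<in> borel_measurable K"
  using measurable_compose[OF measurable_Pair[OF assms(2,3)] borel_measurable_exp_loss[OF assms(1)], of k]
  by simp

lemma exp_loss_le:
  assumes \<sigma>: "is_strategy \<sigma>" and "h \<in> space (hist_space n)"
  shows "exp_loss \<sigma> \<theta> k n h \<le> ennreal (real k * \<bar>fst \<theta> - snd \<theta>\<bar>)"
  using assms(2)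
proof (induction k arbitrary: n h)
  case 0
  then show ?case by simp
next
  case (Suc k)
  let ?d = "\<bar>fst \<theta> - snd \<theta>\<bar>"
  have "exp_loss \<sigma> \<theta> (Suc k) n h \<le> (\<Sum>y\<in>{1, 2}. emeasure (\<sigma> n h) {y} * ennreal (real (Suc k) * ?d))"
    unfolding exp_loss.simps
  proof (intro sum_mono mult_left_mono)
    fix y :: nat assume y: "y \<in> {1, 2}"
    have "(\<integral>\<^sup>+x. ennreal (normal_density (arm_mean \<theta> y) 1 x) * exp_loss \<sigma> \<theta> k (Suc n) (h(n := (y, x))) \<partial>lborel)
      \<le> (\<integral>\<^sup>+x. ennreal (normal_density (arm_mean \<theta> y) 1 x) * ennreal (real k * ?d) \<partial>lborel)"
      using Suc y by (intro nn_integral_mono mult_left_mono Suc.IH hist_space_upd) auto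
    also have "\<dots> = ennreal (real k * ?d)"
      by (simp add: nn_integral_multc nn_integral_normal_density)
    finally show "ennreal (gap \<theta> y) +
      (\<integral>\<^sup>+x. ennreal (normal_density (arm_mean \<theta> y) 1 x) * exp_loss \<sigma> \<theta> k (Suc n) (h(n := (y, x))) \<partial>lborel)
      \<le> ennreal (real (Suc k) * ?d)"
      using gap_le[of \<theta> y]
      by (simp add: distrib_right gap_nonneg add_mono ennreal_leI ennreal_plus)
  qed simp
  also have "\<dots> = ennreal (real (Suc k) * ?d)"
    using sum_strategy[OF \<sigma> Suc.prems] by (simp only: sum_distrib_right[symmetric] mult_1)
  finally show ?case .
qed

lemma exp_loss_finite:
  "is_strategy \<sigma> \<Longrightarrow> h \<in> space (hist_space n) \<Longrightarrow> exp_loss \<sigma> \<theta> k n h < \<infinity>"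
  using exp_loss_le[of \<sigma> h n \<theta> k] by (simp add: le_less_trans)

lemma measurable_hist_action:
  fixes f :: "nat \<Rightarrow> 'a :: topological_space"
  assumes "i < n"
  shows "(\<lambda>h. f (fst (h i))) \<in> borel_measurable (hist_space n)"
  by (rule measurable_compose[OF measurable_hist_fst[OF assms]]) simp

lemma measurable_obs_fst: "(\<lambda>z. f (fst z)) \<in> borel_measurable obs_space"
  unfolding obs_space_def by (rule measurable_compose[OF measurable_fst]) simp

text \<open>Ties the recursion to the actual law: the first step is peeled off, its regret is fixed
  by the action just taken, and the induction hypothesis covers the rest.\<close>

lemma nn_integral_continuation_gap:
  assumes \<sigma>: "is_strategy \<sigma>" and "h \<in> space (hist_space n)"
  shows "(\<integral>\<^sup>+h'. (\<Sum>i = n..<n + k. ennreal (gap \<theta> (fst (h' i)))) \<partial>continuation_law \<sigma> \<theta> n k h) =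
    exp_loss \<sigma> \<theta> k n h"
  using assms(2)
proof (induction k arbitrary: n h)
  case 0
  then show ?case by simp
next
  case (Suc k)
  interpret Ionescu_Tulcea "obs_kernel \<sigma> \<theta>" "\<lambda>_. obs_space"
    using \<sigma> by (rule Ionescu_Tulcea_obs_kernel)
  let ?f = "\<lambda>m h'. (\<Sum>i = m..<n + Suc k. ennreal (gap \<theta> (fst (h' i))))"
  have meas: "(\<lambda>h'. ennreal (gap \<theta> (fst (h' i)))) \<in> borel_measurable (hist_space (n + Suc k))" if "i < n + Suc k" for i
    using that by (rule measurable_hist_action)
  have fmeas: "?f m \<in> borel_measurable (hist_space (n + Suc k))" for m
    using meas by (intro borel_measurable_sum) auto
  have sets: "sets (continuation_law \<sigma> \<theta> (Suc n) k g) = sets (hist_space (n + Suc k))"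
    if "g \<in> space (hist_space (Suc n))" for g
    using that sets_C[of g "Suc n" k] by (simp add: continuation_law_def hist_space_def)
  have inner: "(\<integral>\<^sup>+h'. ?f n h' \<partial>continuation_law \<sigma> \<theta> (Suc n) k (h(n := (y, x)))) =
      ennreal (gap \<theta> y) + exp_loss \<sigma> \<theta> k (Suc n) (h(n := (y, x)))" if y: "y \<in> {1, 2}" for y x
  proof -
    let ?C = "continuation_law \<sigma> \<theta> (Suc n) k (h(n := (y, x)))"
    have g: "h(n := (y, x)) \<in> space (hist_space (Suc n))"
      using Suc.prems y by (rule hist_space_upd)
    have "(\<integral>\<^sup>+h'. ?f n h' \<partial>?C) = (\<integral>\<^sup>+h'. ennreal (gap \<theta> (fst (h' n))) + ?f (Suc n) h' \<partial>?C)"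
      by (intro nn_integral_cong sum.atLeast_Suc_lessThan) simp
    also have "\<dots> = (\<integral>\<^sup>+h'. ennreal (gap \<theta> (fst (h' n))) \<partial>?C) + (\<integral>\<^sup>+h'. ?f (Suc n) h' \<partial>?C)"
      using meas[of n] fmeas[of "Suc n"] unfolding measurable_cong_sets[OF sets[OF g, symmetric] refl]
      by (intro nn_integral_add) auto
    also have "(\<integral>\<^sup>+h'. ennreal (gap \<theta> (fst (h' n))) \<partial>?C) = ennreal (gap \<theta> y)"
      using nn_integral_continuation_past[OF \<sigma> g lessI measurable_obs_fst[of "\<lambda>y. ennreal (gap \<theta> y)"], of \<theta> k]
      by simp
    also have "(\<integral>\<^sup>+h'. ?f (Suc n) h' \<partial>?C) = exp_loss \<sigma> \<theta> k (Suc n) (h(n := (y, x)))"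
      using Suc.IH[OF g] by (simp only: add_Suc_right add_Suc)
    finally show ?thesis .
  qed
  have m1: "(\<lambda>z. \<integral>\<^sup>+h'. ?f n h' \<partial>continuation_law \<sigma> \<theta> (Suc n) k (h(n := z))) \<in> borel_measurable obs_space"
  proof -
    have h': "h \<in> space (PiM {0..<n} (\<lambda>_. obs_space))"
      using Suc.prems by (simp add: hist_space_def)
    have f': "?f n \<in> borel_measurable (PiM {0..<Suc n + k} (\<lambda>_. obs_space))"
      using fmeas[of n] by (simp only: hist_space_def add_Suc_right add_Suc)
    have "(\<lambda>z. h(n := z)) \<in> obs_space \<rightarrow>\<^sub>M PiM {0..<Suc n} (\<lambda>_. obs_space)"
      using h' by (intro measurable_fun_upd[where J = "{0..<n}"]) auto
    from measurable_compose[OF this measurable_compose[OF measurable_C nn_integral_measurable_subprob_algebra[OF f']]]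
    show ?thesis by (simp add: continuation_law_def)
  qed
  have "(\<integral>\<^sup>+h'. ?f n h' \<partial>continuation_law \<sigma> \<theta> n (Suc k) h) =
    (\<Sum>y\<in>{1, 2}. emeasure (\<sigma> n h) {y} *
       (\<integral>\<^sup>+x. ennreal (normal_density (arm_mean \<theta> y) 1 x) *
         (\<integral>\<^sup>+h'. ?f n h' \<partial>continuation_law \<sigma> \<theta> (Suc n) k (h(n := (y, x)))) \<partial>lborel))"
    by (simp only: nn_integral_continuation_Suc[OF \<sigma> Suc.prems fmeas] nn_integral_obs_kernel[OF \<sigma> Suc.prems m1])
  also have "\<dots> = exp_loss \<sigma> \<theta> (Suc k) n h"
    unfolding exp_loss.simps
  proof (intro sum.cong refl arg_cong[where f = "(*) _"])
    fix y :: nat assume y: "y \<in> {1, 2}"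
    have [measurable]: "(\<lambda>x. exp_loss \<sigma> \<theta> k (Suc n) (h(n := (y, x)))) \<in> borel_measurable borel"
      using Suc.prems y
      by (intro borel_measurable_exp_loss_comp[OF \<sigma>] measurable_hist_upd measurable_const)
        (auto simp: space_pair_measure)
    show "(\<integral>\<^sup>+x. ennreal (normal_density (arm_mean \<theta> y) 1 x) *
         (\<integral>\<^sup>+h'. ?f n h' \<partial>continuation_law \<sigma> \<theta> (Suc n) k (h(n := (y, x)))) \<partial>lborel) =
      ennreal (gap \<theta> y) + (\<integral>\<^sup>+x. ennreal (normal_density (arm_mean \<theta> y) 1 x) *
         exp_loss \<sigma> \<theta> k (Suc n) (h(n := (y, x))) \<partial>lborel)"
      unfolding inner[OF y] distrib_left
      by (subst nn_integral_add) (auto simp: nn_integral_multc nn_integral_normal_density)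
  qed
  finally show ?case .
qed

lemma remaining_loss_eq:
  assumes \<sigma>: "is_strategy \<sigma>" and h: "h \<in> space (hist_space n)" and "n \<le> N"
  shows "remaining_loss N \<sigma> n h \<theta> = enn2real (exp_loss \<sigma> \<theta> (N - n) n h)"
proof -
  interpret Ionescu_Tulcea "obs_kernel \<sigma> \<theta>" "\<lambda>_. obs_space"
    using \<sigma> by (rule Ionescu_Tulcea_obs_kernel)
  have sets: "sets (continuation_law \<sigma> \<theta> n (N - n) h) = sets (hist_space N)"
    using h sets_C[of h n "N - n"] assms(3) by (simp add: continuation_law_def hist_space_def)
  have "(\<lambda>h'. \<Sum>i = n..<N. gap \<theta> (fst (h' i))) \<in> borel_measurable (hist_space N)"
    by (intro borel_measurable_sum measurable_hist_action) auto
  then have m: "(\<lambda>h'. \<Sum>i = n..<N. gap \<theta> (fst (h' i))) \<in> borel_measurable (continuation_law \<sigma> \<theta> n (N - n) h)"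
    using sets by (simp cong: measurable_cong_sets)
  have "remaining_loss N \<sigma> n h \<theta> =
    enn2real (\<integral>\<^sup>+h'. ennreal (\<Sum>i = n..<N. gap \<theta> (fst (h' i))) \<partial>continuation_law \<sigma> \<theta> n (N - n) h)"
    unfolding remaining_loss_def gap_def[symmetric] using m
    by (intro integral_eq_nn_integral) (auto simp: gap_nonneg sum_nonneg)
  then show ?thesis
    using nn_integral_continuation_gap[OF \<sigma> h, of \<theta> "N - n"] assms(3)
    by (simp add: sum_ennreal gap_nonneg)
qed

text \<open>Tower property, proved by peeling off the last step, whose conditional law given the
  past is the kernel. It serves to replace an income by its conditional mean given the
  action.\<close>

lemma nn_integral_history_sum_cong:
  assumes \<sigma>: "is_strategy \<sigma>" and f: "f \<in> borel_measurable obs_space" and g: "g \<in> borel_measurable obs_space"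
    and eq: "\<And>y. y \<in> {1, 2} \<Longrightarrow> (\<integral>\<^sup>+x. ennreal (normal_density (arm_mean \<theta> y) 1 x) * f (y, x) \<partial>lborel) =
      (\<integral>\<^sup>+x. ennreal (normal_density (arm_mean \<theta> y) 1 x) * g (y, x) \<partial>lborel)"
  shows "(\<integral>\<^sup>+h. (\<Sum>i<n. f (h i)) \<partial>history_law \<sigma> \<theta> n) = (\<integral>\<^sup>+h. (\<Sum>i<n. g (h i)) \<partial>history_law \<sigma> \<theta> n)"
proof -
  interpret Ionescu_Tulcea "obs_kernel \<sigma> \<theta>" "\<lambda>_. obs_space"
    using \<sigma> by (rule Ionescu_Tulcea_obs_kernel)
  let ?P = "\<lambda>n :: nat. PiM {0..<n} (\<lambda>_. obs_space)"
  let ?u = "\<lambda>_. undefined :: nat \<times> real"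
  have u: "?u \<in> space (?P 0)" by (auto simp: space_PiM)
  have sumP: "(\<lambda>h. \<Sum>i<m. f (h i)) \<in> borel_measurable (?P n)"
    if "f \<in> borel_measurable obs_space" "m \<le> n" for f :: "nat \<times> real \<Rightarrow> ennreal" and m n
    using that by (intro borel_measurable_sum measurable_compose[OF measurable_component_singleton]) auto
  have step: "(\<integral>\<^sup>+h. (\<Sum>i<Suc n. f (h i)) \<partial>C 0 (Suc n) ?u) =
    (\<integral>\<^sup>+h. (\<Sum>i<n. f (h i)) \<partial>C 0 n ?u) + (\<integral>\<^sup>+h. (\<integral>\<^sup>+z. f z \<partial>obs_kernel \<sigma> \<theta> n h) \<partial>C 0 n ?u)"
    if f: "f \<in> borel_measurable obs_space" for f n
  proof -
    have sets: "sets (C 0 n ?u) = sets (?P n)"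
      using sets_C[OF u, of n] by simp
    have "(\<integral>\<^sup>+h. (\<Sum>i<Suc n. f (h i)) \<partial>C 0 (Suc n) ?u) =
      (\<integral>\<^sup>+h. (\<integral>\<^sup>+h'. (\<Sum>i<Suc n. f (h' i)) \<partial>eP n h) \<partial>C 0 n ?u)"
      using sumP[OF f, of "Suc n" "Suc n"] measurable_eP[of n] sets unfolding C.simps add_0
      by (intro nn_integral_bind[where B = "?P (Suc n)"]) (auto cong: measurable_cong_sets)
    also have "\<dots> = (\<integral>\<^sup>+h. (\<Sum>i<n. f (h i)) + (\<integral>\<^sup>+z. f z \<partial>obs_kernel \<sigma> \<theta> n h) \<partial>C 0 n ?u)"
    proof (intro nn_integral_cong)
      fix h assume "h \<in> space (C 0 n ?u)"
      then have h: "h \<in> space (?P n)" using sets_eq_imp_space_eq[OF sets] by simp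
      interpret P: prob_space "obs_kernel \<sigma> \<theta> n h" by (rule prob_space_P[OF h])
      show "(\<integral>\<^sup>+h'. (\<Sum>i<Suc n. f (h' i)) \<partial>eP n h) = (\<Sum>i<n. f (h i)) + (\<integral>\<^sup>+z. f z \<partial>obs_kernel \<sigma> \<theta> n h)"
        using f sets_P[OF h] h sumP[OF f, of "Suc n" "Suc n"]
        by (subst nn_integral_eP)
          (auto simp: nn_integral_add P.emeasure_space_1 cong: measurable_cong_sets)
    qed
    also have "\<dots> = (\<integral>\<^sup>+h. (\<Sum>i<n. f (h i)) \<partial>C 0 n ?u) + (\<integral>\<^sup>+h. (\<integral>\<^sup>+z. f z \<partial>obs_kernel \<sigma> \<theta> n h) \<partial>C 0 n ?u)"
      using sumP[OF f, of n n] sets measurable_compose[OF P nn_integral_measurable_subprob_algebra[OF f], of n]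
      by (intro nn_integral_add) (auto cong: measurable_cong_sets)
    finally show ?thesis .
  qed
  have kernel: "(\<integral>\<^sup>+h. (\<integral>\<^sup>+z. f z \<partial>obs_kernel \<sigma> \<theta> n h) \<partial>C 0 n ?u) =
    (\<integral>\<^sup>+h. (\<integral>\<^sup>+z. g z \<partial>obs_kernel \<sigma> \<theta> n h) \<partial>C 0 n ?u)" for n
  proof (rule nn_integral_cong)
    fix h assume "h \<in> space (C 0 n ?u)"
    then have "h \<in> space (hist_space n)"
      using space_C[OF u, of n] by (simp add: hist_space_def)
    then show "(\<integral>\<^sup>+z. f z \<partial>obs_kernel \<sigma> \<theta> n h) = (\<integral>\<^sup>+z. g z \<partial>obs_kernel \<sigma> \<theta> n h)"
      by (simp add: nn_integral_obs_kernel[OF \<sigma>] f g eq cong: sum.cong)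
  qed
  have "(\<integral>\<^sup>+h. (\<Sum>i<n. f (h i)) \<partial>C 0 n ?u) = (\<integral>\<^sup>+h. (\<Sum>i<n. g (h i)) \<partial>C 0 n ?u)"
  proof (induction n)
    case (Suc n)
    then show ?case using step[OF f, of n] step[OF g, of n] kernel[of n] by simp
  qed simp
  then show ?thesis by (simp add: history_law_def continuation_law_def)
qed

text \<open>Given the action, an income has the mean of the chosen arm, so the loss defined by
  incomes is an expected sum of regrets. Incomes are unbounded and of both signs; their positive and
  negative parts are therefore treated apart until integrability is known.\<close>

lemma loss_eq_remaining_loss:
  assumes \<sigma>: "is_strategy \<sigma>"
  shows "loss N \<sigma> \<theta> = remaining_loss N \<sigma> 0 (\<lambda>_. undefined) \<theta>"
proof -
  interpret Ionescu_Tulcea "obs_kernel \<sigma> \<theta>" "\<lambda>_. obs_space"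
    using \<sigma> by (rule Ionescu_Tulcea_obs_kernel)
  let ?L = "history_law \<sigma> \<theta> N"
  have u: "(\<lambda>_. undefined) \<in> space (PiM {0..<0 :: nat} (\<lambda>_. obs_space))" by (auto simp: space_PiM)
  have sets: "sets ?L = sets (hist_space N)"
    using sets_C[OF u, of N] by (simp add: history_law_def continuation_law_def hist_space_def)
  have space: "space ?L = space (hist_space N)"
    by (rule sets_eq_imp_space_eq[OF sets])
  interpret L: prob_space ?L
    using prob_space_C[OF u, of N] by (simp add: history_law_def continuation_law_def)
  have act [measurable]: "(\<lambda>h. f (fst (h i))) \<in> borel_measurable ?L" if "i < N" for i and f :: "nat \<Rightarrow> real"
    using measurable_hist_action[OF that] unfolding measurable_cong_sets[OF sets refl] .
  have inc [measurable]: "(\<lambda>h. snd (h i)) \<in> borel_measurable ?L" if "i < N" for i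
    using measurable_hist_snd[OF that] unfolding measurable_cong_sets[OF sets refl] .
  have int_act: "integrable ?L (\<lambda>h. f (fst (h i)))" if i: "i < N" for i and f :: "nat \<Rightarrow> real"
  proof (rule L.integrable_const_bound[where B = "max \<bar>f 1\<bar> \<bar>f 2\<bar>"])
    show "AE h in ?L. norm (f (fst (h i))) \<le> max \<bar>f 1\<bar> \<bar>f 2\<bar>"
      using fst_hist[OF _ i] unfolding space[symmetric] by (intro AE_I2) fastforce
  qed (use i in measurable)
  \<comment> \<open>\<open>ennreal\<close> cuts negative values to 0, so \<open>P 1 y\<close> and
    \<open>P (-1) y\<close> are the means of the positive and the negative part of an income of arm
    \<open>y\<close>.\<close>
  define P where "P s y = enn2real (\<integral>\<^sup>+x. ennreal (normal_density (arm_mean \<theta> y) 1 x) * ennreal (s * x) \<partial>lborel)" for s :: real and y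
  have moment: "integrable lborel (\<lambda>x. normal_density (arm_mean \<theta> y) 1 x * x)" for y
    by (rule integrable_normal_moment_nz_1) simp
  have P: "ennreal (P s y) = (\<integral>\<^sup>+x. ennreal (normal_density (arm_mean \<theta> y) 1 x) * ennreal (s * x) \<partial>lborel)"
    if "s \<in> {1, -1}" for s y
  proof -
    have "(\<integral>\<^sup>+x. ennreal (normal_density (arm_mean \<theta> y) 1 x * x) \<partial>lborel) \<noteq> \<infinity>"
      "(\<integral>\<^sup>+x. ennreal (- (normal_density (arm_mean \<theta> y) 1 x * x)) \<partial>lborel) \<noteq> \<infinity>"
      using moment[of y] unfolding real_integrable_def by auto
    then show ?thesis
      using that by (auto simp: P_def ennreal_mult'[symmetric] less_top)
  qed
  have mean: "P 1 y - P (-1) y = arm_mean \<theta> y" for y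
  proof -
    have "P 1 y - P (-1) y = (\<integral>x. normal_density (arm_mean \<theta> y) 1 x * x \<partial>lborel)"
      unfolding real_lebesgue_integral_def[OF moment] by (simp add: P_def ennreal_mult'[symmetric])
    then show ?thesis by (simp add: integral_normal_moment_nz_1)
  qed
  have sum_P: "(\<Sum>i<N. \<integral>\<^sup>+h. ennreal (s * snd (h i)) \<partial>?L) = ennreal (\<Sum>i<N. \<integral>h. P s (fst (h i)) \<partial>?L)"
    if s: "s \<in> {1, -1}" for s
  proof -
    have "(\<Sum>i<N. \<integral>\<^sup>+h. ennreal (s * snd (h i)) \<partial>?L) = (\<integral>\<^sup>+h. (\<Sum>i<N. ennreal (s * snd (h i))) \<partial>?L)"
      by (intro nn_integral_sum[symmetric]) simp
    also have "\<dots> = (\<integral>\<^sup>+h. (\<Sum>i<N. ennreal (P s (fst (h i)))) \<partial>?L)"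
    proof (rule nn_integral_history_sum_cong[OF \<sigma>])
      show "(\<lambda>z. ennreal (s * snd z)) \<in> borel_measurable obs_space"
        unfolding obs_space_def by measurable
      show "(\<lambda>z. ennreal (P s (fst z))) \<in> borel_measurable obs_space"
        by (rule measurable_obs_fst)
      show "(\<integral>\<^sup>+x. ennreal (normal_density (arm_mean \<theta> y) 1 x) * ennreal (s * snd (y, x)) \<partial>lborel) =
        (\<integral>\<^sup>+x. ennreal (normal_density (arm_mean \<theta> y) 1 x) * ennreal (P s (fst (y, x))) \<partial>lborel)" for y
        by (simp add: nn_integral_multc nn_integral_normal_density P[OF s])
    qed
    also have "\<dots> = (\<Sum>i<N. \<integral>\<^sup>+h. ennreal (P s (fst (h i))) \<partial>?L)"
      by (intro nn_integral_sum) simp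
    also have "\<dots> = (\<Sum>i<N. ennreal (\<integral>h. P s (fst (h i)) \<partial>?L))"
      by (intro sum.cong refl nn_integral_eq_integral int_act) (auto simp: P_def)
    also have "\<dots> = ennreal (\<Sum>i<N. \<integral>h. P s (fst (h i)) \<partial>?L)"
      by (intro sum_ennreal Bochner_Integration.integral_nonneg) (simp add: P_def)
    finally show ?thesis .
  qed
  have fin: "(\<integral>\<^sup>+h. ennreal (s * snd (h i)) \<partial>?L) < \<infinity>" if "s \<in> {1, -1}" "i < N" for s i
  proof -
    have "(\<integral>\<^sup>+h. ennreal (s * snd (h i)) \<partial>?L) \<le> (\<Sum>i<N. \<integral>\<^sup>+h. ennreal (s * snd (h i)) \<partial>?L)"
      using that(2) by (intro member_le_sum) auto
    also have "\<dots> < \<infinity>" unfolding sum_P[OF that(1)] by simp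
    finally show ?thesis .
  qed
  \<comment> \<open>Only now is the integrability of the incomes under the history law available:
    both parts have finite mean.\<close>
  have int_inc: "integrable ?L (\<lambda>h. snd (h i))" if "i < N" for i
    using fin[of 1 i] fin[of "-1" i] that by (simp add: real_integrable_def less_top)
  have "(\<Sum>i<N. enn2real (\<integral>\<^sup>+h. ennreal (s * snd (h i)) \<partial>?L)) = (\<Sum>i<N. \<integral>h. P s (fst (h i)) \<partial>?L)"
    if s: "s \<in> {1, -1}" for s
  proof -
    have "(\<Sum>i<N. enn2real (\<integral>\<^sup>+h. ennreal (s * snd (h i)) \<partial>?L)) =
      enn2real (\<Sum>i<N. \<integral>\<^sup>+h. ennreal (s * snd (h i)) \<partial>?L)"
      using fin[OF s] by (subst enn2real_sum) auto
    then show ?thesis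
      unfolding sum_P[OF s] by (simp add: P_def sum_nonneg)
  qed
  note sums = this[of 1] this[of "-1"]
  have "(\<integral>h. (\<Sum>i<N. snd (h i)) \<partial>?L) = (\<Sum>i<N. \<integral>h. snd (h i) \<partial>?L)"
    using int_inc by (intro Bochner_Integration.integral_sum) simp
  also have "\<dots> = (\<Sum>i<N. enn2real (\<integral>\<^sup>+h. ennreal (1 * snd (h i)) \<partial>?L) - enn2real (\<integral>\<^sup>+h. ennreal (- 1 * snd (h i)) \<partial>?L))"
    using int_inc by (intro sum.cong) (auto simp: real_lebesgue_integral_def)
  also have "\<dots> = (\<Sum>i<N. (\<integral>h. P 1 (fst (h i)) \<partial>?L) - (\<integral>h. P (-1) (fst (h i)) \<partial>?L))"
    using sums by (simp only: sum_subtractf insert_iff simp_thms)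
  also have "\<dots> = (\<Sum>i<N. \<integral>h. arm_mean \<theta> (fst (h i)) \<partial>?L)"
    by (intro sum.cong refl) (simp add: int_act mean flip: Bochner_Integration.integral_diff)
  finally have S: "(\<integral>h. (\<Sum>i<N. snd (h i)) \<partial>?L) = (\<Sum>i<N. \<integral>h. arm_mean \<theta> (fst (h i)) \<partial>?L)" .
  have "remaining_loss N \<sigma> 0 (\<lambda>_. undefined) \<theta> =
    (\<integral>h. (\<Sum>i<N. max (fst \<theta>) (snd \<theta>) - arm_mean \<theta> (fst (h i))) \<partial>?L)"
    by (simp add: remaining_loss_def history_law_def lessThan_atLeast0)
  also have "\<dots> = (\<Sum>i<N. \<integral>h. max (fst \<theta>) (snd \<theta>) - arm_mean \<theta> (fst (h i)) \<partial>?L)"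
    using int_act by (intro Bochner_Integration.integral_sum) simp
  also have "\<dots> = (\<Sum>i<N. max (fst \<theta>) (snd \<theta>) - (\<integral>h. arm_mean \<theta> (fst (h i)) \<partial>?L))"
    by (intro sum.cong refl) (simp add: int_act L.prob_space)
  finally show ?thesis
    by (simp add: loss_def S sum_subtractf)
qed

section \<open>Losses weighted by the likelihood\<close>

definition means :: "real \<times> real \<Rightarrow> real \<times> real" where
  "means p = (fst p + snd p, fst p - snd p)"

lemma measurable_means [measurable]: "means \<in> borel \<Otimes>\<^sub>M borel \<rightarrow>\<^sub>M borel \<Otimes>\<^sub>M borel"
  unfolding means_def[abs_def] by measurable

definition likelihood :: "nat \<Rightarrow> history \<Rightarrow> real \<times> real \<Rightarrow> real" where
  "likelihood n h \<theta> = (\<Prod>i<n. normal_density (arm_mean \<theta> (fst (h i))) 1 (snd (h i)))"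

lemma likelihood_nonneg: "0 \<le> likelihood n h \<theta>"
  by (simp add: likelihood_def prod_nonneg)

lemma likelihood_Suc:
  "likelihood (Suc n) (h(n := (y, x))) \<theta> = likelihood n h \<theta> * normal_density (arm_mean \<theta> y) 1 x"
  by (simp add: likelihood_def)

lemma borel_measurable_likelihood [measurable]: "likelihood n h \<in> borel_measurable (borel \<Otimes>\<^sub>M borel)"
  unfolding likelihood_def[abs_def] by measurable

text \<open>\<open>\<pi>\<close> is a possibly improper prior density of \<open>(m, v)\<close>; nothing is normalized.\<close>

definition weighted_loss :: "strategy \<Rightarrow> (real \<times> real \<Rightarrow> real) \<Rightarrow> nat \<Rightarrow> nat \<Rightarrow> history \<Rightarrow> ennreal" where
  "weighted_loss \<sigma> \<pi> k n h =
     (\<integral>\<^sup>+p. exp_loss \<sigma> (means p) k n h * ennreal (likelihood n h (means p) * \<pi> p) \<partial>(lborel \<Otimes>\<^sub>M lborel))"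

definition weighted_gap :: "(real \<times> real \<Rightarrow> real) \<Rightarrow> nat \<Rightarrow> nat \<Rightarrow> history \<Rightarrow> ennreal" where
  "weighted_gap \<pi> y n h =
     (\<integral>\<^sup>+p. ennreal (gap (means p) y * (likelihood n h (means p) * \<pi> p)) \<partial>(lborel \<Otimes>\<^sub>M lborel))"

lemma weighted_loss_0: "weighted_loss \<sigma> \<pi> 0 n h = 0"
  by (simp add: weighted_loss_def)

text \<open>Bayesian updating without normalization: the likelihood of the extended history absorbs
  the density of the next income, and Tonelli moves the integral over that income outside the
  integral over the parameter.\<close>

lemma weighted_loss_Suc:
  assumes \<sigma>: "is_strategy \<sigma>" and h: "h \<in> space (hist_space n)"
    and \<pi> [measurable]: "\<pi> \<in> borel_measurable (borel \<Otimes>\<^sub>M borel)" and \<pi>_nonneg: "\<And>p. 0 \<le> \<pi> p"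
  shows "weighted_loss \<sigma> \<pi> (Suc k) n h =
    (\<Sum>y\<in>{1, 2}. emeasure (\<sigma> n h) {y} *
       (weighted_gap \<pi> y n h + (\<integral>\<^sup>+x. weighted_loss \<sigma> \<pi> k (Suc n) (h(n := (y, x))) \<partial>lborel)))"
proof -
  let ?w = "\<lambda>p. likelihood n h (means p) * \<pi> p"
  have w_nonneg: "0 \<le> ?w p" for p
    by (simp add: likelihood_nonneg \<pi>_nonneg)
  let ?nd = "\<lambda>y p x. ennreal (normal_density (arm_mean (means p) y) 1 x)"
  let ?e = "\<lambda>y p x. exp_loss \<sigma> (means p) k (Suc n) (h(n := (y, x)))"
  have nd_meas [measurable]: "(\<lambda>p. arm_mean (means p) y) \<in> borel_measurable (borel \<Otimes>\<^sub>M borel)" for y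
    by (rule measurable_compose[OF measurable_means borel_measurable_arm_mean])
  have e_meas: "(\<lambda>q. ?e y (fst q) (snd q)) \<in> borel_measurable ((borel \<Otimes>\<^sub>M borel) \<Otimes>\<^sub>M borel)"
    if "y \<in> {1, 2}" for y
    using h that
    by (intro borel_measurable_exp_loss_comp[OF \<sigma>] measurable_hist_upd measurable_const) (auto, measurable)
  have prod_meas: "(\<lambda>q. ?nd y (fst q) (snd q) * ?e y (fst q) (snd q)) \<in> borel_measurable ((borel \<Otimes>\<^sub>M borel) \<Otimes>\<^sub>M borel)"
    if "y \<in> {1, 2}" for y
    using e_meas[OF that] by measurable
  have inner: "(\<integral>\<^sup>+p. (ennreal (gap (means p) y) + (\<integral>\<^sup>+x. ?nd y p x * ?e y p x \<partial>lborel)) * ennreal (?w p) \<partial>(lborel \<Otimes>\<^sub>M lborel)) =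
    weighted_gap \<pi> y n h + (\<integral>\<^sup>+x. weighted_loss \<sigma> \<pi> k (Suc n) (h(n := (y, x))) \<partial>lborel)"
    if y: "y \<in> {1, 2}" for y
  proof -
    have [measurable]: "(\<lambda>p. \<integral>\<^sup>+x. ?nd y p x * ?e y p x \<partial>lborel) \<in> borel_measurable (lborel \<Otimes>\<^sub>M lborel)"
      using prod_meas[OF y] by (intro lborel.borel_measurable_nn_integral) (simp add: split_beta)
    have [measurable]: "(\<lambda>p. gap (means p) y) \<in> borel_measurable (borel \<Otimes>\<^sub>M borel)"
      by (rule measurable_compose[OF measurable_means borel_measurable_gap])
    have sec [measurable]: "(\<lambda>x. ?nd y p x * ?e y p x) \<in> borel_measurable borel" for p
      using measurable_compose[OF _ prod_meas[OF y], of "\<lambda>x. (p, x)" borel] by (simp add: space_pair_measure)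
    have "(\<integral>\<^sup>+p. (ennreal (gap (means p) y) + (\<integral>\<^sup>+x. ?nd y p x * ?e y p x \<partial>lborel)) * ennreal (?w p) \<partial>(lborel \<Otimes>\<^sub>M lborel)) =
      (\<integral>\<^sup>+p. ennreal (gap (means p) y * ?w p) + (\<integral>\<^sup>+x. ?nd y p x * ?e y p x * ennreal (?w p) \<partial>lborel) \<partial>(lborel \<Otimes>\<^sub>M lborel))"
      by (intro nn_integral_cong) (simp add: distrib_right nn_integral_multc ennreal_mult gap_nonneg w_nonneg)
    also have "\<dots> = weighted_gap \<pi> y n h +
      (\<integral>\<^sup>+p. (\<integral>\<^sup>+x. ?nd y p x * ?e y p x * ennreal (?w p) \<partial>lborel) \<partial>(lborel \<Otimes>\<^sub>M lborel))"
      unfolding weighted_gap_def by (subst nn_integral_add) (auto simp: nn_integral_multc)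
    also have "(\<integral>\<^sup>+p. (\<integral>\<^sup>+x. ?nd y p x * ?e y p x * ennreal (?w p) \<partial>lborel) \<partial>(lborel \<Otimes>\<^sub>M lborel)) =
      (\<integral>\<^sup>+x. (\<integral>\<^sup>+p. ?nd y p x * ?e y p x * ennreal (?w p) \<partial>(lborel \<Otimes>\<^sub>M lborel)) \<partial>lborel)"
    proof -
      interpret pp: pair_sigma_finite "lborel \<Otimes>\<^sub>M lborel :: (real \<times> real) measure" "lborel :: real measure"
        unfolding lborel_prod by standard
      have "(\<lambda>(p, x). ?nd y p x * ?e y p x * ennreal (?w p)) \<in> borel_measurable ((lborel \<Otimes>\<^sub>M lborel) \<Otimes>\<^sub>M lborel)"
        using prod_meas[OF y] unfolding split_beta by measurable
      then show ?thesis by (rule pp.Fubini'[symmetric])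
    qed
    also have "\<dots> = (\<integral>\<^sup>+x. weighted_loss \<sigma> \<pi> k (Suc n) (h(n := (y, x))) \<partial>lborel)"
      unfolding weighted_loss_def likelihood_Suc
      by (intro nn_integral_cong)
        (simp add: ennreal_mult likelihood_nonneg \<pi>_nonneg mult_ac)
    finally show ?thesis .
  qed
  have meas: "(\<lambda>p. (ennreal (gap (means p) y) + (\<integral>\<^sup>+x. ?nd y p x * ?e y p x \<partial>lborel)) * ennreal (?w p))
      \<in> borel_measurable (lborel \<Otimes>\<^sub>M lborel)" if y: "y \<in> {1, 2}" for y
  proof -
    have [measurable]: "(\<lambda>p. \<integral>\<^sup>+x. ?nd y p x * ?e y p x \<partial>lborel) \<in> borel_measurable (lborel \<Otimes>\<^sub>M lborel)"
      using prod_meas[OF y] by (intro lborel.borel_measurable_nn_integral) (simp add: split_beta)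
    have [measurable]: "(\<lambda>p. gap (means p) y) \<in> borel_measurable (borel \<Otimes>\<^sub>M borel)"
      by (rule measurable_compose[OF measurable_means borel_measurable_gap])
    show ?thesis by measurable
  qed
  have "weighted_loss \<sigma> \<pi> (Suc k) n h = (\<integral>\<^sup>+p. (\<Sum>y\<in>{1, 2}. emeasure (\<sigma> n h) {y} *
      ((ennreal (gap (means p) y) + (\<integral>\<^sup>+x. ?nd y p x * ?e y p x \<partial>lborel)) * ennreal (?w p))) \<partial>(lborel \<Otimes>\<^sub>M lborel))"
    unfolding weighted_loss_def exp_loss.simps by (simp only: sum_distrib_right mult.assoc)
  also have "\<dots> = (\<Sum>y\<in>{1, 2}. \<integral>\<^sup>+p. emeasure (\<sigma> n h) {y} *
      ((ennreal (gap (means p) y) + (\<integral>\<^sup>+x. ?nd y p x * ?e y p x \<partial>lborel)) * ennreal (?w p)) \<partial>(lborel \<Otimes>\<^sub>M lborel))"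
    by (intro nn_integral_sum borel_measurable_times_ennreal[OF borel_measurable_const] meas)
  also have "\<dots> = (\<Sum>y\<in>{1, 2}. emeasure (\<sigma> n h) {y} *
      (\<integral>\<^sup>+p. (ennreal (gap (means p) y) + (\<integral>\<^sup>+x. ?nd y p x * ?e y p x \<partial>lborel)) * ennreal (?w p) \<partial>(lborel \<Otimes>\<^sub>M lborel)))"
    by (intro sum.cong refl nn_integral_cmult meas)
  also have "\<dots> = (\<Sum>y\<in>{1, 2}. emeasure (\<sigma> n h) {y} *
       (weighted_gap \<pi> y n h + (\<integral>\<^sup>+x. weighted_loss \<sigma> \<pi> k (Suc n) (h(n := (y, x))) \<partial>lborel)))"
    by (intro sum.cong refl) (simp only: inner)
  finally show ?thesis .
qed

section \<open>The likelihood and its statistics\<close>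

text \<open>Conjugate update of a normal law of \<open>m\<close> with precision \<open>a\<close>.
  The residual of the observation is shifted by a term linear in \<open>v\<close>; the exponential
  that splits off carries the increments of the contrast and of the information.\<close>

lemma normal_density_update:
  fixes a b e m v y \<mu> :: real
  assumes a: "0 < a" and y: "y - \<mu> = e - 2 * v * b / a"
  shows "normal_density \<mu> (1 / sqrt a) m * normal_density m 1 y =
    normal_density 0 (sqrt (1 + 1 / a)) e *
    exp (2 * v * (b * e / (a + 1)) - 2 * v\<^sup>2 * (b\<^sup>2 / (a * (a + 1)))) *
    normal_density ((a * \<mu> + y) / (a + 1)) (1 / sqrt (a + 1)) m"
proof -
  have a1: "0 < a + 1" using a by simp
  define d z where "d = y - \<mu>" and "z = m - \<mu>"
  have sq: "(1 / sqrt a)\<^sup>2 = 1 / a" "(sqrt (1 + 1 / a))\<^sup>2 = 1 + 1 / a" "(1 / sqrt (a + 1))\<^sup>2 = 1 / (a + 1)"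
    using a by (simp_all add: power_divide)
  \<comment> \<open>The normalizing factors agree because
    \<open>(1 / a) * 1 = (1 + 1 / a) * (1 / (a + 1))\<close>.\<close>
  have pre: "1 / sqrt (2 * pi * (1 / a)) * (1 / sqrt (2 * pi * 1\<^sup>2)) =
    1 / sqrt (2 * pi * (1 + 1 / a)) * (1 / sqrt (2 * pi * (1 / (a + 1))))"
  proof -
    have "(2 * pi * (1 / a)) * (2 * pi * 1\<^sup>2) = (2 * pi * (1 + 1 / a)) * (2 * pi * (1 / (a + 1)))"
    proof -
      have "(1 + 1 / a) * (1 / (a + 1)) = 1 / a"
        using a a1 by (simp add: divide_simps)
      then have "(2 * pi) * (2 * pi) * (1 / a) = (2 * pi) * (2 * pi) * ((1 + 1 / a) * (1 / (a + 1)))"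
        by (simp only:)
      then show ?thesis by (simp only: mult_ac power_one mult_1_right mult_1)
    qed
    then have "sqrt (2 * pi * (1 / a)) * sqrt (2 * pi * 1\<^sup>2) = sqrt (2 * pi * (1 + 1 / a)) * sqrt (2 * pi * (1 / (a + 1)))"
      by (simp only: real_sqrt_mult[symmetric])
    then show ?thesis by (simp only: times_divide_times_eq mult_1)
  qed
  have mean: "m - (a * \<mu> + y) / (a + 1) = z - d / (a + 1)"
    using a1 by (simp add: z_def d_def field_simps)
  \<comment> \<open>Completing the square in \<open>z\<close> leaves the posterior precision
    \<open>a + 1\<close> and a residual term with the predictive variance
    \<open>1 + 1 / a\<close>.\<close>
  have f1: "a * z\<^sup>2 + (d - z)\<^sup>2 = (a + 1) * (z - d / (a + 1))\<^sup>2 + a * d\<^sup>2 / (a + 1)"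
  proof -
    have "(a + 1) * (z - d / (a + 1))\<^sup>2 = (a + 1) * z\<^sup>2 - 2 * z * d + d\<^sup>2 / (a + 1)"
    proof -
      define f where "f = d / (a + 1)"
      have d: "d = (a + 1) * f" using a1 by (simp add: f_def)
      have "d\<^sup>2 / (a + 1) = (a + 1) * f\<^sup>2"
        using a1 by (simp add: d power2_eq_square)
      then show ?thesis
        unfolding f_def[symmetric] by (simp add: d power2_eq_square algebra_simps)
    qed
    moreover have "d\<^sup>2 / (a + 1) + a * d\<^sup>2 / (a + 1) = (a + 1) * d\<^sup>2 / (a + 1)"
      by (simp add: distrib_right add_divide_distrib)
    then have "d\<^sup>2 / (a + 1) + a * d\<^sup>2 / (a + 1) = d\<^sup>2"
      using a1 by simp
    ultimately show ?thesis by (simp add: power2_eq_square algebra_simps)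
  qed
  \<comment> \<open>Expanding around \<open>v = 0\<close> separates the predictive term from a
    linear and a quadratic term in \<open>v\<close>.\<close>
  have f2: "a * d\<^sup>2 / (a + 1) = a * e\<^sup>2 / (a + 1) - 4 * v * (b * e / (a + 1)) + 4 * v\<^sup>2 * (b\<^sup>2 / (a * (a + 1)))"
  proof -
    have "a * d\<^sup>2 = a * e\<^sup>2 - 4 * v * (b * e) + 4 * v\<^sup>2 * (b\<^sup>2 / a)"
      using a unfolding d_def y by (simp add: power2_eq_square field_simps)
    then show ?thesis by (simp add: add_divide_distrib diff_divide_distrib)
  qed
  have f3: "- (m - \<mu>)\<^sup>2 / (2 * (1 / a)) + - (y - m)\<^sup>2 / (2 * 1\<^sup>2) = - (a * z\<^sup>2 + (d - z)\<^sup>2) / 2"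
    by (simp add: z_def d_def field_simps)
  have f4: "- (e - 0)\<^sup>2 / (2 * (1 + 1 / a)) = - (a * e\<^sup>2 / (a + 1)) / 2"
    using a a1 by (simp add: field_simps)
  have f5: "- (m - (a * \<mu> + y) / (a + 1))\<^sup>2 / (2 * (1 / (a + 1))) = - ((a + 1) * (z - d / (a + 1))\<^sup>2) / 2"
    unfolding mean using a1 by simp
  have gen: "- (Q + (E - 4 * v * X + 4 * v\<^sup>2 * Y)) / 2 = - E / 2 + (2 * v * X - 2 * v\<^sup>2 * Y) + - Q / 2"
    for Q E X Y :: real
    by (simp add: field_simps)
  have ex: "- (m - \<mu>)\<^sup>2 / (2 * (1 / a)) + - (y - m)\<^sup>2 / (2 * 1\<^sup>2) =
    - (e - 0)\<^sup>2 / (2 * (1 + 1 / a)) + (2 * v * (b * e / (a + 1)) - 2 * v\<^sup>2 * (b\<^sup>2 / (a * (a + 1)))) +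
    - (m - (a * \<mu> + y) / (a + 1))\<^sup>2 / (2 * (1 / (a + 1)))"
    unfolding f3 f1 f2 f4 f5 by (rule gen)
  have "normal_density \<mu> (1 / sqrt a) m * normal_density m 1 y =
    (1 / sqrt (2 * pi * (1 / a)) * (1 / sqrt (2 * pi * 1\<^sup>2))) *
    exp (- (m - \<mu>)\<^sup>2 / (2 * (1 / a)) + - (y - m)\<^sup>2 / (2 * 1\<^sup>2))"
    unfolding normal_density_def sq exp_add by (simp only: mult_ac)
  also have "\<dots> = normal_density 0 (sqrt (1 + 1 / a)) e *
    exp (2 * v * (b * e / (a + 1)) - 2 * v\<^sup>2 * (b\<^sup>2 / (a * (a + 1)))) *
    normal_density ((a * \<mu> + y) / (a + 1)) (1 / sqrt (a + 1)) m"
    unfolding normal_density_def sq ex exp_add pre by (simp only: mult_ac)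
  finally show ?thesis .
qed

section \<open>Statistics of a history and their increments\<close>

lemma applications_Suc: "applications (Suc n) h l = applications n h l + (if fst (h n) = l then 1 else 0)"
proof -
  have "{k. k < Suc n \<and> fst (h k) = l} = {k. k < n \<and> fst (h k) = l} \<union> (if fst (h n) = l then {n} else {})"
    by (auto simp: less_Suc_eq)
  then show ?thesis by (simp add: applications_def)
qed

lemma total_income_Suc: "total_income (Suc n) h l = total_income n h l + (if fst (h n) = l then snd (h n) else 0)"
proof -
  have "{k. k < Suc n \<and> fst (h k) = l} = {k. k < n \<and> fst (h k) = l} \<union> (if fst (h n) = l then {n} else {})"
    by (auto simp: less_Suc_eq)
  then show ?thesis by (simp add: total_income_def)
qed

lemma applications_upd: "n \<le> k \<Longrightarrow> applications n (h(k := z)) l = applications n h l"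
  unfolding applications_def by (rule arg_cong[where f = card]) auto

lemma total_income_upd: "n \<le> k \<Longrightarrow> total_income n (h(k := z)) l = total_income n h l"
  unfolding total_income_def by (rule sum.cong) auto

lemma applications_0: "applications n h l = 0 \<Longrightarrow> total_income n h l = 0"
proof -
  assume "applications n h l = 0"
  then have "{k. k < n \<and> fst (h k) = l} = {}" by (simp add: applications_def)
  then show ?thesis unfolding total_income_def by (simp only: sum.empty)
qed

lemma applications_sum:
  "(\<And>i. i < n \<Longrightarrow> fst (h i) \<in> {1, 2}) \<Longrightarrow> applications n h 1 + applications n h 2 = n"
proof (induction n)
  case 0
  then show ?case by (simp add: applications_def)
next
  case (Suc n)
  then have "fst (h n) \<in> {1, 2}" "applications n h 1 + applications n h 2 = n" by auto
  then show ?case by (auto simp: applications_Suc)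
qed

definition overall_mean :: "nat \<Rightarrow> history \<Rightarrow> real" where
  "overall_mean n h = (total_income n h 1 + total_income n h 2) / real n"

text \<open>This is the statistic \<open>u\<close> times \<open>sqrt N\<close>, kept free of the
  horizon.\<close>

definition contrast :: "nat \<Rightarrow> history \<Rightarrow> real" where
  "contrast n h = (total_income n h 1 * real (applications n h 2) -
     total_income n h 2 * real (applications n h 1)) / real n"

text \<open>
  The likelihood of the history at \<open>v = 0\<close>, integrated over \<open>m\<close>: a product of predictive
  densities.
\<close>

definition predictive :: "nat \<Rightarrow> history \<Rightarrow> real" where
  "predictive n h = (\<Prod>k = 1..<n. normal_density (overall_mean k h) (sqrt (1 + 1 / real k)) (snd (h k)))"

lemma predictive_nonneg: "0 \<le> predictive n h"
  by (simp add: predictive_def prod_nonneg)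

lemma predictive_pos: "0 < predictive n h"
  unfolding predictive_def by (intro prod_pos ballI normal_density_pos) (simp add: add_pos_nonneg)

lemma overall_mean_upd: "n \<le> k \<Longrightarrow> overall_mean n (h(k := z)) = overall_mean n h"
  by (simp add: overall_mean_def total_income_upd)

lemma predictive_Suc:
  "1 \<le> n \<Longrightarrow> predictive (Suc n) h = predictive n h *
     normal_density (overall_mean n h) (sqrt (1 + 1 / real n)) (snd (h n))"
  by (simp add: predictive_def)

lemma predictive_upd: "n \<le> k \<Longrightarrow> predictive n (h(k := z)) = predictive n h"
  unfolding predictive_def by (intro prod.cong) (auto simp: overall_mean_upd)

text \<open>The sign with which \<open>v\<close> enters the mean of the arm.\<close>

definition sgn_arm :: "nat \<Rightarrow> real" where
  "sgn_arm y = (if y = 1 then 1 else - 1)"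

text \<open>The data of \<open>normal_density_update\<close> with \<open>a = real n\<close>:
  \<open>e\<close> is the deviation of the new income from the overall mean and \<open>b\<close> the
  signed count of the other arm. The expression with \<open>v\<close> in the last two claims is the
  mean of \<open>m\<close> given \<open>v\<close> under the constant prior.\<close>

lemma stats_Suc:
  assumes n: "1 \<le> n" and acts: "\<And>i. i \<le> n \<Longrightarrow> fst (h i) \<in> {1, 2}"
    and y: "y = fst (h n)" and b: "b = sgn_arm y * real (applications n h (3 - y))"
    and e: "e = snd (h n) - overall_mean n h"
  shows "contrast (Suc n) h = contrast n h + b * e / (real n + 1)"
    and "real (applications (Suc n) h 1) * real (applications (Suc n) h 2) / real (Suc n) =
      real (applications n h 1) * real (applications n h 2) / real n + b\<^sup>2 / (real n * (real n + 1))"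
    and "overall_mean (Suc n) h - v * (real (applications (Suc n) h 1) - real (applications (Suc n) h 2)) / real (Suc n) =
      (real n * (overall_mean n h - v * (real (applications n h 1) - real (applications n h 2)) / real n) +
        (snd (h n) - sgn_arm y * v)) / (real n + 1)"
    and "snd (h n) - sgn_arm y * v -
      (overall_mean n h - v * (real (applications n h 1) - real (applications n h 2)) / real n) = e - 2 * v * b / real n"
proof -
  define a n1 n2 X1 X2 x where "a = real n" and "n1 = real (applications n h 1)" and "n2 = real (applications n h 2)"
    and "X1 = total_income n h 1" and "X2 = total_income n h 2" and "x = snd (h n)"
  note defs = a_def[symmetric] n1_def[symmetric] n2_def[symmetric] X1_def[symmetric] X2_def[symmetric] x_def[symmetric]
    n1_def[symmetric, unfolded One_nat_def] X1_def[symmetric, unfolded One_nat_def]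
  have a: "0 < a" "0 < a + 1" using n by (auto simp: a_def)
  have "applications n h 1 + applications n h 2 = n"
    using acts by (intro applications_sum) auto
  then have an: "a = n1 + n2" by (simp add: a_def n1_def n2_def flip: of_nat_add)
  have n12: "n1 + n2 > 0" "n1 + n2 + 1 > 0" using a unfolding an by auto
  have y12: "y = 1 \<or> y = 2" using acts[of n] y by auto
  have om: "overall_mean n h = (X1 + X2) / a"
    by (simp only: overall_mean_def defs)
  have S: "real (Suc n) = a + 1" by (simp add: a_def)
  show "contrast (Suc n) h = contrast n h + b * e / (real n + 1)"
    using y12 n12
    unfolding contrast_def b e om total_income_Suc applications_Suc y[symmetric] S defs
    by (auto simp: sgn_arm_def defs an divide_simps) (simp_all add: algebra_simps)
  show "real (applications (Suc n) h 1) * real (applications (Suc n) h 2) / real (Suc n) =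
      real (applications n h 1) * real (applications n h 2) / real n + b\<^sup>2 / (real n * (real n + 1))"
    using y12 n12
    unfolding b total_income_Suc applications_Suc y[symmetric] S defs
    by (auto simp: sgn_arm_def defs an divide_simps) (simp_all add: algebra_simps power2_eq_square)
  show "overall_mean (Suc n) h - v * (real (applications (Suc n) h 1) - real (applications (Suc n) h 2)) / real (Suc n) =
      (real n * (overall_mean n h - v * (real (applications n h 1) - real (applications n h 2)) / real n) +
        (snd (h n) - sgn_arm y * v)) / (real n + 1)"
    using y12 n12
    unfolding overall_mean_def total_income_Suc applications_Suc y[symmetric] S defs
    by (auto simp: sgn_arm_def defs an divide_simps) (simp_all add: algebra_simps)
  show "snd (h n) - sgn_arm y * v -
      (overall_mean n h - v * (real (applications n h 1) - real (applications n h 2)) / real n) = e - 2 * v * b / real n"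
    using y12 n12
    unfolding b e om defs
    by (auto simp: sgn_arm_def defs an divide_simps) (simp_all add: algebra_simps)
qed

text \<open>The Gaussian update, iterated. Under the constant prior and given \<open>v\<close>,
  \<open>m\<close> is normal with variance \<open>1 / n\<close>; its density is the last factor. The
  induction starts at \<open>n = 1\<close>, when this law first is proper.\<close>

lemma likelihood_eq:
  assumes "1 \<le> n" and "\<And>i. i < n \<Longrightarrow> fst (h i) \<in> {1, 2}"
  shows "likelihood n h (means (m, v)) = predictive n h *
    exp (2 * v * contrast n h - 2 * v\<^sup>2 * (real (applications n h 1) * real (applications n h 2) / real n)) *
    normal_density (overall_mean n h - v * (real (applications n h 1) - real (applications n h 2)) / real n)
      (1 / sqrt (real n)) m"
  using assms
proof (induction n rule: dec_induct)
  case base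
  have "fst (h 0) \<in> {1, 2}" using base by auto
  moreover have "(snd (h 0) - (m + v))\<^sup>2 = (m - (snd (h 0) - v))\<^sup>2"
    "(snd (h 0) - (m - v))\<^sup>2 = (m - (snd (h 0) + v))\<^sup>2"
    by (simp_all add: power2_eq_square algebra_simps)
  ultimately show ?case
    by (auto simp: likelihood_def predictive_def contrast_def overall_mean_def means_def
        applications_Suc total_income_Suc applications_def[of 0] total_income_def[of 0] normal_density_def)
next
  case (step n)
  define y where "y = fst (h n)"
  define b where "b = sgn_arm y * real (applications n h (3 - y))"
  define e where "e = snd (h n) - overall_mean n h"
  define \<mu> where "\<mu> = overall_mean n h - v * (real (applications n h 1) - real (applications n h 2)) / real n"
  define k where "k = real (applications n h 1) * real (applications n h 2) / real n"
  have n: "1 \<le> n" and acts: "\<And>i. i \<le> n \<Longrightarrow> fst (h i) \<in> {1, 2}"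
    using step by auto
  have npos: "0 < real n" using n by simp
  have S1: "contrast (Suc n) h = contrast n h + b * e / (real n + 1)"
    by (rule stats_Suc(1)[OF n acts y_def b_def e_def])
  have S2: "real (applications (Suc n) h 1) * real (applications (Suc n) h 2) / real (Suc n) =
      k + b\<^sup>2 / (real n * (real n + 1))"
    unfolding k_def by (rule stats_Suc(2)[OF n acts y_def b_def e_def])
  have S3: "overall_mean (Suc n) h - v * (real (applications (Suc n) h 1) - real (applications (Suc n) h 2)) / real (Suc n) =
      (real n * \<mu> + (snd (h n) - sgn_arm y * v)) / (real n + 1)"
    unfolding \<mu>_def by (rule stats_Suc(3)[OF n acts y_def b_def e_def])
  have S4: "snd (h n) - sgn_arm y * v - \<mu> = e - 2 * v * b / real n"
    unfolding \<mu>_def by (rule stats_Suc(4)[OF n acts y_def b_def e_def])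
  have nd1: "normal_density (arm_mean (means (m, v)) y) 1 (snd (h n)) = normal_density m 1 (snd (h n) - sgn_arm y * v)"
    by (simp add: normal_density_def arm_mean_eq means_def sgn_arm_def algebra_simps)
  have nd2: "normal_density (overall_mean n h) s (snd (h n)) = normal_density 0 s e" for s
    by (simp add: normal_density_def e_def)
  let ?E = "\<lambda>k. exp (2 * v * contrast k h - 2 * v\<^sup>2 * (real (applications k h 1) * real (applications k h 2) / real k))"
  have E: "?E (Suc n) = ?E n * exp (2 * v * (b * e / (real n + 1)) - 2 * v\<^sup>2 * (b\<^sup>2 / (real n * (real n + 1))))"
    unfolding S1 S2 by (simp add: k_def algebra_simps flip: exp_add)
  have "likelihood (Suc n) h (means (m, v)) = likelihood n h (means (m, v)) * normal_density m 1 (snd (h n) - sgn_arm y * v)"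
    by (simp add: likelihood_def nd1[unfolded y_def] y_def)
  also have "likelihood n h (means (m, v)) = predictive n h * ?E n * normal_density \<mu> (1 / sqrt (real n)) m"
    using step.IH step.prems by (simp add: \<mu>_def)
  also have "\<dots> * normal_density m 1 (snd (h n) - sgn_arm y * v) =
    predictive n h * ?E n * (normal_density \<mu> (1 / sqrt (real n)) m * normal_density m 1 (snd (h n) - sgn_arm y * v))"
    by (simp only: mult.assoc)
  also have "\<dots> = (predictive n h * normal_density 0 (sqrt (1 + 1 / real n)) e) *
    (?E n * exp (2 * v * (b * e / (real n + 1)) - 2 * v\<^sup>2 * (b\<^sup>2 / (real n * (real n + 1))))) *
    normal_density ((real n * \<mu> + (snd (h n) - sgn_arm y * v)) / (real n + 1)) (1 / sqrt (real n + 1)) m"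
    unfolding normal_density_update[OF npos S4] by (simp only: mult_ac)
  also have "\<dots> = predictive (Suc n) h * ?E (Suc n) *
    normal_density (overall_mean (Suc n) h - v * (real (applications (Suc n) h 1) - real (applications (Suc n) h 2)) / real (Suc n))
      (1 / sqrt (real (Suc n))) m"
    unfolding E S3 predictive_Suc[OF n] nd2 by (simp add: add.commute)
  finally show ?case .
qed


lemma max_add_diff: "max (m + v) (m - v) = m + \<bar>v :: real\<bar>"
  by (auto simp: max_def abs_if)

context bandit
begin

section \<open>Integrating out \<open>m\<close> and \<open>v\<close>\<close>

abbreviation \<rho> :: "real \<Rightarrow> real" where
  "\<rho> \<equiv> scaled_dens N c varrho"

abbreviation prior_weight :: "real \<times> real \<Rightarrow> real" where
  "prior_weight \<equiv> \<lambda>p. \<rho> (snd p)"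

lemma sqrt_N_pos: "0 < sqrt (real N)"
  using N_pos by simp

lemma scaled_dens_eq: "\<rho> v = sqrt N * dens (sqrt N * v)"
proof -
  have "\<bar>v\<bar> \<le> c / sqrt N \<longleftrightarrow> \<bar>sqrt N * v\<bar> \<le> c"
    using sqrt_N_pos by (simp add: abs_mult field_simps)
  then show ?thesis
    by (auto simp: scaled_dens_def dens_def indicator_def abs_le_iff)
qed

lemma scaled_dens_nonneg: "0 \<le> \<rho> v"
  unfolding scaled_dens_eq by (simp add: dens_nonneg)

lemma borel_measurable_scaled_dens [measurable]: "\<rho> \<in> borel_measurable borel"
  unfolding scaled_dens_eq[abs_def] by measurable

lemma nn_integral_scaled_dens:
  assumes [measurable]: "f \<in> borel_measurable borel"
  shows "(\<integral>\<^sup>+v. f v * ennreal (\<rho> v) \<partial>lborel) = (\<integral>\<^sup>+w. f (w / sqrt N) * ennreal (dens w) \<partial>lborel)"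
proof -
  have "(\<integral>\<^sup>+v. f v * ennreal (\<rho> v) \<partial>lborel) =
    ennreal \<bar>1 / sqrt N\<bar> * (\<integral>\<^sup>+w. f (0 + 1 / sqrt N * w) * ennreal (\<rho> (0 + 1 / sqrt N * w)) \<partial>lborel)"
    using sqrt_N_pos by (intro nn_integral_real_affine) auto
  also have "\<dots> = (\<integral>\<^sup>+w. f (w / sqrt N) * ennreal (dens w) \<partial>lborel)"
  proof (subst nn_integral_cmult[symmetric])
    show "(\<lambda>w. f (0 + 1 / sqrt N * w) * ennreal (\<rho> (0 + 1 / sqrt N * w))) \<in> borel_measurable lborel"
      by measurable
    show "(\<integral>\<^sup>+w. ennreal \<bar>1 / sqrt N\<bar> * (f (0 + 1 / sqrt N * w) * ennreal (\<rho> (0 + 1 / sqrt N * w))) \<partial>lborel) =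
      (\<integral>\<^sup>+w. f (w / sqrt N) * ennreal (dens w) \<partial>lborel)"
    proof (intro nn_integral_cong)
      fix w
      have z: "0 + 1 / sqrt N * w = w / sqrt N" by simp
      have eq: "ennreal \<bar>1 / sqrt N\<bar> * ennreal (\<rho> (w / sqrt N)) = ennreal (dens w)"
        using sqrt_N_pos by (simp add: scaled_dens_eq dens_nonneg flip: ennreal_mult)
      show "ennreal \<bar>1 / sqrt N\<bar> * (f (0 + 1 / sqrt N * w) * ennreal (\<rho> (0 + 1 / sqrt N * w))) =
        f (w / sqrt N) * ennreal (dens w)"
        unfolding z by (subst mult.left_commute) (simp only: eq)
    qed
  qed
  finally show ?thesis .
qed

definition arm_time :: "nat \<Rightarrow> history \<Rightarrow> nat \<Rightarrow> real" where
  "arm_time n h l = real (applications n h l) / real N"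

definition ustat :: "nat \<Rightarrow> history \<Rightarrow> real" where
  "ustat n h = (total_income n h 1 * real (applications n h 2) -
     total_income n h 2 * real (applications n h 1)) / (sqrt N * real n)"

lemma ustat_eq: "ustat n h = contrast n h / sqrt N"
  by (simp add: ustat_def contrast_def)

lemma arm_time_nonneg: "0 \<le> arm_time n h l"
  by (simp add: arm_time_def)

lemma arm_time_sum:
  assumes "h \<in> space (hist_space n)"
  shows "arm_time n h 1 + arm_time n h 2 = real n / real N"
  using applications_sum[of n h] fst_hist[OF assms]
  by (simp add: arm_time_def flip: add_divide_distrib of_nat_add)

lemma arm_time_sum':
  assumes "h \<in> space (hist_space n)" "l \<in> {1, 2}"
  shows "arm_time n h l + arm_time n h (3 - l) = real n / real N"
  using arm_time_sum[OF assms(1)] assms(2) by (auto simp: add.commute)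

text \<open>The gap of arm \<open>l\<close> lives on the half-line of \<open>v\<close> where the
  other arm is better. Multiplication by \<open>(-1) ^ l\<close> reflects it to
  \<open>w > 0\<close>, and evenness makes the reflected density the same, so both arms lead to
  integrals over \<open>[0, c]\<close>. The last factor is the scale of
  \<open>v = w / sqrt N\<close>.\<close>

lemma nn_integral_arm_gap:
  assumes l: "l \<in> {1, 2}" and k: "0 \<le> k"
  shows "(\<integral>\<^sup>+v. ennreal (exp (2 * v * d - 2 * v\<^sup>2 * k) * (\<bar>v\<bar> + (-1) ^ l * v)) * ennreal (\<rho> v) \<partial>lborel) =
    ennreal (g_info l (d / sqrt N) (k / N) / sqrt N)"
proof -
  let ?E = "\<lambda>v :: real. exp (2 * v * d - 2 * v\<^sup>2 * k)"
  let ?g = "\<lambda>v :: real. \<bar>v\<bar> + (-1) ^ l * v"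
  let ?G = "\<lambda>w. ennreal (?E w * ?g w)"
  have "(\<integral>\<^sup>+v. ?G v * ennreal (\<rho> v) \<partial>lborel) = (\<integral>\<^sup>+w. ?G (w / sqrt N) * ennreal (dens w) \<partial>lborel)"
    by (rule nn_integral_scaled_dens) measurable
  also have "\<dots> = (\<integral>\<^sup>+w. ?G ((-1) ^ l * w / sqrt N) * ennreal (dens ((-1) ^ l * w)) \<partial>lborel)"
    using nn_integral_real_affine[of "\<lambda>w. ?G (w / sqrt N) * ennreal (dens w)" "(-1) ^ l" 0] by simp
  also have "\<dots> = (\<integral>\<^sup>+w. ennreal (1 / sqrt N) *
      ennreal (indicator {0..c} w * (2 * w * exp ((-1) ^ l * (2 * (d / sqrt N) * w) - 2 * w\<^sup>2 * (k / N))) * dens w) \<partial>lborel)"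
  proof (intro nn_integral_cong)
    fix w
    let ?s = "(-1) ^ l :: real"
    have s: "?s * ?s = 1" "\<bar>?s\<bar> = 1" "dens (?s * w) = dens w"
      using l dens_even by (auto simp: power_abs)
    have E: "?E (?s * w / sqrt N) = exp (?s * (2 * (d / sqrt N) * w) - 2 * w\<^sup>2 * (k / N))"
      using l sqrt_N_pos by (intro arg_cong[where f = exp]) (auto simp: power_divide mult_ac)
    have g: "?g (?s * w / sqrt N) = (\<bar>w\<bar> + w) / sqrt N"
      using s(1,2) by (simp add: abs_mult add_divide_distrib mult.assoc[symmetric])
    have i: "(\<bar>w\<bar> + w) * dens w = indicator {0..c} w * (2 * w) * dens w"
      by (auto simp: indicator_def dens_def)
    have "?G (?s * w / sqrt N) * ennreal (dens (?s * w)) =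
      ennreal (1 / sqrt N * (?E (?s * w / sqrt N) * ((\<bar>w\<bar> + w) * dens w)))"
      unfolding g s(3) by (subst ennreal_mult''[symmetric]) (simp_all add: dens_nonneg mult_ac)
    also have "\<dots> = ennreal (1 / sqrt N) *
      ennreal (indicator {0..c} w * (2 * w * exp (?s * (2 * (d / sqrt N) * w) - 2 * w\<^sup>2 * (k / N))) * dens w)"
      unfolding E i by (subst ennreal_mult') (simp_all add: mult_ac)
    finally show "?G (?s * w / sqrt N) * ennreal (dens (?s * w)) = ennreal (1 / sqrt N) *
      ennreal (indicator {0..c} w * (2 * w * exp (?s * (2 * (d / sqrt N) * w) - 2 * w\<^sup>2 * (k / N))) * dens w)" .
  qed
  also have "\<dots> = ennreal (1 / sqrt N) * ennreal (g_info l (d / sqrt N) (k / N))"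
    using k by (subst nn_integral_cmult) (measurable, simp add: ennreal_g_info)
  also have "\<dots> = ennreal (g_info l (d / sqrt N) (k / N) / sqrt N)"
    by (subst ennreal_mult'[symmetric]) simp_all
  finally show ?thesis .
qed

lemma gap_means: "l \<in> {1, 2} \<Longrightarrow> gap (means (m, v)) l = \<bar>v\<bar> + (-1) ^ l * v"
  using max_add_diff[of m v] by (auto simp: gap_def means_def)

text \<open>The gap depends on \<open>v\<close> alone, and \<open>m\<close> occurs only in the last
  factor of \<open>likelihood_eq\<close>, which integrates to 1.\<close>

lemma weighted_gap_eq:
  assumes n: "1 \<le> n" and h: "h \<in> space (hist_space n)" and l: "l \<in> {1, 2}"
  shows "weighted_gap prior_weight l n h =
    ennreal (predictive n h / sqrt N * g_fun c varrho l (ustat n h) (arm_time n h l) (arm_time n h (3 - l)))"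
proof -
  let ?n1 = "real (applications n h 1)" and ?n2 = "real (applications n h 2)"
  let ?k = "?n1 * ?n2 / real n"
  let ?\<mu> = "\<lambda>v. overall_mean n h - v * (?n1 - ?n2) / real n"
  let ?E = "\<lambda>v. exp (2 * v * contrast n h - 2 * v\<^sup>2 * ?k)"
  let ?g = "\<lambda>v :: real. \<bar>v\<bar> + (-1) ^ l * v"
  let ?G = "\<lambda>w. ennreal (?E w * ?g w)"
  have K: "?k / real N = arm_time n h l * arm_time n h (3 - l) / (arm_time n h l + arm_time n h (3 - l))"
  proof -
    have "arm_time n h l * arm_time n h (3 - l) = ?n1 * ?n2 / (real N * real N)"
      using l by (auto simp: arm_time_def)
    then show ?thesis
      using N_pos n unfolding arm_time_sum'[OF h l] by (simp add: field_simps)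
  qed
  have "weighted_gap prior_weight l n h =
    (\<integral>\<^sup>+v. (\<integral>\<^sup>+m. ennreal (gap (means (m, v)) l * (likelihood n h (means (m, v)) * \<rho> (snd (m, v)))) \<partial>lborel) \<partial>lborel)"
  proof -
    have [measurable]: "(\<lambda>p. gap (means p) l) \<in> borel_measurable (borel \<Otimes>\<^sub>M borel)"
      by (rule measurable_compose[OF measurable_means borel_measurable_gap])
    have "(\<lambda>p. ennreal (gap (means p) l * (likelihood n h (means p) * \<rho> (snd p)))) \<in> borel_measurable (lborel \<Otimes>\<^sub>M lborel)"
      by measurable
    from lborel_pair.nn_integral_snd[OF this] show ?thesis
      unfolding weighted_gap_def by simp
  qed
  also have "\<dots> = (\<integral>\<^sup>+v. ennreal (predictive n h) * (?G v * ennreal (\<rho> v)) \<partial>lborel)"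
  proof (intro nn_integral_cong)
    fix v
    have "(\<integral>\<^sup>+m. ennreal (gap (means (m, v)) l * (likelihood n h (means (m, v)) * \<rho> (snd (m, v)))) \<partial>lborel) =
      (\<integral>\<^sup>+m. ennreal (predictive n h) * (?G v * ennreal (\<rho> v)) * ennreal (normal_density (?\<mu> v) (1 / sqrt (real n)) m) \<partial>lborel)"
    proof (intro nn_integral_cong)
      fix m
      have "ennreal (gap (means (m, v)) l * (likelihood n h (means (m, v)) * \<rho> (snd (m, v)))) =
        ennreal (predictive n h * (?E v * ?g v * \<rho> v) * normal_density (?\<mu> v) (1 / sqrt (real n)) m)"
        unfolding gap_means[OF l] using likelihood_eq[where h = h, OF n fst_hist[OF h], of m v] by (simp add: mult_ac)
      then show "ennreal (gap (means (m, v)) l * (likelihood n h (means (m, v)) * \<rho> (snd (m, v)))) =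
        ennreal (predictive n h) * (?G v * ennreal (\<rho> v)) * ennreal (normal_density (?\<mu> v) (1 / sqrt (real n)) m)"
        by (simp only: ennreal_mult'[OF predictive_nonneg] ennreal_mult'' normal_density_nonneg scaled_dens_nonneg)
    qed
    also have "\<dots> = ennreal (predictive n h) * (?G v * ennreal (\<rho> v))"
      using n by (simp add: nn_integral_cmult nn_integral_normal_density)
    finally show "(\<integral>\<^sup>+m. ennreal (gap (means (m, v)) l * (likelihood n h (means (m, v)) * \<rho> (snd (m, v)))) \<partial>lborel) =
      ennreal (predictive n h) * (?G v * ennreal (\<rho> v))" .
  qed
  also have "\<dots> = ennreal (predictive n h) * ennreal (g_info l (contrast n h / sqrt N) (?k / N) / sqrt N)"
  proof -
    have "0 \<le> ?k" by simp
    note gap_int = nn_integral_arm_gap[OF l this]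
    show ?thesis by (subst nn_integral_cmult) (measurable, simp only: gap_int)
  qed
  also have "\<dots> = ennreal (predictive n h * (g_info l (contrast n h / sqrt N) (?k / N) / sqrt N))"
    by (rule ennreal_mult'[symmetric]) (rule predictive_nonneg)
  finally show ?thesis
    unfolding g_fun_eq K ustat_eq by simp
qed

section \<open>Dynamic programming\<close>

definition hist_packet_val :: "nat \<Rightarrow> nat \<Rightarrow> nat \<Rightarrow> history \<Rightarrow> real" where
  "hist_packet_val l j n h = packet_val l j (ustat n h) (arm_time n h l) (arm_time n h (3 - l))"

text \<open>Inside a packet the last action is still owed \<open>M - n mod M\<close> times. Values
  are in units of \<open>sqrt N\<close>, the order of \<open>N\<close> steps with regrets of order
  \<open>1 / sqrt N\<close>.\<close>

definition hist_val :: "nat \<Rightarrow> history \<Rightarrow> real" where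
  "hist_val n h = (if M dvd n then r_ext (ustat n h) (arm_time n h 1) (arm_time n h 2)
     else hist_packet_val (fst (h (n - 1))) (M - n mod M) n h)"

lemma arm_time_pos:
  assumes "1 \<le> n" "h \<in> space (hist_space n)" "l \<in> {1, 2}"
  shows "0 < arm_time n h l + arm_time n h (3 - l)"
  unfolding arm_time_sum'[OF assms(2,3)] using assms(1) N_pos by simp

lemma hist_packet_val_nonneg:
  assumes "1 \<le> n" "h \<in> space (hist_space n)" "l \<in> {1, 2}"
  shows "0 \<le> hist_packet_val l j n h"
  unfolding hist_packet_val_def
  using arm_time_pos[OF assms] by (intro packet_val_nonneg arm_time_nonneg)

text \<open>Under the predictive law the new income is normal around the overall mean with variance
  \<open>1 + 1 / n\<close>, and \<open>u\<close> is affine in it. Averaging the value is therefore a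
  \<open>gconv\<close>.\<close>

lemma nn_integral_hist_packet_val:
  assumes n: "1 \<le> n" and h: "h \<in> space (hist_space n)" and l: "l \<in> {1, 2}"
  shows "(\<integral>\<^sup>+x. ennreal (predictive (Suc n) (h(n := (l, x))) * sqrt N *
      hist_packet_val l j (Suc n) (h(n := (l, x)))) \<partial>lborel) =
    ennreal (predictive n h * sqrt N *
      gconv (step_var (arm_time n h (3 - l)) (arm_time n h l + arm_time n h (3 - l)) 1)
        (\<lambda>u. packet_val l j u (arm_time n h l + 1 / real N) (arm_time n h (3 - l))) (ustat n h))"
proof -
  let ?p = "arm_time n h l + 1 / real N" and ?q = "arm_time n h (3 - l)"
  let ?F = "\<lambda>u. packet_val l j u ?p ?q"
  let ?s = "sqrt (1 + 1 / real n)" and ?\<mu> = "overall_mean n h"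
  define b where "b = sgn_arm l * real (applications n h (3 - l)) / (real n + 1) / sqrt N"
  have acts: "fst ((h(n := (l, x))) i) \<in> {1, 2}" if "i \<le> n" for i x
    using fst_hist[OF hist_space_upd[OF h l], of i x] that by simp
  have B: "0 \<le> predictive n h * sqrt N" by (simp add: predictive_nonneg)
  have l3: "3 - l \<noteq> l" using l by auto
  have u: "ustat (Suc n) (h(n := (l, x))) = ustat n h + b * (x - ?\<mu>)" for x
  proof -
    have "contrast (Suc n) (h(n := (l, x))) = contrast n h +
      sgn_arm l * real (applications n h (3 - l)) * (x - ?\<mu>) / (real n + 1)"
      using stats_Suc(1)[where h = "h(n := (l, x))", OF n acts refl refl refl]
      by (simp add: contrast_def total_income_upd applications_upd overall_mean_upd)
    then show ?thesis
      by (simp add: ustat_eq b_def add_divide_distrib)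
  qed
  have t: "arm_time (Suc n) (h(n := (l, x))) l = ?p" "arm_time (Suc n) (h(n := (l, x))) (3 - l) = ?q" for x
    using l3 by (auto simp: arm_time_def applications_Suc applications_upd add_divide_distrib)
  have 0: "0 \<le> 1 / real N" "0 < arm_time n h l + ?q"
    using arm_time_pos[OF n h l] by auto
  have F: "exp_growth (2 * c) ?F"
    using arm_time_nonneg[of n h l] arm_time_nonneg[of n h "3 - l"] 0
    by (intro exp_growth_packet_val) linarith+
  have "(\<integral>\<^sup>+x. ennreal (predictive (Suc n) (h(n := (l, x))) * sqrt N *
      hist_packet_val l j (Suc n) (h(n := (l, x)))) \<partial>lborel) =
    (\<integral>\<^sup>+x. ennreal (predictive n h * sqrt N) * ennreal (normal_density ?\<mu> ?s x * ?F (ustat n h + b * (x - ?\<mu>))) \<partial>lborel)"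
  proof (intro nn_integral_cong)
    fix x
    have eq: "predictive (Suc n) (h(n := (l, x))) * sqrt N * hist_packet_val l j (Suc n) (h(n := (l, x))) =
      predictive n h * sqrt N * (normal_density ?\<mu> ?s x * ?F (ustat n h + b * (x - ?\<mu>)))"
      unfolding hist_packet_val_def u t
      using n by (simp add: predictive_Suc predictive_upd overall_mean_upd mult_ac)
    show "ennreal (predictive (Suc n) (h(n := (l, x))) * sqrt N * hist_packet_val l j (Suc n) (h(n := (l, x)))) =
      ennreal (predictive n h * sqrt N) * ennreal (normal_density ?\<mu> ?s x * ?F (ustat n h + b * (x - ?\<mu>)))"
      unfolding eq by (rule ennreal_mult') (simp add: predictive_nonneg)
  qed
  also have "\<dots> = ennreal (predictive n h * sqrt N) * ennreal (gconv (b\<^sup>2 * ?s\<^sup>2) ?F (ustat n h))"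
  proof -
    have "0 < ?s" using n by (simp add: add_pos_nonneg)
    note affine = nn_integral_normal_affine[OF F this]
    have [measurable]: "(\<lambda>x. ?F (ustat n h + b * (x - ?\<mu>))) \<in> borel_measurable borel"
      by (rule measurable_compose[OF _ exp_growth_measurable[OF F]]) measurable
    have "(\<lambda>x. ennreal (normal_density ?\<mu> ?s x * ?F (ustat n h + b * (x - ?\<mu>)))) \<in> borel_measurable lborel"
      by measurable
    then show ?thesis by (simp only: nn_integral_cmult affine)
  qed
  \<comment> \<open>The slope is, up to sign and scale, the count of the other arm over
    \<open>n + 1\<close>. Its square times \<open>(n + 1) / n\<close> is the increment of
    \<open>- q\<^sup>2 / t\<close> in rescaled time.\<close>
  also have "b\<^sup>2 * ?s\<^sup>2 = step_var ?q (arm_time n h l + ?q) 1"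
  proof -
    have s2: "?s\<^sup>2 = (real n + 1) / real n" using n by (simp add: field_simps)
    have b2: "b\<^sup>2 = (real (applications n h (3 - l)))\<^sup>2 / (real n + 1)\<^sup>2 / real N"
      by (simp add: b_def power_divide power_mult_distrib sgn_arm_def)
    have *: "1 / (real n / real N) - 1 / (real n / real N + real 1 / real N) = real N / (real n * (real n + 1))"
      using n N_pos by (simp add: divide_simps) (simp add: algebra_simps)
    have "x\<^sup>2 / (a + 1)\<^sup>2 / k * ((a + 1) / a) = (x / k)\<^sup>2 * (k / (a * (a + 1)))"
      if "a > 0" "k > 0" for x a k :: real
    proof -
      have "a + 1 \<noteq> 0" using that by simp
      then show ?thesis using that by (simp add: power2_eq_square divide_simps)
    qed
    then show ?thesis
      unfolding b2 s2 step_var_def arm_time_sum'[OF h l] * using n N_pos by (simp add: arm_time_def)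
  qed
  finally show ?thesis
    by (simp only: ennreal_mult'[OF B])
qed

text \<open>Bellman equation for one forced application, by \<open>packet_val_Suc\<close>. The
  factor \<open>1 / sqrt N\<close> of the gap is \<open>sqrt N / N\<close> in the units of the
  value.\<close>

lemma weighted_gap_step:
  assumes n: "1 \<le> n" and h: "h \<in> space (hist_space n)" and l: "l \<in> {1, 2}"
  shows "weighted_gap prior_weight l n h +
    (\<integral>\<^sup>+x. ennreal (predictive (Suc n) (h(n := (l, x))) * sqrt N *
      hist_packet_val l j (Suc n) (h(n := (l, x)))) \<partial>lborel) =
    ennreal (predictive n h * sqrt N * hist_packet_val l (Suc j) n h)"
proof -
  let ?p = "arm_time n h l" and ?q = "arm_time n h (3 - l)" and ?u = "ustat n h"
  let ?G = "gconv (step_var ?q (?p + ?q) 1) (\<lambda>u. packet_val l j u (?p + 1 / real N) ?q) ?u"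
  have pq: "0 < ?p + ?q" by (rule arm_time_pos[OF n h l])
  have "0 \<le> ?G"
  proof (rule gconv_nonneg, rule packet_val_nonneg)
    have "0 \<le> 1 / real N" by simp
    then show "0 \<le> ?p + 1 / real N" "0 < ?p + 1 / real N + ?q"
      using arm_time_nonneg[of n h l] pq by linarith+
  qed (rule arm_time_nonneg)
  moreover have "1 / sqrt N = sqrt N / real N"
    using sqrt_N_pos by (simp add: field_simps)
  then have "predictive n h * (1 / sqrt N) * g_fun c varrho l ?u ?p ?q = predictive n h * (sqrt N / real N) * g_fun c varrho l ?u ?p ?q"
    by (simp only:)
  then have "predictive n h / sqrt N * g_fun c varrho l ?u ?p ?q = predictive n h * sqrt N * (g_fun c varrho l ?u ?p ?q / real N)"
    by simp
  ultimately show ?thesis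
    unfolding weighted_gap_eq[OF n h l] nn_integral_hist_packet_val[OF n h l]
    unfolding hist_packet_val_def packet_val_Suc[OF arm_time_nonneg arm_time_nonneg pq]
    using predictive_nonneg[of n h]
    by (simp add: distrib_left g_fun_nonneg flip: ennreal_plus)
qed

text \<open>When the application just made completes its packet, nothing is owed, and
  \<open>packet_val_0\<close> returns the value at a packet boundary. Boundary and interior thus
  obey one formula.\<close>

lemma hist_val_upd:
  "hist_val (Suc n) (h(n := (y, x))) = hist_packet_val y (M - n mod M - 1) (Suc n) (h(n := (y, x)))"
  if "y \<in> {1, 2}"
proof -
  have "n mod M < M" using M_ge by simp
  show ?thesis
  proof (cases "M dvd Suc n")
    case True
    then have "Suc n mod M = 0" by simp
    then have "M - n mod M - 1 = 0"
      using \<open>n mod M < M\<close> by (simp add: mod_Suc split: if_splits)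
    then show ?thesis
      using True that by (auto simp: hist_val_def hist_packet_val_def packet_val_0 own_def)
  next
    case False
    then have "Suc n mod M = Suc (n mod M)"
      by (auto simp: mod_Suc dvd_eq_mod_eq_0)
    then show ?thesis using False by (simp add: hist_val_def)
  qed
qed

lemma weighted_gap_hist_val:
  assumes n: "1 \<le> n" and h: "h \<in> space (hist_space n)" and l: "l \<in> {1, 2}"
  shows "weighted_gap prior_weight l n h +
    (\<integral>\<^sup>+x. ennreal (predictive (Suc n) (h(n := (l, x))) * sqrt N * hist_val (Suc n) (h(n := (l, x)))) \<partial>lborel) =
    ennreal (predictive n h * sqrt N * hist_packet_val l (M - n mod M) n h)"
proof -
  have "n mod M < M" using M_ge by simp
  then have "M - n mod M = Suc (M - n mod M - 1)" by simp
  then show ?thesis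
    unfolding hist_val_upd[OF l] using weighted_gap_step[OF n h l] by metis
qed

lemma ustat_eq_0:
  assumes "arm_time n h 1 = 0 \<or> arm_time n h 2 = 0"
  shows "ustat n h = 0"
  using assms N_pos applications_0[of n h 1] applications_0[of n h 2]
  by (auto simp: arm_time_def ustat_def)

lemma r_ext_le_hist_packet_val:
  assumes n: "1 \<le> n" "n < N" and h: "h \<in> space (hist_space n)" and l: "l \<in> {1, 2}"
  shows "r_ext (ustat n h) (arm_time n h 1) (arm_time n h 2) \<le> hist_packet_val l M n h"
proof -
  have "0 < arm_time n h 1 + arm_time n h 2" "arm_time n h 1 + arm_time n h 2 < 1"
    unfolding arm_time_sum[OF h] using n by auto
  then have "r_ext (ustat n h) (arm_time n h 1) (arm_time n h 2) \<le>
      own l (packet_val l M) (ustat n h) (arm_time n h 1) (arm_time n h 2)"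
    using l ustat_eq_0 by (intro r_ext_le_packet_val arm_time_nonneg) auto
  then show ?thesis
    using l by (auto simp: own_def hist_packet_val_def)
qed

lemma hist_val_N:
  assumes h: "h \<in> space (hist_space N)"
  shows "hist_val N h = 0"
proof -
  have "arm_time N h 1 + arm_time N h 2 = 1"
    unfolding arm_time_sum[OF h] using N_pos by simp
  moreover from this have "r_ext u (arm_time N h 1) (arm_time N h 2) = 0" for u
    using arm_time_nonneg[of N h 1] arm_time_nonneg[of N h 2]
    by (auto simp: r_ext_def r_fun_def r_act.simps one_arm_def)
  ultimately show ?thesis
    using M_dvd by (simp add: hist_val_def)
qed

lemma packet_strategy_is_strategy: "packet_strategy M \<sigma> \<Longrightarrow> is_strategy \<sigma>"
  by (simp add: packet_strategy_def)

lemma packet_strategy_emeasure: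
  assumes "packet_strategy M \<sigma>" "\<not> M dvd n" "h \<in> space (hist_space n)" "y \<in> {1, 2}"
  shows "emeasure (\<sigma> n h) {y} = (if y = fst (h (n - 1)) then 1 else 0)"
  using assms by (auto simp: packet_strategy_def)

lemma packet_end_action: "1 \<le> n \<Longrightarrow> \<not> M dvd n \<Longrightarrow> fst (h (n - 1)) \<in> {1, 2}" if "h \<in> space (hist_space n)"
  using that by (intro fst_hist) auto

text \<open>At a packet boundary a randomized choice is an average over actions, each bounded below
  by the Bellman inequality. Inside a packet the action is forced, and the value is defined by this
  very action.\<close>

lemma weighted_loss_ge:
  assumes \<sigma>: "packet_strategy M \<sigma>" and "1 \<le> n" "n + k = N" "h \<in> space (hist_space n)"
  shows "ennreal (predictive n h * sqrt N * hist_val n h) \<le> weighted_loss \<sigma> prior_weight k n h"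
  using assms(2-)
proof (induction k arbitrary: n h)
  case 0
  then show ?case by (simp add: hist_val_N)
next
  case (Suc k)
  note n = Suc.prems(1) and h = Suc.prems(3)
  have nN: "n < N" using Suc.prems by simp
  let ?B = "predictive n h * sqrt N"
  have B: "0 \<le> ?B" using predictive_nonneg[of n h] by simp
  have "ennreal (?B * hist_val n h) \<le>
    (\<Sum>y\<in>{1, 2}. emeasure (\<sigma> n h) {y} * ennreal (?B * hist_packet_val y (M - n mod M) n h))"
  proof (cases "M dvd n")
    case True
    have "ennreal (?B * hist_val n h) = (\<Sum>y\<in>{1, 2}. emeasure (\<sigma> n h) {y} * ennreal (?B * hist_val n h))"
      unfolding sum_distrib_right[symmetric] sum_strategy[OF packet_strategy_is_strategy[OF \<sigma>] h] by simp
    also have "\<dots> \<le> (\<Sum>y\<in>{1, 2}. emeasure (\<sigma> n h) {y} * ennreal (?B * hist_packet_val y (M - n mod M) n h))"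
      using True r_ext_le_hist_packet_val[OF n nN h] B
      by (intro sum_mono mult_left_mono ennreal_leI) (auto simp: hist_val_def)
    finally show ?thesis .
  next
    case False
    have "fst (h (n - 1)) \<in> {1, 2}" using packet_end_action[OF h n False] .
    then show ?thesis
      using False by (auto simp: hist_val_def packet_strategy_emeasure[OF \<sigma> False h])
  qed
  also have "\<dots> \<le> (\<Sum>y\<in>{1, 2}. emeasure (\<sigma> n h) {y} *
       (weighted_gap prior_weight y n h + (\<integral>\<^sup>+x. weighted_loss \<sigma> prior_weight k (Suc n) (h(n := (y, x))) \<partial>lborel)))"
  proof (intro sum_mono mult_left_mono)
    fix y :: nat assume y: "y \<in> {1, 2}"
    show "ennreal (?B * hist_packet_val y (M - n mod M) n h) \<le>
      weighted_gap prior_weight y n h + (\<integral>\<^sup>+x. weighted_loss \<sigma> prior_weight k (Suc n) (h(n := (y, x))) \<partial>lborel)"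
      unfolding weighted_gap_hist_val[OF n h y, symmetric]
      using Suc.prems y by (intro add_left_mono nn_integral_mono Suc.IH hist_space_upd) auto
  qed simp
  also have "\<dots> = weighted_loss \<sigma> prior_weight (Suc k) n h"
    using packet_strategy_is_strategy[OF \<sigma>] h
    by (intro weighted_loss_Suc[symmetric]) (auto simp: scaled_dens_nonneg)
  finally show ?case .
qed

text \<open>Optimal choices are demanded only on histories with an invariant \<open>P\<close> that
  is passed on along actions of positive probability, since a limiting strategy is constrained only
  at the start of the two initial packets, inside packets and at decision histories.\<close>

lemma weighted_loss_eq:
  assumes \<sigma>: "packet_strategy M \<sigma>"
    and P: "\<And>n h y x. P n h \<Longrightarrow> 1 \<le> n \<Longrightarrow> n < N \<Longrightarrow> h \<in> space (hist_space n) \<Longrightarrow> y \<in> {1, 2} \<Longrightarrow>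
      emeasure (\<sigma> n h) {y} \<noteq> 0 \<Longrightarrow> P (Suc n) (h(n := (y, x)))"
    and opt: "\<And>n h y. P n h \<Longrightarrow> 1 \<le> n \<Longrightarrow> n < N \<Longrightarrow> h \<in> space (hist_space n) \<Longrightarrow> y \<in> {1, 2} \<Longrightarrow>
      emeasure (\<sigma> n h) {y} \<noteq> 0 \<Longrightarrow> M dvd n \<Longrightarrow> hist_packet_val y M n h = hist_val n h"
    and "P n h" "1 \<le> n" "n + k = N" "h \<in> space (hist_space n)"
  shows "weighted_loss \<sigma> prior_weight k n h = ennreal (predictive n h * sqrt N * hist_val n h)"
  using assms(4-)
proof (induction k arbitrary: n h)
  case 0
  then show ?case by (simp add: hist_val_N weighted_loss_0)
next
  case (Suc k)
  note Pn = Suc.prems(1) and n = Suc.prems(2) and h = Suc.prems(4)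
  have nN: "n < N" using Suc.prems by simp
  let ?B = "predictive n h * sqrt N"
  have "weighted_loss \<sigma> prior_weight (Suc k) n h = (\<Sum>y\<in>{1, 2}. emeasure (\<sigma> n h) {y} *
       (weighted_gap prior_weight y n h + (\<integral>\<^sup>+x. weighted_loss \<sigma> prior_weight k (Suc n) (h(n := (y, x))) \<partial>lborel)))"
    using packet_strategy_is_strategy[OF \<sigma>] h
    by (intro weighted_loss_Suc) (auto simp: scaled_dens_nonneg)
  also have "\<dots> = (\<Sum>y\<in>{1, 2}. emeasure (\<sigma> n h) {y} * ennreal (?B * hist_val n h))"
  proof (intro sum.cong refl)
    fix y :: nat assume y: "y \<in> {1, 2}"
    show "emeasure (\<sigma> n h) {y} *
       (weighted_gap prior_weight y n h + (\<integral>\<^sup>+x. weighted_loss \<sigma> prior_weight k (Suc n) (h(n := (y, x))) \<partial>lborel)) =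
      emeasure (\<sigma> n h) {y} * ennreal (?B * hist_val n h)"
    \<comment> \<open>An action of probability 0 contributes nothing, whatever the loss after
      it.\<close>
    proof (cases "emeasure (\<sigma> n h) {y} = 0")
      case False
      have "(\<integral>\<^sup>+x. weighted_loss \<sigma> prior_weight k (Suc n) (h(n := (y, x))) \<partial>lborel) =
        (\<integral>\<^sup>+x. ennreal (predictive (Suc n) (h(n := (y, x))) * sqrt N * hist_val (Suc n) (h(n := (y, x)))) \<partial>lborel)"
        using Suc.prems y False nN by (intro nn_integral_cong Suc.IH P hist_space_upd) auto
      then have "weighted_gap prior_weight y n h + (\<integral>\<^sup>+x. weighted_loss \<sigma> prior_weight k (Suc n) (h(n := (y, x))) \<partial>lborel) =
        ennreal (?B * hist_packet_val y (M - n mod M) n h)"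
        by (simp only: weighted_gap_hist_val[OF n h y])
      moreover have "hist_packet_val y (M - n mod M) n h = hist_val n h"
      proof (cases "M dvd n")
        case True
        then show ?thesis using opt[OF Pn n nN h y False] by simp
      next
        case nd: False
        then have "y = fst (h (n - 1))"
          using False packet_strategy_emeasure[OF \<sigma> nd h y] by (auto split: if_splits)
        then show ?thesis using nd by (simp add: hist_val_def)
      qed
      ultimately show ?thesis by simp
    qed simp
  qed
  also have "\<dots> = ennreal (?B * hist_val n h)"
    unfolding sum_distrib_right[symmetric] sum_strategy[OF packet_strategy_is_strategy[OF \<sigma>] h] by simp
  finally show ?case .
qed

end

section \<open>Posterior losses and optimal actions\<close>

lemma applications_eq_sum: "applications n h l = (\<Sum>i<n. if fst (h i) = l then 1 else 0)"
  by (induction n) (simp_all add: applications_Suc, simp add: applications_def)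

lemma total_income_eq_sum: "total_income n h l = (\<Sum>i<n. if fst (h i) = l then snd (h i) else 0)"
  by (induction n) (simp_all add: total_income_Suc, simp add: total_income_def)

lemma measurable_applications: "(\<lambda>h. applications n h l) \<in> hist_space n \<rightarrow>\<^sub>M count_space UNIV"
proof -
  have "(\<lambda>h. \<Sum>i<n. if fst (h i) = l then 1 else 0 :: nat) \<in> hist_space n \<rightarrow>\<^sub>M count_space UNIV"
  proof (induction n)
    case 0
    then show ?case by simp
  next
    case (Suc n)
    have "(\<lambda>h. \<Sum>i<k. if fst (h i) = l then 1 else 0 :: nat) \<in> hist_space (Suc n) \<rightarrow>\<^sub>M count_space UNIV" if "k \<le> Suc n" for k
      using that
    proof (induction k)
      case (Suc k)
      have "(\<lambda>h. if fst (h k) = l then 1 else 0 :: nat) \<in> hist_space (Suc n) \<rightarrow>\<^sub>M count_space UNIV"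
        using Suc.prems by (intro measurable_compose[OF measurable_hist_fst]) auto
      with Suc show ?case by (simp add: measurable_count_space_const) measurable
    qed simp
    then show ?case by blast
  qed
  then show ?thesis by (simp add: applications_eq_sum)
qed

lemma borel_measurable_total_income: "(\<lambda>h. total_income n h l) \<in> borel_measurable (hist_space n)"
  unfolding total_income_eq_sum
proof (rule borel_measurable_sum)
  fix i assume "i \<in> {..<n}"
  then have i: "i < n" by simp
  have [measurable]: "(\<lambda>h. snd (h i)) \<in> borel_measurable (hist_space n)"
    by (rule measurable_hist_snd[OF i])
  have [measurable]: "Measurable.pred (hist_space n) (\<lambda>h. fst (h i) = l)"
    by (rule measurable_compose[OF measurable_hist_fst[OF i], where g = "\<lambda>y. y = l"]) simp
  show "(\<lambda>h. if fst (h i) = l then snd (h i) else 0) \<in> borel_measurable (hist_space n)"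
    by measurable
qed

text \<open>Exponential family form: the parameter enters only through totals and counts, while the
  squares of the incomes form a common factor.\<close>

lemma likelihood_exp:
  assumes "\<And>i. i < n \<Longrightarrow> fst (h i) \<in> {1, 2}"
  shows "likelihood n h \<theta> = (1 / sqrt (2 * pi)) ^ n * exp (- (\<Sum>i<n. (snd (h i))\<^sup>2) / 2) *
    (exp (fst \<theta> * total_income n h 1 - real (applications n h 1) * (fst \<theta>)\<^sup>2 / 2) *
     exp (snd \<theta> * total_income n h 2 - real (applications n h 2) * (snd \<theta>)\<^sup>2 / 2))"
  using assms
proof (induction n)
  case 0
  then show ?case by (simp add: likelihood_def applications_def total_income_def)
next
  case (Suc n)
  let ?x = "snd (h n)" and ?\<mu> = "arm_mean \<theta> (fst (h n))"
  have IH: "likelihood n h \<theta> = (1 / sqrt (2 * pi)) ^ n * exp (- (\<Sum>i<n. (snd (h i))\<^sup>2) / 2) *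
    (exp (fst \<theta> * total_income n h 1 - real (applications n h 1) * (fst \<theta>)\<^sup>2 / 2) *
     exp (snd \<theta> * total_income n h 2 - real (applications n h 2) * (snd \<theta>)\<^sup>2 / 2))"
    using Suc by simp
  have nd: "normal_density ?\<mu> 1 ?x = 1 / sqrt (2 * pi) * exp (- ?x\<^sup>2 / 2) * exp (?\<mu> * ?x - ?\<mu>\<^sup>2 / 2)"
    by (simp add: normal_density_def power2_eq_square field_simps flip: exp_add)
  have "fst (h n) = 1 \<or> fst (h n) = 2" using Suc.prems[of n] by simp
  then have step: "exp (fst \<theta> * total_income (Suc n) h 1 - real (applications (Suc n) h 1) * (fst \<theta>)\<^sup>2 / 2) *
     exp (snd \<theta> * total_income (Suc n) h 2 - real (applications (Suc n) h 2) * (snd \<theta>)\<^sup>2 / 2) =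
    exp (fst \<theta> * total_income n h 1 - real (applications n h 1) * (fst \<theta>)\<^sup>2 / 2) *
     exp (snd \<theta> * total_income n h 2 - real (applications n h 2) * (snd \<theta>)\<^sup>2 / 2) * exp (?\<mu> * ?x - ?\<mu>\<^sup>2 / 2)"
    by (auto simp: applications_Suc total_income_Suc arm_mean_eq algebra_simps add_divide_distrib simp flip: exp_add)
  have sum: "exp (- (\<Sum>i<Suc n. (snd (h i))\<^sup>2) / 2) = exp (- (\<Sum>i<n. (snd (h i))\<^sup>2) / 2) * exp (- ?x\<^sup>2 / 2)"
    by (simp add: add_divide_distrib diff_divide_distrib flip: exp_add)
  have "likelihood (Suc n) h \<theta> = likelihood n h \<theta> * normal_density ?\<mu> 1 ?x"
    by (simp add: likelihood_def)
  then show ?case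
    unfolding IH nd step sum by (simp add: mult_ac)
qed

context bandit
begin

text \<open>Sufficiency: the densities of the two totals and the full likelihood differ by a factor
  that depends on the history alone. With positive counts both totals have genuine normal
  densities.\<close>

lemma posterior_weight_eq:
  assumes h: "h \<in> space (hist_space n)" and pos: "applications n h 1 > 0" "applications n h 2 > 0"
  obtains \<kappa> where "\<kappa> > 0" "\<And>p. posterior_weight \<rho> n h p = \<kappa> * (likelihood n h (means p) * \<rho> (snd p))"
proof -
  let ?A = "(1 / sqrt (2 * pi)) ^ n * exp (- (\<Sum>i<n. (snd (h i))\<^sup>2) / 2)"
  let ?k = "\<lambda>l. 1 / sqrt (2 * pi * real (applications n h l)) *
    exp (- (total_income n h l)\<^sup>2 / (2 * real (applications n h l)))"
  have A: "?A > 0" by simp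
  have k: "?k l > 0" if "applications n h l > 0" for l
    using that by simp
  have nd: "normal_density (a * \<mu>) (sqrt a) X = 1 / sqrt (2 * pi * a) * exp (- X\<^sup>2 / (2 * a)) * exp (\<mu> * X - a * \<mu>\<^sup>2 / 2)"
    if "a > 0" for a \<mu> X :: real
  proof -
    have "- (X - a * \<mu>)\<^sup>2 / (2 * a) = - X\<^sup>2 / (2 * a) + (\<mu> * X - a * \<mu>\<^sup>2 / 2)"
      using that by (simp add: power2_eq_square field_simps)
    then show ?thesis using that by (simp add: normal_density_def flip: exp_add)
  qed
  show ?thesis
  proof
    show "?k 1 * ?k 2 / ?A > 0"
      by (rule divide_pos_pos[OF mult_pos_pos[OF k[OF pos(1)] k[OF pos(2)]] A])
    show "posterior_weight \<rho> n h p = ?k 1 * ?k 2 / ?A * (likelihood n h (means p) * \<rho> (snd p))" for p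
    proof -
      let ?e1 = "exp ((fst p + snd p) * total_income n h 1 - real (applications n h 1) * (fst p + snd p)\<^sup>2 / 2)"
      let ?e2 = "exp ((fst p - snd p) * total_income n h 2 - real (applications n h 2) * (fst p - snd p)\<^sup>2 / 2)"
      have L: "likelihood n h (means p) = ?A * (?e1 * ?e2)"
        using likelihood_exp[of n h "means p"] fst_hist[OF h] by (simp add: means_def)
      have "posterior_weight \<rho> n h p = (?k 1 * ?e1) * (?k 2 * ?e2) * \<rho> (snd p)"
        using pos unfolding posterior_weight_def Let_def split_beta
        by (subst (1 2) nd) simp_all
      also have "\<dots> = ?k 1 * ?k 2 / ?A * (?A * (?e1 * ?e2) * \<rho> (snd p))"
        using A by (simp add: field_simps)
      finally show ?thesis unfolding L .
    qed
  qed
qed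

lemma scaled_dens_support: "\<rho> v \<noteq> 0 \<Longrightarrow> \<bar>v\<bar> \<le> c / sqrt N"
  by (auto simp: scaled_dens_def split: if_splits)

lemma nn_integral_scaled_dens_1: "(\<integral>\<^sup>+v. ennreal (\<rho> v) \<partial>lborel) = 1"
  using nn_integral_scaled_dens[of "\<lambda>_. 1"] nn_integral_dens by simp

text \<open>Integrating \<open>m\<close> out leaves a function of \<open>v\<close> that is bounded
  on the support of \<open>\<rho>\<close> and positive wherever \<open>\<rho>\<close> is. Hence the
  posterior can be normalized although the prior is improper.\<close>

lemma nn_integral_likelihood:
  assumes n: "1 \<le> n" and h: "h \<in> space (hist_space n)"
  shows "(\<integral>\<^sup>+p. ennreal (likelihood n h (means p) * \<rho> (snd p)) \<partial>(lborel \<Otimes>\<^sub>M lborel)) < \<infinity>"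
    and "(\<integral>\<^sup>+p. ennreal (likelihood n h (means p) * \<rho> (snd p)) \<partial>(lborel \<Otimes>\<^sub>M lborel)) \<noteq> 0"
proof -
  let ?k = "real (applications n h 1) * real (applications n h 2) / real n"
  let ?\<mu> = "\<lambda>v. overall_mean n h - v * (real (applications n h 1) - real (applications n h 2)) / real n"
  let ?E = "\<lambda>v. exp (2 * v * contrast n h - 2 * v\<^sup>2 * ?k)"
  let ?I = "\<integral>\<^sup>+p. ennreal (likelihood n h (means p) * \<rho> (snd p)) \<partial>(lborel \<Otimes>\<^sub>M lborel)"
  have "?I = (\<integral>\<^sup>+v. (\<integral>\<^sup>+m. ennreal (likelihood n h (means (m, v)) * \<rho> (snd (m, v))) \<partial>lborel) \<partial>lborel)"
  proof -
    have "(\<lambda>p. ennreal (likelihood n h (means p) * \<rho> (snd p))) \<in> borel_measurable (lborel \<Otimes>\<^sub>M lborel)"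
      by measurable
    from lborel_pair.nn_integral_snd[OF this] show ?thesis by simp
  qed
  also have "\<dots> = (\<integral>\<^sup>+v. ennreal (predictive n h * ?E v * \<rho> v) \<partial>lborel)"
  proof (rule nn_integral_cong)
    fix v
    have "(\<integral>\<^sup>+m. ennreal (likelihood n h (means (m, v)) * \<rho> (snd (m, v))) \<partial>lborel) =
      (\<integral>\<^sup>+m. ennreal (predictive n h * ?E v * \<rho> v) * ennreal (normal_density (?\<mu> v) (1 / sqrt (real n)) m) \<partial>lborel)"
    proof (rule nn_integral_cong)
      fix m
      have "likelihood n h (means (m, v)) = predictive n h * ?E v * normal_density (?\<mu> v) (1 / sqrt (real n)) m"
        by (rule likelihood_eq[OF n fst_hist[OF h]])
      then have eq: "likelihood n h (means (m, v)) * \<rho> (snd (m, v)) =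
        predictive n h * ?E v * \<rho> v * normal_density (?\<mu> v) (1 / sqrt (real n)) m"
        by (simp only: snd_conv mult_ac)
      show "ennreal (likelihood n h (means (m, v)) * \<rho> (snd (m, v))) =
        ennreal (predictive n h * ?E v * \<rho> v) * ennreal (normal_density (?\<mu> v) (1 / sqrt (real n)) m)"
        unfolding eq by (rule ennreal_mult'') simp
    qed
    then show "(\<integral>\<^sup>+m. ennreal (likelihood n h (means (m, v)) * \<rho> (snd (m, v))) \<partial>lborel) =
      ennreal (predictive n h * ?E v * \<rho> v)"
      using n by (simp add: nn_integral_cmult nn_integral_normal_density)
  qed
  finally have I: "?I = (\<integral>\<^sup>+v. ennreal (predictive n h * ?E v * \<rho> v) \<partial>lborel)" .
  let ?B = "predictive n h * exp (2 * (c / sqrt N) * \<bar>contrast n h\<bar>)"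
  have "?I \<le> (\<integral>\<^sup>+v. ennreal ?B * ennreal (\<rho> v) \<partial>lborel)"
    unfolding I
  proof (rule nn_integral_mono)
    fix v
    show "ennreal (predictive n h * ?E v * \<rho> v) \<le> ennreal ?B * ennreal (\<rho> v)"
    proof (cases "\<rho> v = 0")
      case False
      have "v * contrast n h \<le> \<bar>v\<bar> * \<bar>contrast n h\<bar>"
        by (simp flip: abs_mult)
      also have "\<dots> \<le> c / sqrt N * \<bar>contrast n h\<bar>"
        using scaled_dens_support[OF False] by (intro mult_right_mono) auto
      finally have vc: "v * contrast n h \<le> c / sqrt N * \<bar>contrast n h\<bar>" .
      have "2 * v * contrast n h - 2 * v\<^sup>2 * ?k \<le> 2 * (c / sqrt N) * \<bar>contrast n h\<bar>"
      proof -
        have "0 \<le> 2 * v\<^sup>2 * ?k" by simp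
        then show ?thesis using vc by linarith
      qed
      then have "predictive n h * ?E v * \<rho> v \<le> ?B * \<rho> v"
        using predictive_nonneg scaled_dens_nonneg by (intro mult_right_mono mult_left_mono) auto
      then show ?thesis
        using predictive_nonneg scaled_dens_nonneg by (simp add: ennreal_leI flip: ennreal_mult'')
    qed simp
  qed
  also have "\<dots> < \<infinity>"
    by (simp add: nn_integral_cmult nn_integral_scaled_dens_1)
  finally show "?I < \<infinity>" .
  show "?I \<noteq> 0"
  proof
    assume "?I = 0"
    then have "AE v in lborel. ennreal (predictive n h * ?E v * \<rho> v) = 0"
      unfolding I by (subst (asm) nn_integral_0_iff_AE) auto
    then have "AE v in lborel. ennreal (\<rho> v) = 0"
    proof (rule AE_mp, intro AE_I2 impI)
      fix v assume "ennreal (predictive n h * ?E v * \<rho> v) = 0"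
      then have "predictive n h * ?E v * \<rho> v = 0"
        using predictive_nonneg scaled_dens_nonneg by (simp add: ennreal_eq_0_iff mult_le_0_iff not_less[symmetric] order_antisym)
          (metis exp_gt_zero linorder_not_less mult_nonneg_nonneg mult_zero_right order_antisym predictive_pos zero_less_mult_iff)
      then show "ennreal (\<rho> v) = 0"
        using predictive_pos[of n h] by simp
    qed
    then have "(\<integral>\<^sup>+v. ennreal (\<rho> v) \<partial>lborel) = 0"
      by (subst nn_integral_0_iff_AE) auto
    then show False by (simp add: nn_integral_scaled_dens_1)
  qed
qed

text \<open>The factor \<open>\<rho>\<close> confines \<open>v\<close> to values at most
  \<open>c / sqrt N\<close> in size, where one step costs at most
  \<open>2 * c / sqrt N\<close>.\<close>

lemma exp_loss_le_support:
  assumes "is_strategy \<sigma>" "h \<in> space (hist_space n)" "k \<le> N"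
  shows "exp_loss \<sigma> (means p) k n h * ennreal (\<rho> (snd p)) \<le> ennreal (real N * (2 * (c / sqrt N))) * ennreal (\<rho> (snd p))"
proof (cases "\<rho> (snd p) = 0")
  case False
  have "exp_loss \<sigma> (means p) k n h \<le> ennreal (real k * \<bar>fst (means p) - snd (means p)\<bar>)"
    by (rule exp_loss_le[OF assms(1,2)])
  also have "\<dots> \<le> ennreal (real N * (2 * (c / sqrt N)))"
    using scaled_dens_support[OF False] assms(3)
    by (intro ennreal_leI mult_mono) (auto simp: means_def)
  finally show ?thesis by (intro mult_right_mono) auto
qed simp

lemma weighted_loss_finite:
  assumes \<sigma>: "is_strategy \<sigma>" and n: "1 \<le> n" and h: "h \<in> space (hist_space n)" and "k \<le> N"
  shows "weighted_loss \<sigma> prior_weight k n h < \<infinity>"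
proof -
  let ?C = "ennreal (real N * (2 * (c / sqrt N)))"
  have "weighted_loss \<sigma> prior_weight k n h \<le>
    (\<integral>\<^sup>+p. ?C * ennreal (likelihood n h (means p) * \<rho> (snd p)) \<partial>(lborel \<Otimes>\<^sub>M lborel))"
    unfolding weighted_loss_def
  proof (rule nn_integral_mono)
    fix p
    show "exp_loss \<sigma> (means p) k n h * ennreal (likelihood n h (means p) * \<rho> (snd p)) \<le>
      ?C * ennreal (likelihood n h (means p) * \<rho> (snd p))"
      using mult_right_mono[OF exp_loss_le_support[OF \<sigma> h assms(4), of p], of "ennreal (likelihood n h (means p))"]
      by (simp add: ennreal_mult likelihood_nonneg scaled_dens_nonneg mult_ac)
  qed
  also have "\<dots> = ?C * (\<integral>\<^sup>+p. ennreal (likelihood n h (means p) * \<rho> (snd p)) \<partial>(lborel \<Otimes>\<^sub>M lborel))"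
    by (rule nn_integral_cmult) measurable
  also have "\<dots> < \<infinity>"
    using nn_integral_likelihood(1)[OF n h] by (simp add: ennreal_mult_less_top)
  finally show ?thesis .
qed

text \<open>\<open>K\<close> is the same for all strategies, so comparing posterior losses amounts
  to comparing weighted losses.\<close>

lemma posterior_loss_eq:
  assumes n: "n \<le> N" and h: "h \<in> space (hist_space n)"
    and pos: "applications n h 1 > 0" "applications n h 2 > 0"
  obtains K where "K > 0"
    "\<And>\<sigma>. is_strategy \<sigma> \<Longrightarrow> posterior_loss N \<rho> \<sigma> n h = K * enn2real (weighted_loss \<sigma> prior_weight (N - n) n h)"
proof -
  obtain \<kappa> where \<kappa>: "\<kappa> > 0" "\<And>p. posterior_weight \<rho> n h p = \<kappa> * (likelihood n h (means p) * \<rho> (snd p))"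
    using posterior_weight_eq[OF h pos] by blast
  have n1: "1 \<le> n"
  proof (rule ccontr)
    assume "\<not> 1 \<le> n"
    then show False using pos by (simp add: applications_def)
  qed
  let ?w = "\<lambda>p. likelihood n h (means p) * \<rho> (snd p)"
  have w_nonneg: "0 \<le> ?w p" for p by (simp add: likelihood_nonneg scaled_dens_nonneg)
  let ?Z = "\<integral>p. posterior_weight \<rho> n h p \<partial>(lborel \<Otimes>\<^sub>M lborel)"
  have "?Z = \<kappa> * (\<integral>p. ?w p \<partial>(lborel \<Otimes>\<^sub>M lborel))"
    unfolding \<kappa>(2) by simp
  also have "(\<integral>p. ?w p \<partial>(lborel \<Otimes>\<^sub>M lborel)) = enn2real (\<integral>\<^sup>+p. ennreal (?w p) \<partial>(lborel \<Otimes>\<^sub>M lborel))"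
    by (intro integral_eq_nn_integral) (auto simp: w_nonneg)
  finally have Z: "?Z > 0"
    using \<kappa>(1) nn_integral_likelihood[OF n1 h] by (simp add: enn2real_positive_iff zero_less_iff_neq_zero)
  show ?thesis
  proof
    show "\<kappa> / ?Z > 0" using \<kappa>(1) Z by simp
    fix \<sigma> assume \<sigma>: "is_strategy \<sigma>"
    have [measurable]: "(\<lambda>p. exp_loss \<sigma> (means p) (N - n) n h) \<in> borel_measurable (borel \<Otimes>\<^sub>M borel)"
      using h by (intro borel_measurable_exp_loss_comp[OF \<sigma>] measurable_const measurable_means)
    have "posterior_loss N \<rho> \<sigma> n h =
      (\<integral>p. \<kappa> / ?Z * (enn2real (exp_loss \<sigma> (means p) (N - n) n h) * ?w p) \<partial>(lborel \<Otimes>\<^sub>M lborel))"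
      unfolding posterior_loss_def posterior_dens_def split_beta prod.collapse \<kappa>(2)
        remaining_loss_eq[OF \<sigma> h n] means_def[symmetric] by (simp add: mult_ac)
    also have "\<dots> = \<kappa> / ?Z * (\<integral>p. enn2real (exp_loss \<sigma> (means p) (N - n) n h) * ?w p \<partial>(lborel \<Otimes>\<^sub>M lborel))"
      by (rule integral_mult_right_zero)
    also have "(\<integral>p. enn2real (exp_loss \<sigma> (means p) (N - n) n h) * ?w p \<partial>(lborel \<Otimes>\<^sub>M lborel)) =
      enn2real (\<integral>\<^sup>+p. ennreal (enn2real (exp_loss \<sigma> (means p) (N - n) n h) * ?w p) \<partial>(lborel \<Otimes>\<^sub>M lborel))"
      by (intro integral_eq_nn_integral) (auto simp: w_nonneg)
    also have "(\<integral>\<^sup>+p. ennreal (enn2real (exp_loss \<sigma> (means p) (N - n) n h) * ?w p) \<partial>(lborel \<Otimes>\<^sub>M lborel)) =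
      weighted_loss \<sigma> prior_weight (N - n) n h"
      unfolding weighted_loss_def
      using exp_loss_finite[OF \<sigma> h, of _ "N - n"]
      by (intro nn_integral_cong) (simp add: ennreal_mult w_nonneg)
    finally show "posterior_loss N \<rho> \<sigma> n h = \<kappa> / ?Z * enn2real (weighted_loss \<sigma> prior_weight (N - n) n h)" .
  qed
qed

section \<open>An explicit limiting strategy\<close>

text \<open>Chosen as a witness for existence and for attaining the risk. Ties go to arm 1, and so
  do the times other than \<open>0\<close> and \<open>M\<close> at which some arm has not been
  applied.\<close>

definition packet_choice :: "nat \<Rightarrow> history \<Rightarrow> nat" where
  "packet_choice n h =
     (if n = 0 then 1 else if n = M then 2
      else if applications n h 1 > 0 \<and> applications n h 2 > 0 \<and>
        r_act c varrho \<epsilon> 2 (ustat n h) (arm_time n h 1) (arm_time n h 2) <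
        r_act c varrho \<epsilon> 1 (ustat n h) (arm_time n h 1) (arm_time n h 2) then 2 else 1)"

definition greedy_strategy :: strategy where
  "greedy_strategy n h = return action_space (if M dvd n then packet_choice n h else fst (h (n - 1)))"

lemma borel_measurable_ustat [measurable]: "(\<lambda>h. ustat n h) \<in> borel_measurable (hist_space n)"
proof -
  have [measurable]: "(\<lambda>h. real (applications n h l)) \<in> borel_measurable (hist_space n)" for l
    by (rule measurable_compose[OF measurable_applications]) simp
  note [measurable] = borel_measurable_total_income
  show ?thesis unfolding ustat_def by measurable
qed

text \<open>Measurability of \<open>r_act\<close> is known in \<open>u\<close> for fixed positive
  times only, so the counts are first restricted to their finitely many possible values.\<close>

lemma measurable_packet_choice: "packet_choice n \<in> hist_space n \<rightarrow>\<^sub>M action_space"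
proof -
  let ?r = "\<lambda>l h a b. r_act c varrho \<epsilon> l (ustat n h) (real a / real N) (real b / real N)"
  let ?Q = "\<lambda>h. \<exists>a\<in>{1..n}. \<exists>b\<in>{1..n}. (applications n h 1 = a \<and> applications n h 2 = b) \<and> ?r 2 h a b < ?r 1 h a b"
  have app: "Measurable.pred (hist_space n) (\<lambda>h. applications n h l = a)" for l a
    by (rule measurable_compose[OF measurable_applications, where g = "\<lambda>k. k = a"]) simp
  have r: "(\<lambda>h. ?r l h a b) \<in> borel_measurable (hist_space n)" if "1 \<le> a" "1 \<le> b" "l \<in> {1, 2}" for l a b
    using that N_pos by (intro measurable_compose[OF borel_measurable_ustat exp_growth_measurable[OF exp_growth_r_act]]) auto
  have Q: "Measurable.pred (hist_space n) ?Q"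
    using r by (intro pred_intros_finite pred_intros_logic app borel_measurable_less) auto
  have bound: "applications n h l \<le> n" for h l
  proof -
    have "card {k. k < n \<and> fst (h k) = l} \<le> card {..<n}" by (rule card_mono) auto
    then show ?thesis by (simp add: applications_def)
  qed
  have eq: "packet_choice n = (\<lambda>h. if n = 0 then 1 else if n = M then 2 else if ?Q h then 2 else 1)"
    using bound by (auto simp: packet_choice_def arm_time_def fun_eq_iff Suc_le_eq)
  have "(\<lambda>h. if ?Q h then 2 else 1) \<in> hist_space n \<rightarrow>\<^sub>M action_space"
    using Q by (intro measurable_If) (auto simp: pred_def)
  then show ?thesis unfolding eq by (cases "n = 0"; cases "n = M") simp_all
qed

lemma packet_strategy_greedy: "packet_strategy M greedy_strategy"
  unfolding packet_strategy_def is_strategy_def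
proof (intro conjI allI impI ballI)
  fix n
  have "(\<lambda>h. if M dvd n then packet_choice n h else fst (h (n - 1))) \<in> hist_space n \<rightarrow>\<^sub>M action_space"
  proof (cases "M dvd n")
    case True
    then show ?thesis using measurable_packet_choice[of n] by simp
  next
    case False
    then have "0 < n" by (intro Nat.gr0I) auto
    then show ?thesis using False measurable_hist_fst[of "n - 1" n] by simp
  qed
  from measurable_compose[OF this measurable_return_prob_space]
  show "greedy_strategy n \<in> hist_space n \<rightarrow>\<^sub>M prob_algebra action_space"
    by (simp add: greedy_strategy_def[abs_def])
qed (simp add: greedy_strategy_def)

lemma decision_history_pos:
  assumes "decision_history N M n h"
  shows "n < N" "M dvd n" "h \<in> space (hist_space n)" "applications n h 1 > 0" "applications n h 2 > 0" "2 * M \<le> n"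
proof -
  show "n < N" "M dvd n" and h: "h \<in> space (hist_space n)" "applications n h 1 > 0" "applications n h 2 > 0"
    using assms M_ge by (auto simp: decision_history_def)
  show "2 * M \<le> n"
  proof -
    have "applications n h 1 + applications n h 2 = n"
      by (rule applications_sum) (rule fst_hist[OF h(1)])
    moreover have "M \<le> applications n h 1" "M \<le> applications n h 2"
      using assms by (simp_all add: decision_history_def)
    ultimately show ?thesis by linarith
  qed
qed

text \<open>Reads the comparison of the two recursion values as equality in the Bellman inequality,
  the form that the induction can use.\<close>

lemma smaller_r_iff:
  assumes d: "decision_history N M n h" and l: "l \<in> {1, 2}"
  shows "smaller_r N M c varrho n h l \<longleftrightarrow> hist_packet_val l M n h = hist_val n h"
proof -
  note d' = decision_history_pos[OF d]
  have t: "0 < arm_time n h 1" "0 < arm_time n h 2" "arm_time n h 1 + arm_time n h 2 < 1"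
    unfolding arm_time_sum[OF d'(3)] using d' N_pos by (auto simp: arm_time_def)
  have "hist_packet_val l M n h = r_act c varrho \<epsilon> l (ustat n h) (arm_time n h 1) (arm_time n h 2)"
    using l t packet_val_M[of "arm_time n h 1" "arm_time n h 2" 1] packet_val_M[of "arm_time n h 2" "arm_time n h 1" 2]
    by (auto simp: hist_packet_val_def own_def add.commute)
  moreover have "hist_val n h = r_fun c varrho \<epsilon> (ustat n h) (arm_time n h 1) (arm_time n h 2)"
    using t d'(2) by (simp add: hist_val_def r_ext_def)
  ultimately show ?thesis
    unfolding smaller_r_def Let_def eps_eq[symmetric] arm_time_def ustat_def by simp
qed

lemma limiting_strategy_greedy: "limiting_strategy N M c varrho greedy_strategy"
  unfolding limiting_strategy_def
proof (intro conjI packet_strategy_greedy bexI[of _ 1] allI impI ballI)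
  show "greedy_strategy 0 h = return action_space 1" for h
    by (simp add: greedy_strategy_def packet_choice_def)
  show "greedy_strategy M h = return action_space (3 - 1)" for h
    using M_ge by (simp add: greedy_strategy_def packet_choice_def)
  fix n h l assume d: "decision_history N M n h" and l: "l \<in> {1, 2}" and pos: "0 < measure (greedy_strategy n h) {l}"
  note d' = decision_history_pos[OF d]
  have "n \<noteq> 0" "n \<noteq> M" using d'(6) M_ge by auto
  moreover have "packet_choice n h = l"
    using pos d'(2) l by (auto simp: greedy_strategy_def measure_return indicator_def split: if_splits)
  ultimately show "smaller_r N M c varrho n h l"
    using d' unfolding packet_choice_def smaller_r_def Let_def eps_eq[symmetric] arm_time_def ustat_def r_fun_def
    by (auto split: if_splits)
qed simp

definition packet_history :: "nat \<Rightarrow> history \<Rightarrow> bool" where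
  "packet_history n h \<longleftrightarrow> (\<forall>j<n. \<forall>k<n. j div M = k div M \<longrightarrow> fst (h j) = fst (h k))"

text \<open>If an earlier step shares the packet of step \<open>n\<close>, then \<open>n\<close>
  does not start a packet and step \<open>n - 1\<close> shares it too, so repeating the last action
  agrees with the whole packet.\<close>

lemma packet_history_upd:
  assumes "packet_history n h" "\<not> M dvd n \<Longrightarrow> y = fst (h (n - 1))"
  shows "packet_history (Suc n) (h(n := (y, x)))"
proof -
  have *: "fst (h j) = y" if "j < n" "j div M = n div M" for j
  proof -
    have "\<not> M dvd n"
    proof
      assume "M dvd n"
      then have "n = n div M * M" by (rule dvd_div_mult_self[symmetric])
      also have "\<dots> = j div M * M" using that by simp
      also have "\<dots> \<le> j" by (rule div_times_less_eq_dividend)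
      finally show False using that by simp
    qed
    moreover have "(n - 1) div M = n div M"
    proof (rule antisym)
      show "(n - 1) div M \<le> n div M" by (rule div_le_mono) simp
      have "j div M \<le> (n - 1) div M" using that(1) by (intro div_le_mono) simp
      then show "n div M \<le> (n - 1) div M" using that(2) by simp
    qed
    moreover have "n - 1 < n" using that(1) by simp
    ultimately have "fst (h j) = fst (h (n - 1))"
      using assms(1)[unfolded packet_history_def, rule_format, of j "n - 1"] that by simp
    then show ?thesis using assms(2) \<open>\<not> M dvd n\<close> by simp
  qed
  show ?thesis
    unfolding packet_history_def
  proof (intro allI impI)
    fix j k assume "j < Suc n" "k < Suc n" "j div M = k div M"
    then consider "j = n" "k = n" | "j = n" "k < n" "k div M = n div M" | "k = n" "j < n" "j div M = n div M"
      | "j < n" "k < n" "j div M = k div M"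
      by (metis less_Suc_eq)
    then show "fst ((h(n := (y, x))) j) = fst ((h(n := (y, x))) k)"
    proof cases
      case 2
      then show ?thesis using *[of k] by simp
    next
      case 3
      then show ?thesis using *[of j] by simp
    next
      case 4
      then show ?thesis using assms(1)[unfolded packet_history_def, rule_format, of j k] by simp
    qed simp
  qed
qed

lemma decision_history_iff:
  "decision_history N M n h \<longleftrightarrow> n < N \<and> M dvd n \<and> h \<in> space (hist_space n) \<and> packet_history n h \<and>
     applications n h 1 \<ge> M \<and> applications n h 2 \<ge> M"
  by (simp add: decision_history_def packet_history_def)

lemma applications_upd_mono: "applications n h l \<le> applications (Suc n) (h(n := z)) l"
  by (simp add: applications_Suc applications_upd)

lemma emeasure_strategy_pos:
  assumes "packet_strategy M \<sigma>" "h \<in> space (hist_space n)" "emeasure (\<sigma> n h) {y} \<noteq> 0"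
  shows "0 < measure (\<sigma> n h) {y}"
proof -
  interpret prob_space "\<sigma> n h"
    using strategy_prob_algebra[OF packet_strategy_is_strategy[OF assms(1)] assms(2)] by (simp add: space_prob_algebra)
  show ?thesis using assms(3) by (simp add: emeasure_eq_measure zero_less_measure_iff)
qed

lemma packet_strategy_action:
  assumes "packet_strategy M \<sigma>" "h \<in> space (hist_space n)" "y \<in> {1, 2}" "emeasure (\<sigma> n h) {y} \<noteq> 0" "\<not> M dvd n"
  shows "y = fst (h (n - 1))"
  using packet_strategy_emeasure[OF assms(1,5,2,3)] assms(4) by (auto split: if_splits)

text \<open>The strategy may deviate from the optimal choices before time \<open>n0\<close>.\<close>

lemma weighted_loss_optimal:
  assumes \<sigma>: "packet_strategy M \<sigma>"
    and opt: "\<And>m g l. n0 \<le> m \<Longrightarrow> decision_history N M m g \<Longrightarrow> l \<in> {1, 2} \<Longrightarrow> measure (\<sigma> m g) {l} > 0 \<Longrightarrow>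
      smaller_r N M c varrho m g l"
    and "n0 \<le> n" "n \<le> N" "1 \<le> n" "h \<in> space (hist_space n)" "packet_history n h"
    and "applications n h 1 \<ge> M" "applications n h 2 \<ge> M"
  shows "weighted_loss \<sigma> prior_weight (N - n) n h = ennreal (predictive n h * sqrt N * hist_val n h)"
proof (rule weighted_loss_eq[OF \<sigma>, where P = "\<lambda>n h. n0 \<le> n \<and> packet_history n h \<and> applications n h 1 \<ge> M \<and> applications n h 2 \<ge> M"])
  fix n h y x
  assume P: "n0 \<le> n \<and> packet_history n h \<and> applications n h 1 \<ge> M \<and> applications n h 2 \<ge> M"
    and n: "1 \<le> n" "n < N" and h: "h \<in> space (hist_space n)" and y: "y \<in> {1, 2}" and e: "emeasure (\<sigma> n h) {y} \<noteq> 0"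
  show "n0 \<le> Suc n \<and> packet_history (Suc n) (h(n := (y, x))) \<and>
    applications (Suc n) (h(n := (y, x))) 1 \<ge> M \<and> applications (Suc n) (h(n := (y, x))) 2 \<ge> M"
    using P packet_history_upd[of n h y x] packet_strategy_action[OF \<sigma> h y e]
      order_trans[OF _ applications_upd_mono] by auto
next
  fix n h y
  assume P: "n0 \<le> n \<and> packet_history n h \<and> applications n h 1 \<ge> M \<and> applications n h 2 \<ge> M"
    and n: "1 \<le> n" "n < N" and h: "h \<in> space (hist_space n)" and y: "y \<in> {1, 2}" and e: "emeasure (\<sigma> n h) {y} \<noteq> 0"
    and M: "M dvd n"
  have d: "decision_history N M n h"
    using P n h M by (simp add: decision_history_iff)
  then show "hist_packet_val y M n h = hist_val n h"
    using opt[OF _ d y emeasure_strategy_pos[OF \<sigma> h e]] P smaller_r_iff[OF d y] by simp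
qed (use assms in auto)

lemma weighted_loss_return:
  assumes \<sigma>: "is_strategy \<sigma>" and h: "h \<in> space (hist_space n)" and l: "l \<in> {1, 2}"
    and eq: "\<sigma> n h = return action_space l" and \<pi>_nonneg: "\<And>p. 0 \<le> \<pi> p"
    and \<pi>: "\<pi> \<in> borel_measurable (borel \<Otimes>\<^sub>M borel)"
  shows "weighted_loss \<sigma> \<pi> (Suc k) n h =
    weighted_gap \<pi> l n h + (\<integral>\<^sup>+x. weighted_loss \<sigma> \<pi> k (Suc n) (h(n := (l, x))) \<partial>lborel)"
proof -
  have e: "emeasure (\<sigma> n h) {y} = (if y = l then 1 else 0)" if "y \<in> {1, 2}" for y
    using that by (auto simp: eq)
  show ?thesis
    unfolding weighted_loss_Suc[OF \<sigma> h \<pi> \<pi>_nonneg]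
    using l by (elim insertE emptyE) (simp_all add: e)
qed

text \<open>A strategy that begins with \<open>l\<close> loses at least the value of a packet with
  \<open>l\<close>, while \<open>greedy_strategy\<close> attains the optimal value; so optimality of
  \<open>l\<close> forces the two values to agree. Conversely, \<open>greedy_strategy\<close>
  altered at the single history \<open>h\<close> attains the optimum.\<close>

lemma currently_optimal_iff:
  assumes d: "decision_history N M n h" and l: "l \<in> {1, 2}"
  shows "currently_optimal N M \<rho> n h l \<longleftrightarrow> smaller_r N M c varrho n h l"
proof -
  note d' = decision_history_pos[OF d]
  have n: "1 \<le> n" using d'(6) M_ge by simp
  have ph: "packet_history n h" "applications n h 1 \<ge> M" "applications n h 2 \<ge> M"
    using d by (auto simp: decision_history_iff)
  let ?B = "predictive n h * sqrt N"
  let ?W = "\<lambda>\<sigma>. weighted_loss \<sigma> prior_weight (N - n) n h"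
  have B: "0 < ?B" using predictive_pos[of n h] sqrt_N_pos by simp
  obtain K where K: "K > 0" "\<And>\<sigma>. is_strategy \<sigma> \<Longrightarrow> posterior_loss N \<rho> \<sigma> n h = K * enn2real (?W \<sigma>)"
    using posterior_loss_eq[OF less_imp_le[OF d'(1)] d'(3,4,5)] by blast
  have fin: "?W \<sigma> < \<infinity>" if "is_strategy \<sigma>" for \<sigma>
    using weighted_loss_finite[OF that n d'(3)] by simp
  have le_iff: "posterior_loss N \<rho> \<sigma> n h \<le> posterior_loss N \<rho> \<sigma>' n h \<longleftrightarrow> ?W \<sigma> \<le> ?W \<sigma>'"
    if "is_strategy \<sigma>" "is_strategy \<sigma>'" for \<sigma> \<sigma>'
  proof -
    have "enn2real x \<le> enn2real y \<longleftrightarrow> x \<le> y" if "x < \<infinity>" "y < \<infinity>" for x y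
      using that by (cases x; cases y) auto
    then show ?thesis using that K fin by simp
  qed
  have V_le: "ennreal (?B * hist_val n h) \<le> ?W \<sigma>" if "packet_strategy M \<sigma>" for \<sigma>
    using d' by (intro weighted_loss_ge[OF that n]) auto
  have hv: "0 \<le> hist_packet_val l M n h" "hist_val n h \<le> hist_packet_val l M n h"
    using hist_packet_val_nonneg[OF n d'(3) l] r_ext_le_hist_packet_val[OF n d'(1,3) l] d'(2)
    by (auto simp: hist_val_def)
  have hv0: "0 \<le> hist_val n h"
    using exp_growth_nonneg[OF exp_growth_r_ext[OF arm_time_nonneg arm_time_nonneg], of n h 1 n h 2 "ustat n h"]
      arm_time_sum[OF d'(3)] n N_pos d'(2) by (simp add: hist_val_def)
  have nm: "n mod M = 0" using d'(2) by simp
  obtain k where k: "N - n = Suc k" using d'(1) by (metis Suc_diff_Suc)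
  have first: "?W \<sigma> = weighted_gap prior_weight l n h +
      (\<integral>\<^sup>+x. weighted_loss \<sigma> prior_weight k (Suc n) (h(n := (l, x))) \<partial>lborel)"
    if "packet_strategy M \<sigma>" "\<sigma> n h = return action_space l" for \<sigma>
    unfolding k using that d'(3) l
    by (intro weighted_loss_return) (auto simp: packet_strategy_is_strategy scaled_dens_nonneg)
  have opt: "smaller_r N M c varrho m g l'"
    if "decision_history N M m g" "l' \<in> {1, 2}" "measure (greedy_strategy m g) {l'} > 0" for m g l'
    using limiting_strategy_greedy that unfolding limiting_strategy_def by blast
  show ?thesis
    unfolding smaller_r_iff[OF d l]
  proof
    assume "currently_optimal N M \<rho> n h l"
    then obtain \<sigma> where \<sigma>: "packet_strategy M \<sigma>" "\<sigma> n h = return action_space l"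
      and min: "\<And>\<sigma>'. packet_strategy M \<sigma>' \<Longrightarrow> posterior_loss N \<rho> \<sigma> n h \<le> posterior_loss N \<rho> \<sigma>' n h"
      unfolding currently_optimal_def by blast
    have "ennreal (?B * hist_packet_val l M n h) = weighted_gap prior_weight l n h +
      (\<integral>\<^sup>+x. ennreal (predictive (Suc n) (h(n := (l, x))) * sqrt N * hist_val (Suc n) (h(n := (l, x)))) \<partial>lborel)"
      using weighted_gap_hist_val[OF n d'(3) l] nm by simp
    also have "\<dots> \<le> ?W \<sigma>"
      unfolding first[OF \<sigma>] using d' k l
      by (intro add_left_mono nn_integral_mono weighted_loss_ge[OF \<sigma>(1)] hist_space_upd) auto
    also have "\<dots> \<le> ?W greedy_strategy"
      using min[OF packet_strategy_greedy] le_iff \<sigma>(1) packet_strategy_greedy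
      by (simp add: packet_strategy_is_strategy)
    also have "\<dots> = ennreal (?B * hist_val n h)"
      using d' n ph opt by (intro weighted_loss_optimal[OF packet_strategy_greedy, where ?n0.0 = 0]) auto
    finally have "?B * hist_packet_val l M n h \<le> ?B * hist_val n h"
      using B hv0 by (subst (asm) ennreal_le_iff) auto
    then have "hist_packet_val l M n h \<le> hist_val n h"
      by (rule mult_left_le_imp_le[OF _ B])
    then show "hist_packet_val l M n h = hist_val n h"
      using hv by simp
  next
    assume eq: "hist_packet_val l M n h = hist_val n h"
    \<comment> \<open>The alteration preserves measurability because singletons are measurable, and
      the packet rule because \<open>n\<close> is a multiple of \<open>M\<close>. From
      \<open>Suc n\<close> on nothing changes, so the later choices remain optimal.\<close>
    define \<sigma> where "\<sigma> = greedy_strategy(n := (greedy_strategy n)(h := return action_space l))"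
    have "packet_strategy M \<sigma>"
    proof -
      have single: "{h} \<in> sets (hist_space n)"
      proof -
        have "{h} = PiE {0..<n} (\<lambda>i. {h i})"
          using d'(3) unfolding space_hist_space PiE_iff by (intro PiE_singleton[symmetric]) simp
        moreover have "{h i} \<in> sets obs_space" if "i \<in> {0..<n}" for i
        proof -
          have "{fst (h i)} \<times> {snd (h i)} \<in> sets obs_space"
            using fst_hist[OF d'(3), of i] that unfolding obs_space_def by (intro pair_measureI) auto
          then show ?thesis by simp
        qed
        ultimately show ?thesis
          unfolding hist_space_def by (simp add: sets_PiM_I_finite)
      qed
      have G: "greedy_strategy m \<in> hist_space m \<rightarrow>\<^sub>M prob_algebra action_space" for m
        using packet_strategy_greedy by (simp add: packet_strategy_def is_strategy_def)
      have R: "return action_space l \<in> space (prob_algebra action_space)"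
        using l by (auto simp: space_prob_algebra intro!: prob_space_return)
      have "(\<lambda>g. if g \<in> {h} then return action_space l else greedy_strategy n g) \<in> hist_space n \<rightarrow>\<^sub>M prob_algebra action_space"
        using single G R by (intro measurable_If_set measurable_const) (auto intro: sets.Int)
      moreover have "\<sigma> n = (\<lambda>g. if g \<in> {h} then return action_space l else greedy_strategy n g)"
        by (simp add: \<sigma>_def fun_eq_iff)
      ultimately have "\<sigma> n \<in> hist_space n \<rightarrow>\<^sub>M prob_algebra action_space"
        by (simp only:)
      then have "\<sigma> m \<in> hist_space m \<rightarrow>\<^sub>M prob_algebra action_space" for m
        using G by (cases "m = n") (auto simp: \<sigma>_def)
      then show ?thesis
        using packet_strategy_greedy d'(2) by (auto simp: packet_strategy_def is_strategy_def \<sigma>_def)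
    qed
    moreover have "\<sigma> n h = return action_space l" by (simp add: \<sigma>_def)
    ultimately have "?W \<sigma> = weighted_gap prior_weight l n h +
      (\<integral>\<^sup>+x. weighted_loss \<sigma> prior_weight k (Suc n) (h(n := (l, x))) \<partial>lborel)"
      by (rule first)
    also have "(\<integral>\<^sup>+x. weighted_loss \<sigma> prior_weight k (Suc n) (h(n := (l, x))) \<partial>lborel) =
      (\<integral>\<^sup>+x. ennreal (predictive (Suc n) (h(n := (l, x))) * sqrt N * hist_val (Suc n) (h(n := (l, x)))) \<partial>lborel)"
    proof (rule nn_integral_cong)
      fix x
      have "k = N - Suc n" using k by simp
      moreover have "smaller_r N M c varrho m g l'"
        if "Suc n \<le> m" "decision_history N M m g" "l' \<in> {1, 2}" "measure (\<sigma> m g) {l'} > 0" for m g l'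
        using opt[OF that(2,3)] that by (simp add: \<sigma>_def)
      ultimately show "weighted_loss \<sigma> prior_weight k (Suc n) (h(n := (l, x))) =
        ennreal (predictive (Suc n) (h(n := (l, x))) * sqrt N * hist_val (Suc n) (h(n := (l, x))))"
        using d' ph l packet_history_upd[OF ph(1), of l x] \<open>packet_strategy M \<sigma>\<close>
          order_trans[OF ph(2) applications_upd_mono] order_trans[OF ph(3) applications_upd_mono]
        by (simp only:) (rule weighted_loss_optimal[where ?n0.0 = "Suc n"], auto intro: hist_space_upd)
    qed
    also have "weighted_gap prior_weight l n h + \<dots> = ennreal (?B * hist_val n h)"
      using weighted_gap_hist_val[OF n d'(3) l] nm eq by simp
    finally have "?W \<sigma> = ennreal (?B * hist_val n h)" .
    then show "currently_optimal N M \<rho> n h l"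
      unfolding currently_optimal_def
      using \<open>packet_strategy M \<sigma>\<close> \<open>\<sigma> n h = return action_space l\<close> V_le le_iff
      by (intro exI[of _ \<sigma>]) (auto simp: packet_strategy_is_strategy)
  qed
qed

end

section \<open>Uniform priors on large intervals\<close>

text \<open>Where exactly one of the conditions holds, \<open>m\<close> lies within
  \<open>\<bar>d\<bar>\<close> of \<open>a\<close> or of \<open>- a\<close>. These two intervals
  have total length \<open>4 * \<bar>d\<bar>\<close>, whatever \<open>a\<close> is.\<close>

lemma nn_integral_xor_le:
  fixes a d :: real
  shows "(\<integral>\<^sup>+m. indicator {m. (\<bar>m + d\<bar> \<le> a) \<noteq> (\<bar>m\<bar> \<le> a)} m \<partial>lborel) \<le> ennreal (4 * \<bar>d\<bar>)"
proof -
  have "(\<integral>\<^sup>+m. indicator {m. (\<bar>m + d\<bar> \<le> a) \<noteq> (\<bar>m\<bar> \<le> a)} m \<partial>lborel) \<le>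
    (\<integral>\<^sup>+m. indicator {a - \<bar>d\<bar>..a + \<bar>d\<bar>} m + indicator {- a - \<bar>d\<bar>..- a + \<bar>d\<bar>} m \<partial>lborel)"
  proof (rule nn_integral_mono)
    fix m
    have "m \<in> {a - \<bar>d\<bar>..a + \<bar>d\<bar>} \<union> {- a - \<bar>d\<bar>..- a + \<bar>d\<bar>}" if "(\<bar>m + d\<bar> \<le> a) \<noteq> (\<bar>m\<bar> \<le> a)"
    proof -
      have "\<bar>m + d\<bar> \<le> a \<and> a < \<bar>m\<bar> \<or> a < \<bar>m + d\<bar> \<and> \<bar>m\<bar> \<le> a"
        using that by (simp only: not_le[symmetric]) blast
      then have "\<bar>m\<bar> - a \<le> \<bar>d\<bar>" "a - \<bar>m\<bar> \<le> \<bar>d\<bar>" by linarith+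
      then show ?thesis by (cases "0 \<le> m") simp_all
    qed
    then show "indicator {m. (\<bar>m + d\<bar> \<le> a) \<noteq> (\<bar>m\<bar> \<le> a)} m \<le>
      (indicator {a - \<bar>d\<bar>..a + \<bar>d\<bar>} m + indicator {- a - \<bar>d\<bar>..- a + \<bar>d\<bar>} m :: ennreal)"
      unfolding indicator_def by (simp only: mem_Collect_eq) (auto simp del: atLeastAtMost_iff)
  qed
  also have "\<dots> = ennreal (2 * \<bar>d\<bar>) + ennreal (2 * \<bar>d\<bar>)"
    by (subst nn_integral_add) (auto simp: nn_integral_indicator)
  also have "\<dots> = ennreal (4 * \<bar>d\<bar>)"
    by (simp flip: ennreal_plus)
  finally show ?thesis .
qed

context bandit
begin

text \<open>For \<open>a > 0\<close> this is the prior density times \<open>2 * a\<close>. Without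
  normalization the error of truncation stays bounded in \<open>a\<close>; the division by
  \<open>2 * a\<close> is made only for \<open>bayes_loss\<close>.\<close>

definition uniform_weight :: "real \<Rightarrow> real \<times> real \<Rightarrow> real" where
  "uniform_weight a p = indicator {-a..a} (fst p) * \<rho> (snd p)"

lemma uniform_weight_nonneg: "0 \<le> uniform_weight a p"
  by (simp add: uniform_weight_def scaled_dens_nonneg)

lemma borel_measurable_uniform_weight [measurable]: "uniform_weight a \<in> borel_measurable (borel \<Otimes>\<^sub>M borel)"
  unfolding uniform_weight_def[abs_def] by measurable

abbreviation empty_history :: history where
  "empty_history \<equiv> \<lambda>_. undefined"

lemma empty_history: "empty_history \<in> space (hist_space 0)"
  by (auto simp: space_hist_space)

lemma likelihood_0: "likelihood 0 h \<theta> = 1"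
  by (simp add: likelihood_def)

lemma bayes_loss_eq:
  assumes \<sigma>: "is_strategy \<sigma>" and a: "0 < a"
  shows "bayes_loss N (prior N c varrho a) \<sigma> =
    enn2real (weighted_loss \<sigma> (uniform_weight a) N 0 empty_history) / (2 * a)"
proof -
  let ?e = "\<lambda>p. exp_loss \<sigma> (means p) N 0 empty_history"
  have [measurable]: "?e \<in> borel_measurable (borel \<Otimes>\<^sub>M borel)"
    using empty_history by (intro borel_measurable_exp_loss_comp[OF \<sigma>] measurable_const measurable_means)
  have "bayes_loss N (prior N c varrho a) \<sigma> =
    (\<integral>p. enn2real (?e p) * uniform_weight a p / (2 * a) \<partial>(lborel \<Otimes>\<^sub>M lborel))"
    unfolding bayes_loss_def split_beta prior_def loss_eq_remaining_loss[OF \<sigma>]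
      remaining_loss_eq[OF \<sigma> empty_history le0] means_def[symmetric]
    by (simp add: uniform_dens_def uniform_weight_def mult_ac)
  also have "\<dots> = (\<integral>p. enn2real (?e p) * uniform_weight a p \<partial>(lborel \<Otimes>\<^sub>M lborel)) / (2 * a)"
    by (rule integral_divide_zero)
  also have "(\<integral>p. enn2real (?e p) * uniform_weight a p \<partial>(lborel \<Otimes>\<^sub>M lborel)) =
    enn2real (\<integral>\<^sup>+p. ennreal (enn2real (?e p) * uniform_weight a p) \<partial>(lborel \<Otimes>\<^sub>M lborel))"
    by (intro integral_eq_nn_integral) (auto simp: uniform_weight_nonneg)
  also have "(\<integral>\<^sup>+p. ennreal (enn2real (?e p) * uniform_weight a p) \<partial>(lborel \<Otimes>\<^sub>M lborel)) =
    weighted_loss \<sigma> (uniform_weight a) N 0 empty_history"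
    unfolding weighted_loss_def likelihood_0
    using exp_loss_finite[OF \<sigma> empty_history, of _ N]
    by (intro nn_integral_cong) (simp add: ennreal_mult uniform_weight_nonneg)
  finally show ?thesis .
qed

lemma bayes_loss_nonneg: "is_strategy \<sigma> \<Longrightarrow> 0 < a \<Longrightarrow> 0 \<le> bayes_loss N (prior N c varrho a) \<sigma>"
  by (simp add: bayes_loss_eq)

lemma nn_integral_uniform_weight:
  assumes "0 < a" and [measurable]: "f \<in> borel_measurable borel"
  shows "(\<integral>\<^sup>+p. f (snd p) * ennreal (uniform_weight a p) \<partial>(lborel \<Otimes>\<^sub>M lborel)) =
    ennreal (2 * a) * (\<integral>\<^sup>+v. f v * ennreal (\<rho> v) \<partial>lborel)"
proof -
  have "(\<lambda>p. f (snd p) * ennreal (uniform_weight a p)) \<in> borel_measurable (lborel \<Otimes>\<^sub>M lborel)"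
    by measurable
  from lborel_pair.nn_integral_snd[OF this, symmetric]
  have "(\<integral>\<^sup>+p. f (snd p) * ennreal (uniform_weight a p) \<partial>(lborel \<Otimes>\<^sub>M lborel)) =
    (\<integral>\<^sup>+v. (\<integral>\<^sup>+m. f v * ennreal (uniform_weight a (m, v)) \<partial>lborel) \<partial>lborel)"
    by simp
  also have "\<dots> = (\<integral>\<^sup>+v. ennreal (2 * a) * (f v * ennreal (\<rho> v)) \<partial>lborel)"
  proof (rule nn_integral_cong)
    fix v
    have "(\<integral>\<^sup>+m. f v * ennreal (uniform_weight a (m, v)) \<partial>lborel) =
      (\<integral>\<^sup>+m. f v * ennreal (\<rho> v) * indicator {-a..a} m \<partial>lborel)"
      by (intro nn_integral_cong) (simp add: uniform_weight_def indicator_def)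
    also have "\<dots> = f v * ennreal (\<rho> v) * ennreal (2 * a)"
      using assms(1) by (subst nn_integral_cmult_indicator) simp_all
    finally show "(\<integral>\<^sup>+m. f v * ennreal (uniform_weight a (m, v)) \<partial>lborel) =
      ennreal (2 * a) * (f v * ennreal (\<rho> v))"
      by (simp add: mult.commute)
  qed
  also have "\<dots> = ennreal (2 * a) * (\<integral>\<^sup>+v. f v * ennreal (\<rho> v) \<partial>lborel)"
    by (rule nn_integral_cmult) measurable
  finally show ?thesis .
qed

lemma weighted_loss_uniform_finite:
  assumes \<sigma>: "is_strategy \<sigma>" and a: "0 < a"
  shows "weighted_loss \<sigma> (uniform_weight a) N 0 empty_history < \<infinity>"
proof -
  let ?C = "ennreal (real N * (2 * (c / sqrt N)))"
  have "weighted_loss \<sigma> (uniform_weight a) N 0 empty_history \<le>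
    (\<integral>\<^sup>+p. ?C * ennreal (uniform_weight a p) \<partial>(lborel \<Otimes>\<^sub>M lborel))"
    unfolding weighted_loss_def likelihood_0
  proof (rule nn_integral_mono)
    fix p
    show "exp_loss \<sigma> (means p) N 0 empty_history * ennreal (1 * uniform_weight a p) \<le> ?C * ennreal (uniform_weight a p)"
      using exp_loss_le_support[OF \<sigma> empty_history, of N p] by (simp add: uniform_weight_def indicator_def)
  qed
  also have "\<dots> = ennreal (2 * a) * (\<integral>\<^sup>+v. ?C * ennreal (\<rho> v) \<partial>lborel)"
    by (rule nn_integral_uniform_weight[OF a]) measurable
  also have "\<dots> < \<infinity>"
    by (simp add: nn_integral_cmult nn_integral_scaled_dens_1 ennreal_mult_less_top)
  finally show ?thesis .
qed

text \<open>The loss rate while nothing is known about \<open>w\<close>; by evenness it is the prior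
  mean of \<open>\<bar>w\<bar>\<close>.\<close>

definition gap0 :: real where
  "gap0 = g_info 1 0 0"

lemma gap0_nonneg: "0 \<le> gap0"
  by (simp add: gap0_def g_info_nonneg)

lemma g_fun_gap0: "p * q = 0 \<Longrightarrow> g_fun c varrho l 0 p q = gap0"
  by (simp only: g_fun_eq gap0_def div_0 g_info_0[of l 0 1])

lemma gap0_eq: "gap0 = 2 * (LINT w:{0..c}|lborel. w * varrho w)"
proof -
  have "gap0 = (\<integral>w. 2 * (indicator {0..c} w * (w * varrho w)) \<partial>lborel)"
    unfolding gap0_def g_info_def using c_pos
    by (intro Bochner_Integration.integral_cong) (auto simp: dens_def indicator_def)
  then show ?thesis by (simp add: set_lebesgue_integral_def)
qed

lemma weighted_gap_uniform:
  assumes a: "0 < a" and l: "l \<in> {1, 2}"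
  shows "weighted_gap (uniform_weight a) l 0 empty_history = ennreal (2 * a * (gap0 / sqrt N))"
proof -
  have "weighted_gap (uniform_weight a) l 0 empty_history =
    (\<integral>\<^sup>+p. ennreal (\<bar>snd p\<bar> + (-1) ^ l * snd p) * ennreal (uniform_weight a p) \<partial>(lborel \<Otimes>\<^sub>M lborel))"
    unfolding weighted_gap_def likelihood_0
    by (intro nn_integral_cong)
      (simp add: gap_means[OF l, of "fst p" "snd p" for p, simplified] ennreal_mult'' uniform_weight_nonneg)
  also have "\<dots> = ennreal (2 * a) * (\<integral>\<^sup>+v. ennreal (\<bar>v\<bar> + (-1) ^ l * v) * ennreal (\<rho> v) \<partial>lborel)"
    by (rule nn_integral_uniform_weight[OF a]) measurable
  also have "(\<integral>\<^sup>+v. ennreal (\<bar>v\<bar> + (-1) ^ l * v) * ennreal (\<rho> v) \<partial>lborel) = ennreal (gap0 / sqrt N)"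
    using nn_integral_arm_gap[OF l, of 0 0] by (simp add: gap0_def g_info_0[of l 0 1])
  also have "ennreal (2 * a) * ennreal (gap0 / sqrt N) = ennreal (2 * a * (gap0 / sqrt N))"
    using a by (intro ennreal_mult'[symmetric]) simp
  finally show ?thesis .
qed

text \<open>Truncating \<open>m\<close> to \<open>[-a, a]\<close> or the first income instead differs by a bounded amount.\<close>

definition truncation_error :: ennreal where
  "truncation_error = ennreal (real N * (2 * (c / sqrt N))) *
     (ennreal (4 * (c / sqrt N)) + 4 * (\<integral>\<^sup>+t. ennreal (std_normal_density t * \<bar>t\<bar>) \<partial>lborel))"

lemma truncation_error_finite: "truncation_error < \<infinity>"
proof -
  have "(\<integral>\<^sup>+t. ennreal (std_normal_density t * \<bar>t\<bar>) \<partial>lborel) < \<infinity>"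
    using integrable_std_normal_moment_abs[of 1] by (subst nn_integral_eq_integral) auto
  then show ?thesis
    by (simp add: truncation_error_def ennreal_mult_less_top)
qed

text \<open>With the income written as its mean plus noise \<open>t\<close>, the displacement from
  \<open>m\<close> is \<open>sgn_arm y * v + t\<close>. For a fixed displacement, the integral over
  \<open>m\<close> is at most four times its size, and this bound has a finite mean.\<close>

lemma nn_integral_truncation_le:
  assumes y: "y \<in> {1, 2}"
  shows "(\<integral>\<^sup>+p. (\<integral>\<^sup>+x. ennreal (normal_density (arm_mean (means p) y) 1 x * \<rho> (snd p)) *
      indicator {x. (\<bar>x\<bar> \<le> a) \<noteq> (\<bar>fst p\<bar> \<le> a)} x \<partial>lborel) \<partial>(lborel \<Otimes>\<^sub>M lborel)) \<le>
    ennreal (4 * (c / sqrt N)) + 4 * (\<integral>\<^sup>+t. ennreal (std_normal_density t * \<bar>t\<bar>) \<partial>lborel)"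
proof -
  let ?s = "\<lambda>v. sgn_arm y * v"
  let ?X = "\<lambda>m d. indicator {m. (\<bar>m + d\<bar> \<le> a) \<noteq> (\<bar>m\<bar> \<le> a)} m :: ennreal"
  have X_meas [measurable]: "(\<lambda>q. ?X (f q) (g q)) \<in> borel_measurable K"
    if [measurable]: "f \<in> borel_measurable K" "g \<in> borel_measurable K" for f g and K :: "'z measure"
  proof -
    have "(\<lambda>q. ?X (f q) (g q)) = indicator {q. (\<bar>f q + g q\<bar> \<le> a) \<noteq> (\<bar>f q\<bar> \<le> a)}"
      by (auto simp: fun_eq_iff indicator_def)
    moreover have "(\<lambda>q. if (\<bar>f q + g q\<bar> \<le> a) \<noteq> (\<bar>f q\<bar> \<le> a) then 1 else 0 :: ennreal) \<in> borel_measurable K"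
      by measurable
    ultimately show ?thesis by (simp add: indicator_def)
  qed
  have shift: "(\<integral>\<^sup>+x. ennreal (normal_density (arm_mean (means p) y) 1 x * \<rho> (snd p)) *
      indicator {x. (\<bar>x\<bar> \<le> a) \<noteq> (\<bar>fst p\<bar> \<le> a)} x \<partial>lborel) =
    (\<integral>\<^sup>+t. ennreal (std_normal_density t * \<rho> (snd p)) * ?X (fst p) (?s (snd p) + t) \<partial>lborel)" for p
  proof -
    have mean: "arm_mean (means p) y = fst p + ?s (snd p)"
      by (simp add: arm_mean_eq means_def sgn_arm_def)
    have [measurable]: "(\<lambda>x. indicator {x. (\<bar>x\<bar> \<le> a) \<noteq> (\<bar>fst p\<bar> \<le> a)} x :: ennreal) \<in> borel_measurable borel"
      by measurable
    have "(\<integral>\<^sup>+x. ennreal (normal_density (arm_mean (means p) y) 1 x * \<rho> (snd p)) *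
        indicator {x. (\<bar>x\<bar> \<le> a) \<noteq> (\<bar>fst p\<bar> \<le> a)} x \<partial>lborel) =
      (\<integral>\<^sup>+t. ennreal (normal_density (arm_mean (means p) y) 1 (arm_mean (means p) y + t) * \<rho> (snd p)) *
        indicator {x. (\<bar>x\<bar> \<le> a) \<noteq> (\<bar>fst p\<bar> \<le> a)} (arm_mean (means p) y + t) \<partial>lborel)"
      by (subst nn_integral_real_affine[where c = 1 and t = "arm_mean (means p) y"]) auto
    also have "\<dots> = (\<integral>\<^sup>+t. ennreal (std_normal_density t * \<rho> (snd p)) * ?X (fst p) (?s (snd p) + t) \<partial>lborel)"
    proof (rule nn_integral_cong)
      fix t
      have "normal_density (arm_mean (means p) y) 1 (arm_mean (means p) y + t) = std_normal_density t"
        by (simp add: normal_density_def)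
      moreover have "indicator {x. (\<bar>x\<bar> \<le> a) \<noteq> (\<bar>fst p\<bar> \<le> a)} (arm_mean (means p) y + t) =
        ?X (fst p) (?s (snd p) + t)"
        unfolding mean by (simp add: indicator_def add.assoc)
      ultimately show "ennreal (normal_density (arm_mean (means p) y) 1 (arm_mean (means p) y + t) * \<rho> (snd p)) *
        indicator {x. (\<bar>x\<bar> \<le> a) \<noteq> (\<bar>fst p\<bar> \<le> a)} (arm_mean (means p) y + t) =
        ennreal (std_normal_density t * \<rho> (snd p)) * ?X (fst p) (?s (snd p) + t)"
        by simp
    qed
    finally show ?thesis .
  qed
  let ?f = "\<lambda>m v t. ennreal (std_normal_density t * \<rho> v) * ?X m (?s v + t)"
  have "(\<integral>\<^sup>+p. (\<integral>\<^sup>+x. ennreal (normal_density (arm_mean (means p) y) 1 x * \<rho> (snd p)) *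
      indicator {x. (\<bar>x\<bar> \<le> a) \<noteq> (\<bar>fst p\<bar> \<le> a)} x \<partial>lborel) \<partial>(lborel \<Otimes>\<^sub>M lborel)) =
    (\<integral>\<^sup>+v. (\<integral>\<^sup>+m. (\<integral>\<^sup>+t. ?f m v t \<partial>lborel) \<partial>lborel) \<partial>lborel)"
  proof -
    have "(\<lambda>p. \<integral>\<^sup>+t. ?f (fst p) (snd p) t \<partial>lborel) \<in> borel_measurable (lborel \<Otimes>\<^sub>M lborel)"
      by (rule lborel.borel_measurable_nn_integral) (simp add: split_beta, measurable)
    from lborel_pair.nn_integral_snd[OF this] show ?thesis
      unfolding shift by simp
  qed
  \<comment> \<open>The integral over \<open>m\<close> must come first: only there does the bound
    become independent of \<open>a\<close>.\<close>
  also have "\<dots> = (\<integral>\<^sup>+v. (\<integral>\<^sup>+t. (\<integral>\<^sup>+m. ?f m v t \<partial>lborel) \<partial>lborel) \<partial>lborel)"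
    by (intro nn_integral_cong lborel_pair.Fubini') (simp add: split_beta, measurable)
  also have "\<dots> \<le> (\<integral>\<^sup>+v. (\<integral>\<^sup>+t. (ennreal (4 * (c / sqrt N)) * ennreal (std_normal_density t) +
      4 * ennreal (std_normal_density t * \<bar>t\<bar>)) * ennreal (\<rho> v) \<partial>lborel) \<partial>lborel)"
  proof (intro nn_integral_mono)
    fix v t
    show "(\<integral>\<^sup>+m. ?f m v t \<partial>lborel) \<le> (ennreal (4 * (c / sqrt N)) * ennreal (std_normal_density t) +
      4 * ennreal (std_normal_density t * \<bar>t\<bar>)) * ennreal (\<rho> v)"
    proof (cases "\<rho> v = 0")
      case False
      have "\<bar>?s v + t\<bar> \<le> \<bar>v\<bar> + \<bar>t\<bar>"
        using abs_triangle_ineq[of "?s v" t] by (simp add: sgn_arm_def split: if_splits)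
      then have d: "\<bar>?s v + t\<bar> \<le> c / sqrt N + \<bar>t\<bar>"
        using scaled_dens_support[OF False] by linarith
      have "(\<integral>\<^sup>+m. ?f m v t \<partial>lborel) = ennreal (std_normal_density t * \<rho> v) * (\<integral>\<^sup>+m. ?X m (?s v + t) \<partial>lborel)"
        by (rule nn_integral_cmult) measurable
      also have "\<dots> \<le> ennreal (std_normal_density t * \<rho> v) * ennreal (4 * (c / sqrt N + \<bar>t\<bar>))"
        using d by (intro mult_left_mono order_trans[OF nn_integral_xor_le] ennreal_leI) auto
      also have "\<dots> = ennreal ((4 * (c / sqrt N) * std_normal_density t + 4 * (std_normal_density t * \<bar>t\<bar>)) * \<rho> v)"
        using c_pos by (subst ennreal_mult''[symmetric]) (simp_all add: algebra_simps)
      also have "\<dots> = (ennreal (4 * (c / sqrt N)) * ennreal (std_normal_density t) +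
          4 * ennreal (std_normal_density t * \<bar>t\<bar>)) * ennreal (\<rho> v)"
      proof -
        have e: "ennreal (A * x + 4 * z) = ennreal A * ennreal x + 4 * ennreal z" if "0 \<le> A" "0 \<le> x" "0 \<le> z" for A x z
          using that by (simp add: ennreal_plus ennreal_mult)
        show ?thesis
          unfolding ennreal_mult''[OF scaled_dens_nonneg] using c_pos by (subst e) simp_all
      qed
      finally show ?thesis .
    qed simp
  qed
  also have "\<dots> = (\<integral>\<^sup>+v. (ennreal (4 * (c / sqrt N)) + 4 * (\<integral>\<^sup>+t. ennreal (std_normal_density t * \<bar>t\<bar>) \<partial>lborel)) *
      ennreal (\<rho> v) \<partial>lborel)"
    by (intro nn_integral_cong)
      (simp add: nn_integral_multc nn_integral_add nn_integral_cmult nn_integral_normal_density)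
  also have "\<dots> = ennreal (4 * (c / sqrt N)) + 4 * (\<integral>\<^sup>+t. ennreal (std_normal_density t * \<bar>t\<bar>) \<partial>lborel)"
    by (simp add: nn_integral_cmult nn_integral_scaled_dens_1)
  finally show ?thesis .
qed

text \<open>Both sides integrate the same function of income and parameter, against indicators that
  differ only where exactly one of income and \<open>m\<close> lies in \<open>[-a, a]\<close>. There
  the regret is replaced by its largest value and the mass is bounded by
  \<open>nn_integral_truncation_le\<close>.\<close>

lemma truncation:
  assumes \<sigma>: "is_strategy \<sigma>" and y: "y \<in> {1, 2}"
  defines "h1 \<equiv> \<lambda>x. empty_history(0 := (y, x))"
  shows "(\<integral>\<^sup>+x. weighted_loss \<sigma> prior_weight (N - 1) 1 (h1 x) * indicator {-a..a} x \<partial>lborel) \<le>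
      (\<integral>\<^sup>+x. weighted_loss \<sigma> (uniform_weight a) (N - 1) 1 (h1 x) \<partial>lborel) + truncation_error"
    and "(\<integral>\<^sup>+x. weighted_loss \<sigma> (uniform_weight a) (N - 1) 1 (h1 x) \<partial>lborel) \<le>
      (\<integral>\<^sup>+x. weighted_loss \<sigma> prior_weight (N - 1) 1 (h1 x) * indicator {-a..a} x \<partial>lborel) + truncation_error"
proof -
  let ?P = "lborel \<Otimes>\<^sub>M lborel :: (real \<times> real) measure"
  let ?Q = "?P \<Otimes>\<^sub>M lborel :: ((real \<times> real) \<times> real) measure"
  interpret pp: pair_sigma_finite ?P "lborel :: real measure"
    unfolding lborel_prod by standard
  let ?C = "ennreal (real N * (2 * (c / sqrt N)))"
  let ?B = "\<lambda>q. ennreal (normal_density (arm_mean (means (fst q)) y) 1 (snd q) * \<rho> (snd (fst q)))"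
  let ?A = "\<lambda>q. exp_loss \<sigma> (means (fst q)) (N - 1) 1 (h1 (snd q)) * ?B q"
  let ?x = "\<lambda>q. indicator {-a..a} (snd q) :: ennreal" and ?m = "\<lambda>q. indicator {-a..a} (fst (fst q)) :: ennreal"
  let ?D = "\<lambda>q. indicator {x. (\<bar>x\<bar> \<le> a) \<noteq> (\<bar>fst (fst q)\<bar> \<le> a)} (snd q) :: ennreal"
  have h1: "h1 x \<in> space (hist_space 1)" for x
    using hist_space_upd[OF empty_history y] by (simp add: h1_def)
  have lik: "likelihood 1 (h1 x) \<theta> = normal_density (arm_mean \<theta> y) 1 x" for x \<theta>
    by (simp add: likelihood_def h1_def)
  have B_meas [measurable]: "?B \<in> borel_measurable ?Q"
  proof -
    have [measurable]: "(\<lambda>q. arm_mean (means (fst q)) y) \<in> borel_measurable ?Q"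
      by (rule measurable_compose[OF _ borel_measurable_arm_mean]) measurable
    show ?thesis by measurable
  qed
  have A_meas [measurable]: "?A \<in> borel_measurable ?Q"
  proof -
    have "(\<lambda>q. empty_history(0 := (y, snd q))) \<in> ?Q \<rightarrow>\<^sub>M hist_space (Suc 0)"
      using y empty_history by (intro measurable_hist_upd measurable_const) measurable
    then have [measurable]: "(\<lambda>q. exp_loss \<sigma> (means (fst q)) (N - 1) 1 (h1 (snd q))) \<in> borel_measurable ?Q"
      unfolding h1_def One_nat_def by (rule borel_measurable_exp_loss_comp[OF \<sigma>]) measurable
    show ?thesis by measurable
  qed
  have D_meas [measurable]: "?D \<in> borel_measurable ?Q"
  proof -
    have "(\<lambda>q. if (\<bar>snd q\<bar> \<le> a) \<noteq> (\<bar>fst (fst q)\<bar> \<le> a) then 1 else 0 :: ennreal) \<in> borel_measurable ?Q"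
      by measurable
    then show ?thesis by (simp add: indicator_def)
  qed
  have x_eq: "(\<integral>\<^sup>+x. weighted_loss \<sigma> prior_weight (N - 1) 1 (h1 x) * indicator {-a..a} x \<partial>lborel) = (\<integral>\<^sup>+q. ?A q * ?x q \<partial>?Q)"
  proof -
    have m: "(\<lambda>q. ?A q * ?x q) \<in> borel_measurable ?Q" by measurable
    have "(\<integral>\<^sup>+q. ?A q * ?x q \<partial>?Q) = (\<integral>\<^sup>+x. (\<integral>\<^sup>+p. ?A (p, x) * ?x (p, x) \<partial>?P) \<partial>lborel)"
      by (rule pp.nn_integral_snd[OF m, symmetric])
    also have "\<dots> = (\<integral>\<^sup>+x. weighted_loss \<sigma> prior_weight (N - 1) 1 (h1 x) * indicator {-a..a} x \<partial>lborel)"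
    proof (rule nn_integral_cong)
      fix x :: real
      have "(\<lambda>p. ?A (p, x)) \<in> borel_measurable ?P"
        by (rule measurable_compose[OF _ A_meas]) measurable
      from nn_integral_multc[OF this, of "indicator {-a..a} x"]
      show "(\<integral>\<^sup>+p. ?A (p, x) * ?x (p, x) \<partial>?P) = weighted_loss \<sigma> prior_weight (N - 1) 1 (h1 x) * indicator {-a..a} x"
        by (simp add: weighted_loss_def lik[unfolded One_nat_def])
    qed
    finally show ?thesis by simp
  qed
  have m_eq: "(\<integral>\<^sup>+x. weighted_loss \<sigma> (uniform_weight a) (N - 1) 1 (h1 x) \<partial>lborel) = (\<integral>\<^sup>+q. ?A q * ?m q \<partial>?Q)"
  proof -
    have m: "(\<lambda>q. ?A q * ?m q) \<in> borel_measurable ?Q" by measurable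
    have "(\<integral>\<^sup>+q. ?A q * ?m q \<partial>?Q) = (\<integral>\<^sup>+x. (\<integral>\<^sup>+p. ?A (p, x) * ?m (p, x) \<partial>?P) \<partial>lborel)"
      by (rule pp.nn_integral_snd[OF m, symmetric])
    also have "\<dots> = (\<integral>\<^sup>+x. weighted_loss \<sigma> (uniform_weight a) (N - 1) 1 (h1 x) \<partial>lborel)"
      unfolding weighted_loss_def lik
      by (intro nn_integral_cong) (simp add: uniform_weight_def indicator_def)
    finally show ?thesis by simp
  qed
  have le: "?A q \<le> ?C * ?B q" for q
    using mult_right_mono[OF exp_loss_le_support[OF \<sigma> h1, of "N - 1" "fst q" "snd q"],
        of "ennreal (normal_density (arm_mean (means (fst q)) y) 1 (snd q))"]
    by (simp add: ennreal_mult scaled_dens_nonneg mult_ac)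
  have "(\<integral>\<^sup>+q. ?C * ?B q * ?D q \<partial>?Q) = ?C * (\<integral>\<^sup>+q. ?B q * ?D q \<partial>?Q)"
    unfolding mult.assoc by (rule nn_integral_cmult) measurable
  also have "(\<integral>\<^sup>+q. ?B q * ?D q \<partial>?Q) = (\<integral>\<^sup>+p. (\<integral>\<^sup>+x. ?B (p, x) * ?D (p, x) \<partial>lborel) \<partial>?P)"
    by (rule lborel.nn_integral_fst[symmetric]) measurable
  also have "?C * \<dots> \<le> truncation_error"
    unfolding truncation_error_def using nn_integral_truncation_le[OF y, of a]
    by (intro mult_left_mono) simp_all
  finally have err: "(\<integral>\<^sup>+q. ?C * ?B q * ?D q \<partial>?Q) \<le> truncation_error" .
  \<comment> \<open>The exceptional set is symmetric in the two truncations, so one inequality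
    serves both directions.\<close>
  have ineq: "(\<integral>\<^sup>+q. ?A q * i q \<partial>?Q) \<le> (\<integral>\<^sup>+q. ?A q * j q \<partial>?Q) + truncation_error"
    if [measurable]: "i \<in> borel_measurable ?Q" "j \<in> borel_measurable ?Q" and ij: "\<And>q. i q \<le> j q + ?D q"
    for i j :: "(real \<times> real) \<times> real \<Rightarrow> ennreal"
  proof -
    have "(\<integral>\<^sup>+q. ?A q * i q \<partial>?Q) \<le> (\<integral>\<^sup>+q. ?A q * j q + ?C * ?B q * ?D q \<partial>?Q)"
    proof (rule nn_integral_mono)
      fix q
      have "?A q * i q \<le> ?A q * (j q + ?D q)" by (intro mult_left_mono ij) simp
      also have "\<dots> \<le> ?A q * j q + ?C * ?B q * ?D q"
        unfolding distrib_left by (intro add_left_mono mult_right_mono le) simp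
      finally show "?A q * i q \<le> ?A q * j q + ?C * ?B q * ?D q" .
    qed
    also have "\<dots> = (\<integral>\<^sup>+q. ?A q * j q \<partial>?Q) + (\<integral>\<^sup>+q. ?C * ?B q * ?D q \<partial>?Q)"
      by (rule nn_integral_add) measurable
    finally show ?thesis using err by (meson add_left_mono order_trans)
  qed
  show "(\<integral>\<^sup>+x. weighted_loss \<sigma> prior_weight (N - 1) 1 (h1 x) * indicator {-a..a} x \<partial>lborel) \<le>
      (\<integral>\<^sup>+x. weighted_loss \<sigma> (uniform_weight a) (N - 1) 1 (h1 x) \<partial>lborel) + truncation_error"
    unfolding x_eq m_eq by (rule ineq) (measurable, auto simp: indicator_def abs_le_iff)
  show "(\<integral>\<^sup>+x. weighted_loss \<sigma> (uniform_weight a) (N - 1) 1 (h1 x) \<partial>lborel) \<le>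
      (\<integral>\<^sup>+x. weighted_loss \<sigma> prior_weight (N - 1) 1 (h1 x) * indicator {-a..a} x \<partial>lborel) + truncation_error"
    unfolding x_eq m_eq by (rule ineq) (measurable, auto simp: indicator_def abs_le_iff)
qed

section \<open>The value after the first step\<close>

definition r_start :: real where
  "r_start = (\<integral>u. r_fun c varrho \<epsilon> u \<epsilon> \<epsilon> * normal_density 0 (sqrt (\<epsilon> / 2)) u \<partial>lborel)"

text \<open>The variance of \<open>u\<close> gathered by the second packet is
  \<open>\<epsilon> / 2\<close>, and a reflection of the integration variable removes the sign in
  the convolution at 0. The switch takes place before the horizon because
  \<open>2 * \<epsilon> \<le> 1\<close>.\<close>

lemma one_arm_start:
  assumes "l \<in> {1, 2}"
  shows "one_arm l 0 \<epsilon> = \<epsilon> * gap0 + r_start"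
proof -
  have sv: "step_var \<epsilon> \<epsilon> M = \<epsilon> / 2"
    using eps_pos by (simp add: step_var_M power2_eq_square)
  have "(\<integral>x. r_fun c varrho \<epsilon> (0 - x) \<epsilon> \<epsilon> * normal_density 0 (sqrt (\<epsilon> / 2)) x \<partial>lborel) = r_start"
    unfolding r_start_def
    by (subst lborel_integral_real_affine[where c = "-1" and t = 0]) (simp_all add: normal_density_def)
  moreover have "\<not> 1 \<le> \<epsilon>" using two_eps_le eps_pos by linarith
  ultimately show ?thesis
    using eps_pos unfolding one_arm_def gconv_def own_def sv by (simp add: g_fun_gap0)
qed

text \<open>During the first packet \<open>u = 0\<close>, so its remaining \<open>M - 1\<close>
  applications are charged at the rate \<open>gap0\<close>, and then the arm is switched. For
  \<open>M = 1\<close> the packet is already complete.\<close>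

lemma hist_val_1:
  assumes y: "y \<in> {1, 2}"
  shows "hist_val 1 (empty_history(0 := (y, x))) = (real M - 1) / real N * gap0 + \<epsilon> * gap0 + r_start"
proof -
  let ?h = "empty_history(0 := (y, x))"
  have t: "arm_time 1 ?h l = (if l = y then 1 / real N else 0)" for l
    by (simp add: arm_time_def applications_Suc applications_def[of 0])
  have u: "ustat 1 ?h = 0"
    using y by (intro ustat_eq_0) (auto simp: t[unfolded One_nat_def])
  have y3: "3 - y \<in> {1, 2}" "3 - y \<noteq> y" using y by auto
  have N: "0 < 1 / real N" using N_pos by simp
  show ?thesis
  proof (cases "M = 1")
    case True
    then have e: "1 / real N = \<epsilon>" and M: "M dvd 1" by (simp_all add: eps_eq)
    have hv: "hist_val 1 ?h = one_arm (3 - y) 0 \<epsilon>"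
      unfolding hist_val_def if_P[OF M] t u e using y eps_pos by (auto simp: r_ext_def)
    have "real M - 1 = 0" using True by simp
    then show ?thesis unfolding hv one_arm_start[OF y3(1)] by simp
  next
    case False
    then have M: "1 < M" "\<not> M dvd 1" using M_ge by auto
    have p: "1 / real N + real (M - 1) / real N = \<epsilon>"
      using M by (simp add: eps_eq of_nat_diff flip: add_divide_distrib)
    have "hist_val 1 ?h = packet_val y (M - 1) 0 (1 / real N) 0"
      using M y3 by (simp add: hist_val_def hist_packet_val_def t[unfolded One_nat_def] u[unfolded One_nat_def])
    also have "\<dots> = real (M - 1) / real N * gap0 + one_arm (3 - y) 0 \<epsilon>"
      using y eps_pos unfolding packet_val_def p by (auto simp: g_fun_gap0 gconv_def own_def r_ext_def)
    finally show ?thesis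
      using M by (simp add: one_arm_start[OF y3(1)] of_nat_diff)
  qed
qed

definition limit_risk :: real where
  "limit_risk = sqrt N * (2 * \<epsilon> * gap0 + r_start)"

lemma r_start_nonneg: "0 \<le> r_start"
  unfolding r_start_def
  by (intro Bochner_Integration.integral_nonneg mult_nonneg_nonneg exp_growth_nonneg[OF exp_growth_r_fun]) (auto simp: eps_pos)

lemma limit_risk_nonneg: "0 \<le> limit_risk"
  using eps_pos gap0_nonneg r_start_nonneg by (simp add: limit_risk_def)

text \<open>The first application supplies the share \<open>gap0 / N\<close> missing from the first
  packet, so the two initial packets together cost \<open>2 * \<epsilon> * gap0\<close>. The factor
  \<open>predictive 1\<close> is an empty product.\<close>

lemma limit_risk_eq:
  assumes y: "y \<in> {1, 2}"
  shows "gap0 / sqrt N + predictive 1 (empty_history(0 := (y, x))) * sqrt N * hist_val 1 (empty_history(0 := (y, x))) = limit_risk"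
proof -
  have "gap0 / sqrt N = sqrt N * (gap0 / real N)"
    using sqrt_N_pos by (simp add: field_simps)
  then show ?thesis
    unfolding hist_val_1[OF y] limit_risk_def
    by (simp add: predictive_def eps_eq algebra_simps diff_divide_distrib)
qed

lemma N_Suc: "N = Suc (N - 1)" "1 \<le> N"
  using N_pos by auto

text \<open>After truncation by the first income the integrand is constant on
  \<open>[-a, a]\<close>, which yields the same factor \<open>2 * a\<close> as in the cost of the
  first step.\<close>

lemma uniform_sum:
  assumes a: "0 < a" and y: "y \<in> {1, 2}"
  shows "ennreal (2 * a * (gap0 / sqrt N)) + (\<integral>\<^sup>+x. ennreal (predictive 1 (empty_history(0 := (y, x))) * sqrt N *
      hist_val 1 (empty_history(0 := (y, x)))) * indicator {-a..a} x \<partial>lborel) = ennreal (2 * a * limit_risk)"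
proof -
  let ?v = "limit_risk - gap0 / sqrt N"
  have v: "predictive 1 (empty_history(0 := (y, x))) * sqrt N * hist_val 1 (empty_history(0 := (y, x))) = ?v" for x
    using limit_risk_eq[OF y, of x] by linarith
  have "0 \<le> ?v"
    using M_ge eps_pos gap0_nonneg r_start_nonneg
    unfolding v[symmetric, of 0] hist_val_1[OF y] by (simp add: predictive_def)
  have "(\<integral>\<^sup>+x. ennreal ?v * indicator {-a..a} x \<partial>lborel) = ennreal ?v * ennreal (2 * a)"
    using a by (subst nn_integral_cmult_indicator) simp_all
  also have "\<dots> = ennreal (?v * (2 * a))"
    using a by (intro ennreal_mult''[symmetric]) simp
  also have "ennreal (2 * a * (gap0 / sqrt N)) + \<dots> = ennreal (2 * a * (gap0 / sqrt N) + ?v * (2 * a))"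
    using a gap0_nonneg \<open>0 \<le> ?v\<close> by (intro ennreal_plus[symmetric] mult_nonneg_nonneg) simp_all
  also have "2 * a * (gap0 / sqrt N) + ?v * (2 * a) = 2 * a * limit_risk"
  proof -
    have "2 * a * g + (R - g) * (2 * a) = 2 * a * R" for g R :: real
      by (simp add: algebra_simps)
    then show ?thesis .
  qed
  finally show ?thesis unfolding v .
qed

text \<open>Each first action alone satisfies the bound, and a randomized first action is an average
  of the two.\<close>

lemma weighted_loss_uniform_ge:
  assumes \<sigma>: "packet_strategy M \<sigma>" and a: "0 < a"
  shows "ennreal (2 * a * limit_risk) \<le> weighted_loss \<sigma> (uniform_weight a) N 0 empty_history + truncation_error"
proof -
  note s = packet_strategy_is_strategy[OF \<sigma>]
  let ?T = "\<lambda>y. weighted_gap (uniform_weight a) y 0 empty_history +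
    (\<integral>\<^sup>+x. weighted_loss \<sigma> (uniform_weight a) (N - 1) 1 (empty_history(0 := (y, x))) \<partial>lborel)"
  have T: "ennreal (2 * a * limit_risk) \<le> ?T y + truncation_error" if y: "y \<in> {1, 2}" for y
  proof -
    have "(\<integral>\<^sup>+x. ennreal (predictive 1 (empty_history(0 := (y, x))) * sqrt N *
        hist_val 1 (empty_history(0 := (y, x)))) * indicator {-a..a} x \<partial>lborel) \<le>
      (\<integral>\<^sup>+x. weighted_loss \<sigma> prior_weight (N - 1) 1 (empty_history(0 := (y, x))) * indicator {-a..a} x \<partial>lborel)"
      using N_Suc hist_space_upd[OF empty_history y]
      by (intro nn_integral_mono mult_right_mono weighted_loss_ge[OF \<sigma>]) auto
    also have "\<dots> \<le> (\<integral>\<^sup>+x. weighted_loss \<sigma> (uniform_weight a) (N - 1) 1 (empty_history(0 := (y, x))) \<partial>lborel) + truncation_error"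
      by (rule truncation(1)[OF s y])
    finally show ?thesis
      unfolding uniform_sum[OF a y, symmetric] weighted_gap_uniform[OF a y] add.assoc
      by (rule add_left_mono)
  qed
  have "ennreal (2 * a * limit_risk) = (\<Sum>y\<in>{1, 2}. emeasure (\<sigma> 0 empty_history) {y} * ennreal (2 * a * limit_risk))"
    unfolding sum_distrib_right[symmetric] sum_strategy[OF s empty_history] by simp
  also have "\<dots> \<le> (\<Sum>y\<in>{1, 2}. emeasure (\<sigma> 0 empty_history) {y} * (?T y + truncation_error))"
    by (intro sum_mono mult_left_mono T) auto
  also have "\<dots> = (\<Sum>y\<in>{1, 2}. emeasure (\<sigma> 0 empty_history) {y} * ?T y) + truncation_error"
    unfolding distrib_left sum.distrib sum_distrib_right[symmetric] sum_strategy[OF s empty_history] by simp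
  also have "(\<Sum>y\<in>{1, 2}. emeasure (\<sigma> 0 empty_history) {y} * ?T y) = weighted_loss \<sigma> (uniform_weight a) N 0 empty_history"
    using weighted_loss_Suc[OF s empty_history borel_measurable_uniform_weight uniform_weight_nonneg, of a "N - 1"] N_Suc(1)
    by simp
  finally show ?thesis .
qed

text \<open>The invariant \<open>P\<close> records that the first packet is spent on
  \<open>l\<close> and the second on the other arm. It makes every packet boundary from
  \<open>2 * M\<close> up to, but not including, the horizon a decision history.\<close>

lemma weighted_loss_limiting:
  assumes \<sigma>: "limiting_strategy N M c varrho \<sigma>"
  obtains l where "l \<in> {1, 2}" "\<sigma> 0 empty_history = return action_space l"
    "\<And>x. weighted_loss \<sigma> prior_weight (N - 1) 1 (empty_history(0 := (l, x))) =
      ennreal (predictive 1 (empty_history(0 := (l, x))) * sqrt N * hist_val 1 (empty_history(0 := (l, x))))"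
proof -
  obtain l where l: "l \<in> {1, 2}"
    and first: "\<And>h. h \<in> space (hist_space 0) \<Longrightarrow> \<sigma> 0 h = return action_space l"
    and second: "\<And>h. h \<in> space (hist_space M) \<Longrightarrow> \<sigma> M h = return action_space (3 - l)"
    using \<sigma> unfolding limiting_strategy_def by blast
  have pk: "packet_strategy M \<sigma>" using \<sigma> by (simp add: limiting_strategy_def)
  define P where "P n h \<longleftrightarrow> packet_history n h \<and> (\<forall>k<n. k < M \<longrightarrow> fst (h k) = l) \<and>
    (\<forall>k<n. M \<le> k \<longrightarrow> k < 2 * M \<longrightarrow> fst (h k) = 3 - l)" for n and h :: history
  have l3: "3 - l \<in> {1, 2}" "3 - l \<noteq> l" using l by auto
  have step: "P (Suc n) (h(n := (y, x)))"
    if Pn: "P n h" and n: "1 \<le> n" "n < N" and h: "h \<in> space (hist_space n)" and y: "y \<in> {1, 2}"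
      and e: "emeasure (\<sigma> n h) {y} \<noteq> 0" for n h y x
  proof -
    have nd: "y = fst (h (n - 1))" if "\<not> M dvd n"
      using packet_strategy_action[OF pk h y e that] .
    have "y = l" if "n < M"
    proof -
      have "\<not> M dvd n" using that n by (simp add: nat_dvd_not_less)
      then show ?thesis using nd Pn n that unfolding P_def by simp
    qed
    moreover have "y = 3 - l" if "M \<le> n" "n < 2 * M"
    proof (cases "n = M")
      case True
      then show ?thesis using e second h y by (auto simp: indicator_def split: if_splits)
    next
      case False
      have "\<not> M dvd n"
      proof
        assume "M dvd n"
        then obtain k where "n = M * k" by blast
        then show False using that False M_ge by (cases k; cases "k - 1") auto
      qed
      then show ?thesis using nd Pn n that False unfolding P_def by simp
    qed
    ultimately show ?thesis
      using Pn packet_history_upd[of n h y x] nd unfolding P_def by (auto simp: less_Suc_eq)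
  qed
  have opt: "hist_packet_val y M n h = hist_val n h"
    if Pn: "P n h" and n: "1 \<le> n" "n < N" and h: "h \<in> space (hist_space n)" and y: "y \<in> {1, 2}"
      and e: "emeasure (\<sigma> n h) {y} \<noteq> 0" and M: "M dvd n" for n h y
  proof -
    have Mn: "M \<le> n" using M n by (intro dvd_imp_le) auto
    have appl: "M \<le> applications n h l"
    proof -
      have "card {..<M} \<le> card {k. k < n \<and> fst (h k) = l}"
        using Pn Mn unfolding P_def by (intro card_mono) auto
      then show ?thesis by (simp add: applications_def)
    qed
    show ?thesis
    proof (cases "n = M")
      case True
      have y3: "y = 3 - l"
        using e second h y True by (auto simp: indicator_def split: if_splits)
      have "applications n h (3 - l) = 0"
        using Pn l3 True unfolding P_def by (auto simp: applications_def)
      then have t0: "arm_time n h (3 - l) = 0" by (simp add: arm_time_def)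
      have ll: "3 - (3 - l) = l" using l by auto
      have tl: "arm_time n h l = real n / real N"
        using arm_time_sum'[OF h l] t0 by simp
      have tpos: "0 < arm_time n h l" "arm_time n h l < 1"
        unfolding tl using n by auto
      \<comment> \<open>Only \<open>l\<close> is known here, and the prescribed choice is the switch
        by which the extended value is defined.\<close>
      have "hist_packet_val y M n h = one_arm (3 - l) (ustat n h) (arm_time n h l)"
        unfolding hist_packet_val_def y3 ll t0 by (rule packet_val_M_new[OF tpos])
      also have "\<dots> = hist_val n h"
        using M l t0 tpos by (auto simp: hist_val_def r_ext_def)
      finally show ?thesis .
    next
      case False
      have "2 * M \<le> n"
      proof -
        obtain k where "n = M * k" using M by blast
        then show ?thesis using False Mn n by (cases k; cases "k - 1") auto
      qed
      have appl': "M \<le> applications n h (3 - l)"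
      proof -
        have "card {M..<2 * M} \<le> card {k. k < n \<and> fst (h k) = 3 - l}"
          using Pn \<open>2 * M \<le> n\<close> unfolding P_def by (intro card_mono) auto
        then show ?thesis by (simp add: applications_def)
      qed
      have d: "decision_history N M n h"
        using Pn n h M l appl appl' unfolding P_def decision_history_iff by auto
      then have "smaller_r N M c varrho n h y"
        using \<sigma> y emeasure_strategy_pos[OF pk h e] unfolding limiting_strategy_def by blast
      then show ?thesis using smaller_r_iff[OF d y] by simp
    qed
  qed
  show ?thesis
  proof
    show "l \<in> {1, 2}" "\<sigma> 0 empty_history = return action_space l"
      using l first[OF empty_history] by auto
    fix x
    have "P 1 (empty_history(0 := (l, x)))"
      using M_ge by (simp add: P_def packet_history_def)
    then show "weighted_loss \<sigma> prior_weight (N - 1) 1 (empty_history(0 := (l, x))) =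
      ennreal (predictive 1 (empty_history(0 := (l, x))) * sqrt N * hist_val 1 (empty_history(0 := (l, x))))"
      using N_Suc hist_space_upd[OF empty_history l]
      by (intro weighted_loss_eq[OF pk, where P = P] step opt) auto
  qed
qed

lemma weighted_loss_uniform_le:
  assumes \<sigma>: "limiting_strategy N M c varrho \<sigma>" and a: "0 < a"
  shows "weighted_loss \<sigma> (uniform_weight a) N 0 empty_history \<le> ennreal (2 * a * limit_risk) + truncation_error"
proof -
  have s: "is_strategy \<sigma>"
    using \<sigma> by (simp add: limiting_strategy_def packet_strategy_def)
  obtain l where l: "l \<in> {1, 2}" "\<sigma> 0 empty_history = return action_space l"
    and eq: "\<And>x. weighted_loss \<sigma> prior_weight (N - 1) 1 (empty_history(0 := (l, x))) =
      ennreal (predictive 1 (empty_history(0 := (l, x))) * sqrt N * hist_val 1 (empty_history(0 := (l, x))))"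
    using weighted_loss_limiting[OF \<sigma>] by blast
  have "weighted_loss \<sigma> (uniform_weight a) N 0 empty_history = weighted_gap (uniform_weight a) l 0 empty_history +
    (\<integral>\<^sup>+x. weighted_loss \<sigma> (uniform_weight a) (N - 1) 1 (empty_history(0 := (l, x))) \<partial>lborel)"
    using weighted_loss_return[OF s empty_history l uniform_weight_nonneg borel_measurable_uniform_weight, of a "N - 1"] N_Suc(1)
    by simp
  also have "\<dots> \<le> ennreal (2 * a * (gap0 / sqrt N)) +
    ((\<integral>\<^sup>+x. weighted_loss \<sigma> prior_weight (N - 1) 1 (empty_history(0 := (l, x))) * indicator {-a..a} x \<partial>lborel) + truncation_error)"
    unfolding weighted_gap_uniform[OF a l(1)] by (intro add_left_mono truncation(2)[OF s l(1)])
  also have "\<dots> = ennreal (2 * a * limit_risk) + truncation_error"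
    unfolding eq add.assoc[symmetric] uniform_sum[OF a l(1)] ..
  finally show ?thesis .
qed

section \<open>Passage to the limit\<close>

definition risk_error :: real where
  "risk_error = enn2real truncation_error"

lemma truncation_error_eq: "truncation_error = ennreal risk_error"
  using truncation_error_finite by (simp add: risk_error_def)

lemma risk_error_nonneg: "0 \<le> risk_error"
  by (simp add: risk_error_def)

lemma bayes_loss_ge:
  assumes \<sigma>: "packet_strategy M \<sigma>" and a: "0 < a"
  shows "limit_risk - risk_error / (2 * a) \<le> bayes_loss N (prior N c varrho a) \<sigma>"
proof -
  note s = packet_strategy_is_strategy[OF \<sigma>]
  let ?W = "weighted_loss \<sigma> (uniform_weight a) N 0 empty_history"
  have W: "?W = ennreal (enn2real ?W)"
    using weighted_loss_uniform_finite[OF s a] by simp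
  have "ennreal (2 * a * limit_risk) \<le> ennreal (enn2real ?W + risk_error)"
    using weighted_loss_uniform_ge[OF \<sigma> a] W risk_error_nonneg by (simp add: truncation_error_eq)
  then have "2 * a * limit_risk \<le> enn2real ?W + risk_error"
    using risk_error_nonneg by (subst (asm) ennreal_le_iff) auto
  then have "(2 * a * limit_risk - risk_error) / (2 * a) \<le> enn2real ?W / (2 * a)"
    using a by (intro divide_right_mono) simp_all
  then show ?thesis
    unfolding bayes_loss_eq[OF s a] using a by (simp add: diff_divide_distrib)
qed

lemma bayes_loss_le:
  assumes \<sigma>: "limiting_strategy N M c varrho \<sigma>" and a: "0 < a"
  shows "bayes_loss N (prior N c varrho a) \<sigma> \<le> limit_risk + risk_error / (2 * a)"
proof -
  have s: "is_strategy \<sigma>"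
    using \<sigma> by (simp add: limiting_strategy_def packet_strategy_def)
  let ?W = "weighted_loss \<sigma> (uniform_weight a) N 0 empty_history"
  have W: "?W = ennreal (enn2real ?W)"
    using weighted_loss_uniform_finite[OF s a] by simp
  have R: "0 \<le> 2 * a * limit_risk" using a limit_risk_nonneg by simp
  have "ennreal (enn2real ?W) \<le> ennreal (2 * a * limit_risk + risk_error)"
    using weighted_loss_uniform_le[OF \<sigma> a] W risk_error_nonneg R by (simp add: truncation_error_eq)
  then have "enn2real ?W \<le> 2 * a * limit_risk + risk_error"
    using risk_error_nonneg R by (subst (asm) ennreal_le_iff) auto
  then show ?thesis
    unfolding bayes_loss_eq[OF s a] using a by (simp add: field_simps)
qed

text \<open>Losses are nonnegative and packet strategies exist, so the real infimum runs over a
  nonempty set bounded below and is a genuine one.\<close>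

lemma bayes_risk_bounds:
  assumes a: "0 < a"
  shows "limit_risk - risk_error / (2 * a) \<le> bayes_risk N M (prior N c varrho a)"
    and "\<And>\<sigma>. packet_strategy M \<sigma> \<Longrightarrow> bayes_risk N M (prior N c varrho a) \<le> bayes_loss N (prior N c varrho a) \<sigma>"
proof -
  show "limit_risk - risk_error / (2 * a) \<le> bayes_risk N M (prior N c varrho a)"
    unfolding bayes_risk_def using packet_strategy_greedy bayes_loss_ge[OF _ a]
    by (intro cINF_greatest) auto
  have "bdd_below (bayes_loss N (prior N c varrho a) ` {\<sigma>. packet_strategy M \<sigma>})"
    using bayes_loss_nonneg[OF packet_strategy_is_strategy a] by (intro bdd_belowI2[where m = 0]) auto
  then show "bayes_risk N M (prior N c varrho a) \<le> bayes_loss N (prior N c varrho a) \<sigma>"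
    if "packet_strategy M \<sigma>" for \<sigma>
    unfolding bayes_risk_def using that by (intro cINF_lower) auto
qed

lemma risk_error_tendsto: "((\<lambda>a. K * (risk_error / (2 * a))) \<longlongrightarrow> 0) at_top"
  by real_asymp

text \<open>The lower bound holds for all packet strategies and the upper one for
  \<open>greedy_strategy\<close>; both are within \<open>risk_error / (2 * a)\<close> of the
  limit.\<close>

lemma bayes_risk_tendsto: "((\<lambda>a. bayes_risk N M (prior N c varrho a)) \<longlongrightarrow> limit_risk) at_top"
proof (rule real_tendsto_sandwich)
  show "((\<lambda>a. limit_risk - 1 * (risk_error / (2 * a))) \<longlongrightarrow> limit_risk) at_top"
    "((\<lambda>a. limit_risk + 1 * (risk_error / (2 * a))) \<longlongrightarrow> limit_risk) at_top"
    using tendsto_diff[OF tendsto_const risk_error_tendsto[of 1], of limit_risk]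
      tendsto_add[OF tendsto_const risk_error_tendsto[of 1], of limit_risk] by simp_all
  show "\<forall>\<^sub>F a in at_top. limit_risk - 1 * (risk_error / (2 * a)) \<le> bayes_risk N M (prior N c varrho a)"
    using eventually_gt_at_top[of 0] by eventually_elim (simp add: bayes_risk_bounds(1)[simplified])
  show "\<forall>\<^sub>F a in at_top. bayes_risk N M (prior N c varrho a) \<le> limit_risk + 1 * (risk_error / (2 * a))"
    using eventually_gt_at_top[of 0]
  proof eventually_elim
    case (elim a)
    show ?case
      using bayes_risk_bounds(2)[OF elim packet_strategy_greedy] bayes_loss_le[OF limiting_strategy_greedy elim]
      by simp
  qed
qed

lemma limiting_strategy_bayesian:
  assumes \<sigma>: "limiting_strategy N M c varrho \<sigma>"
  shows "bayesian_in_limit N M (prior N c varrho) \<sigma>"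
  unfolding bayesian_in_limit_def
proof (rule real_tendsto_sandwich)
  have pk: "packet_strategy M \<sigma>" using \<sigma> by (simp add: limiting_strategy_def)
  show "\<forall>\<^sub>F a in at_top. 0 \<le> bayes_loss N (prior N c varrho a) \<sigma> - bayes_risk N M (prior N c varrho a)"
    using eventually_gt_at_top[of 0] by eventually_elim (simp add: bayes_risk_bounds(2)[OF _ pk])
  show "\<forall>\<^sub>F a in at_top. bayes_loss N (prior N c varrho a) \<sigma> - bayes_risk N M (prior N c varrho a) \<le> 2 * (risk_error / (2 * a))"
    using eventually_gt_at_top[of 0]
  proof eventually_elim
    case (elim a)
    show ?case
      using bayes_risk_bounds(1)[OF elim] bayes_loss_le[OF \<sigma> elim] by linarith
  qed
  show "((\<lambda>a. 2 * (risk_error / (2 * a))) \<longlongrightarrow> 0) at_top"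
    by (rule risk_error_tendsto)
qed simp

text \<open>The factor 4 combines the two initial packets with the factor 2 in
  \<open>gap0\<close>.\<close>

lemma limit_risk_formula:
  "limit_risk / sqrt N = 4 * \<epsilon> * (LINT w:{0..c}|lborel. w * varrho w) +
     (\<integral>u. r_fun c varrho \<epsilon> u \<epsilon> \<epsilon> * normal_density 0 (sqrt (\<epsilon> / 2)) u \<partial>lborel)"
  using sqrt_N_pos by (simp add: limit_risk_def gap0_eq r_start_def)

end

theorem theorem2:
  fixes c \<epsilon> :: real and M N :: nat and varrho :: "real \<Rightarrow> real"
  assumes "c > 0"
    and "M \<ge> 1" and "N \<ge> 2 * M" and "M dvd N"
    and "\<epsilon> = real M / real N"
    and "\<And>w. w \<in> {-c..c} \<Longrightarrow> varrho w \<ge> 0"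
    and "set_integrable lborel {-c..c} varrho"
    and "(LINT w:{-c..c}|lborel. varrho w) = 1"
    and "\<And>w. w \<in> {-c..c} \<Longrightarrow> varrho (- w) = varrho w"
  shows "(\<exists>\<sigma>. limiting_strategy N M c varrho \<sigma>) \<and>
         (\<forall>\<sigma>. limiting_strategy N M c varrho \<sigma> \<longrightarrow> bayesian_in_limit N M (prior N c varrho) \<sigma>) \<and>
         (\<forall>n h l. decision_history N M n h \<and> l \<in> {1, 2} \<longrightarrow>
            (currently_optimal N M (scaled_dens N c varrho) n h l \<longleftrightarrow> smaller_r N M c varrho n h l)) \<and>
         (\<exists>R. ((\<lambda>a. bayes_risk N M (prior N c varrho a)) \<longlongrightarrow> R) at_top \<and>
            R / sqrt N =
              4 * \<epsilon> * (LINT w:{0..c}|lborel. w * varrho w) +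
              (\<integral>u. r_fun c varrho \<epsilon> u \<epsilon> \<epsilon> * normal_density 0 (sqrt (\<epsilon> / 2)) u \<partial>lborel))"
proof -
  interpret bandit c \<epsilon> M N varrho
    by unfold_locales (fact assms)+
  show ?thesis
    using limiting_strategy_greedy limiting_strategy_bayesian currently_optimal_iff
      bayes_risk_tendsto limit_risk_formula by blast
qed

end
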